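(* Let $M$ be a matroid of rank $k$ on the ground set $[n]$ and let $\Gamma_M\subset\mathbb{R}^n$ be its matroid polytope. Then $M$ is a positroid if and only if every two-dimensional face of $\Gamma_M$ is a positroid polytope. Moreover, if $M$ is not a positroid, then $\Gamma_M$ has a two-dimensional face whose vertices are exactly $e_{S\cup\{a,b\}}, e_{S\cup\{a,d\}}, e_{S\cup\{b,c\}}, e_{S\cup\{c,d\}}$ for some $1\le a<b<c<d\le n$ and some $S\subseteq[n]$ with $|S|=k-2$ and $S\cap\{a,b,c,d\}=\emptyset$.
   Context: For $I\subseteq[n]$, $e_I=\sum_{i\in I}e_i\in\mathbb{R}^n$ where $e_1,\dots,e_n$ is the standard basis. For a matroid $M$ on $[n]$ with set of bases $\mathcal{B}$, its matroid polytope is $\Gamma_M=\mathrm{conv}\{e_B: B\in\mathcal{B}\}$. A positroid of rank $k$ on $[n]$ is a matroid whose bases are exactly the sets $I\in\binom{[n]}{k}$ with $p_I(A)\neq 0$, for some real $k\times n$ matrix $A$ of rank $k$ all of whose maximal minors $p_I(A)$ are nonnegative. A polytope $F$ is a positroid polytope if $F=\Gamma_{M'}$ for some positroid $M'$ (i.e. the vertex set of $F$, viewed as a collection of subsets of $[n]$, is the set of bases of a positroid). *)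

theory Defs
  imports "HOL-Analysis.Analysis"
begin

text \<open>The ground set [n] is modelled as the universe of a finite linearly ordered
type 'n (so n = CARD('n)); points of R^n are elements of real^'n.\<close>

definition indic_vec :: "'n::finite set \<Rightarrow> real^'n" where
  "indic_vec I = (\<chi> i. if i \<in> I then 1 else 0)"

definition is_matroid_bases :: "nat \<Rightarrow> 'n::finite set set \<Rightarrow> bool" where
  "is_matroid_bases k \<B> \<longleftrightarrow>
     \<B> \<noteq> {} \<and> (\<forall>B\<in>\<B>. card B = k) \<and>
     (\<forall>B1\<in>\<B>. \<forall>B2\<in>\<B>. \<forall>x\<in>B1 - B2. \<exists>y\<in>B2 - B1. insert y (B1 - {x}) \<in> \<B>)"

definition matroid_polytope :: "'n::finite set set \<Rightarrow> (real^'n) set" where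
  "matroid_polytope \<B> = convex hull (indic_vec ` \<B>)"

definition det_nat :: "nat \<Rightarrow> (nat \<Rightarrow> nat \<Rightarrow> real) \<Rightarrow> real" where
  "det_nat k M = (\<Sum>p | p permutes {0..<k}. of_int (sign p) * (\<Prod>i<k. M i (p i)))"

definition max_minor :: "nat \<Rightarrow> (nat \<Rightarrow> 'n::{finite,linorder} \<Rightarrow> real) \<Rightarrow> 'n set \<Rightarrow> real" where
  "max_minor k A I = det_nat k (\<lambda>i j. A i (sorted_list_of_set I ! j))"

definition is_positroid :: "nat \<Rightarrow> 'n::{finite,linorder} set set \<Rightarrow> bool" where
  "is_positroid k \<B> \<longleftrightarrow>
     (\<exists>A :: nat \<Rightarrow> 'n \<Rightarrow> real.
        (\<exists>I. card I = k \<and> max_minor k A I \<noteq> 0) \<comment> \<open>A has rank k\<close>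
      \<and> (\<forall>I. card I = k \<longrightarrow> max_minor k A I \<ge> 0)
      \<and> \<B> = {I. card I = k \<and> max_minor k A I \<noteq> 0})"

definition is_positroid_polytope :: "(real^'n::{finite,linorder}) set \<Rightarrow> bool" where
  "is_positroid_polytope F \<longleftrightarrow>
     (\<exists>k' \<B>'. is_positroid k' \<B>' \<and> F = matroid_polytope \<B>')"

end

theory Submission
  imports Defs "Jordan_Normal_Form.Determinant"
begin

text \<open>Call a family of sets \<^emph>\<open>squares filled\<close> if, whenever \<open>a < b < c < d\<close> and the four sets \<open>Sab\<close>,
  \<open>Sbc\<close>, \<open>Scd\<close>, \<open>Sad\<close> belong to it, so do \<open>Sac\<close> and \<open>Sbd\<close>. By the three-term Pluecker relation every positroid
  has this property, and a matroid violates it exactly when its polytope has a square face of the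
  forbidden kind. The point is that a matroid \<open>M\<close> with filled squares is a positroid.

  First, \<open>M\<close> is determined by the ranks of cyclic intervals. If \<open>I\<close> is not a basis, take \<open>X\<close> with
  \<open>\<bar>I \<inter> X\<bar> > r X\<close> whose boundary in the cyclic order is as small as possible. If \<open>X\<close> were not a cyclic interval,
  minimality would force crossing links \<open>a\<close>, \<open>c\<close> in \<open>M|X\<close> and \<open>b\<close>, \<open>d\<close> in \<open>M/X\<close>, and these produce a square that is
  not filled. Second, the cyclic interval ranks of \<open>M\<close> are encoded by a bounded affine permutation,
  and every such permutation is realized by a totally nonnegative matrix: decompose it into
  transpositions, each of which adds a multiple of one column to another. The support of this matrix
  also has filled squares and the same cyclic interval ranks, so it equals \<open>M\<close>.

  That faces of positroid polytopes are positroid polytopes is seen by row reducing the matrix at an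
  optimal basis and deleting the entries that are not tight.\<close>

section \<open>Rank functions of matroids given by bases\<close>

text \<open>No representation is ever extracted from \<open>M\<close> itself. The reconstruction
  from cyclic interval ranks is applied twice, to \<open>M\<close> and to the support of a matrix
  that knows only those ranks, so the matrix can be built from the permutation alone. The obstacle
  in the reconstruction is to make the two links cross. That neither \<open>M|X\<close> nor
  \<open>M/X\<close> splits along a cut gives some link in each, but says nothing about their
  relative position. Therefore the complement of \<open>X\<close> is not cut at the original
  crossing points but along the link a, c already found, which forces b and d onto different sides
  of it. Minimality is what excludes splitting: otherwise one of the pieces would violate its rank
  bound with fewer runs. In the realization, the coefficient of a column addition can be fixed to 1
  up to sign, without any genericity: the old and the new contribution to a minor are both
  nonnegative and cannot cancel.\<close>

definition rk :: "'a set set \<Rightarrow> 'a set \<Rightarrow> nat" where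
  "rk M X = Max ((\<lambda>B. card (B \<inter> X)) ` M)"

text \<open>The ground set is left out, so that the same facts serve families on \<open>nat\<close>
  and on a finite type. Finiteness of bases is a separate axiom because an infinite set has
  \<open>card\<close> 0.\<close>

locale matroid =
  fixes k :: nat and M :: "'a set set"
  assumes nonempty: "M \<noteq> {}"
    and finite_basis: "B \<in> M \<Longrightarrow> finite B"
    and card_basis: "B \<in> M \<Longrightarrow> card B = k"
    and exchange: "\<lbrakk>B1 \<in> M; B2 \<in> M; x \<in> B1 - B2\<rbrakk> \<Longrightarrow> \<exists>y\<in>B2 - B1. insert y (B1 - {x}) \<in> M"
begin

lemma finite_cards: "finite ((\<lambda>B. card (B \<inter> X)) ` M)"
proof (rule finite_subset)
  show "(\<lambda>B. card (B \<inter> X)) ` M \<subseteq> {..k}"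
    using card_basis finite_basis by (metis (no_types, lifting) atMost_iff card_mono image_subsetI inf_le1)
qed simp

lemma card_Int_le_rk: "B \<in> M \<Longrightarrow> card (B \<inter> X) \<le> rk M X"
  unfolding rk_def using finite_cards by (intro Max_ge) auto

lemma rk_attained: "\<exists>B\<in>M. card (B \<inter> X) = rk M X"
proof -
  have "rk M X \<in> (\<lambda>B. card (B \<inter> X)) ` M"
    unfolding rk_def using finite_cards nonempty by (intro Max_in) auto
  then show ?thesis by auto
qed

lemma rk_le: "(\<And>B. B \<in> M \<Longrightarrow> card (B \<inter> X) \<le> c) \<Longrightarrow> rk M X \<le> c"
  using rk_attained[of X] by metis

lemma rk_mono: "X \<subseteq> Y \<Longrightarrow> rk M X \<le> rk M Y"
proof (rule rk_le)
  fix B assume "B \<in> M" "X \<subseteq> Y"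
  then have "card (B \<inter> X) \<le> card (B \<inter> Y)"
    using finite_basis by (intro card_mono) auto
  also have "\<dots> \<le> rk M Y" using \<open>B \<in> M\<close> by (rule card_Int_le_rk)
  finally show "card (B \<inter> X) \<le> rk M Y" .
qed

lemma rk_insert_le: "rk M (insert e X) \<le> Suc (rk M X)"
proof (rule rk_le)
  fix B assume B: "B \<in> M"
  have "B \<inter> insert e X \<subseteq> insert e (B \<inter> X)" by auto
  then have "card (B \<inter> insert e X) \<le> card (insert e (B \<inter> X))"
    using finite_basis[OF B] by (intro card_mono) auto
  also have "\<dots> \<le> Suc (card (B \<inter> X))" by (rule card_insert_le_m1) auto
  also have "\<dots> \<le> Suc (rk M X)" using card_Int_le_rk[OF B] by simp
  finally show "card (B \<inter> insert e X) \<le> Suc (rk M X)" .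
qed

lemma card_basis_split: "B \<in> M \<Longrightarrow> card (B \<inter> X) + card (B - X) = k"
  using card_basis finite_basis by (metis card_Int_Diff)

lemma rk_le_rank: "rk M X \<le> k"
  using card_basis finite_basis by (intro rk_le) (metis card_mono inf_le1)

text \<open>Starting from \<open>B\<close>, a sequence of exchanges towards a basis that is optimal on \<open>Z\<close> only ever
  removes elements outside \<open>Z\<close>, so optimality on subsets of \<open>Z\<close> is never lost.\<close>

lemma extend_optimal:
  assumes B: "B \<in> M"
  obtains B' where "B' \<in> M" "card (B' \<inter> Z) = rk M Z"
    "\<And>X. X \<subseteq> Z \<Longrightarrow> card (B \<inter> X) = rk M X \<Longrightarrow> card (B' \<inter> X) = rk M X"
proof -
  obtain B2 where B2: "B2 \<in> M" "card (B2 \<inter> Z) = rk M Z" using rk_attained by blast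
  define Q where "Q C \<longleftrightarrow> C \<in> M \<and> (\<forall>X\<subseteq>Z. card (B \<inter> X) = rk M X \<longrightarrow> card (C \<inter> X) = rk M X)" for C
  obtain C where C: "Q C" and min: "\<And>D. Q D \<Longrightarrow> card (C - B2) \<le> card (D - B2)"
    using ex_has_least_nat[of Q B "\<lambda>C. card (C - B2)"] B by (auto simp: Q_def)
  have CM: "C \<in> M" using C by (simp add: Q_def)
  have fin: "finite C" using finite_basis CM .
  have sub: "C - Z \<subseteq> B2 - Z"
  proof (rule ccontr)
    assume "\<not> C - Z \<subseteq> B2 - Z"
    then obtain x where x: "x \<in> C" "x \<notin> Z" "x \<notin> B2" by auto
    then obtain y where y: "y \<in> B2" "y \<notin> C" "insert y (C - {x}) \<in> M"
      using exchange[OF CM B2(1), of x] by auto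
    let ?D = "insert y (C - {x})"
    have "Q ?D" unfolding Q_def
    proof (intro conjI allI impI)
      fix X assume X: "X \<subseteq> Z" "card (B \<inter> X) = rk M X"
      have "card (C \<inter> X) = rk M X" using C X by (auto simp: Q_def)
      moreover have "C \<inter> X \<subseteq> ?D \<inter> X" using x X by auto
      then have "card (C \<inter> X) \<le> card (?D \<inter> X)" using fin by (intro card_mono) auto
      ultimately show "card (?D \<inter> X) = rk M X" using card_Int_le_rk[OF y(3), of X] by simp
    qed (rule y(3))
    moreover have "?D - B2 = (C - B2) - {x}" using y by auto
    then have "card (?D - B2) < card (C - B2)"
      using x fin by (metis DiffI card_Diff1_less finite_Diff)
    ultimately show False using min[of ?D] by simp
  qed
  have "card (C - Z) \<le> card (B2 - Z)" using sub finite_basis[OF B2(1)] by (intro card_mono) auto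
  then have "rk M Z \<le> card (C \<inter> Z)"
    using card_basis_split[OF CM, of Z] card_basis_split[OF B2(1), of Z] B2(2) by linarith
  then have "card (C \<inter> Z) = rk M Z" using card_Int_le_rk[OF CM, of Z] by simp
  then show thesis using that[of C] C by (auto simp: Q_def)
qed

lemma optimal_chain:
  assumes "X \<subseteq> Z"
  obtains B where "B \<in> M" "card (B \<inter> X) = rk M X" "card (B \<inter> Z) = rk M Z"
proof -
  obtain B where "B \<in> M" "card (B \<inter> X) = rk M X" using rk_attained by blast
  then show thesis using assms that by (elim extend_optimal[of B Z]) auto
qed

lemma optimal_chain3:
  assumes "X \<subseteq> Y" "Y \<subseteq> Z"
  obtains B where "B \<in> M" "card (B \<inter> X) = rk M X" "card (B \<inter> Y) = rk M Y" "card (B \<inter> Z) = rk M Z"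
proof -
  obtain B where B: "B \<in> M" "card (B \<inter> X) = rk M X" "card (B \<inter> Y) = rk M Y"
    using optimal_chain[OF assms(1)] .
  obtain B' where "B' \<in> M" "card (B' \<inter> Z) = rk M Z"
    "\<And>X. X \<subseteq> Z \<Longrightarrow> card (B \<inter> X) = rk M X \<Longrightarrow> card (B' \<inter> X) = rk M X"
    using extend_optimal[OF B(1), of Z] by blast
  then show thesis using that[of B'] B assms by auto
qed

text \<open>This is monotonicity of closure. A basis optimal on \<open>X\<close>, \<open>Y\<close>
  and \<open>insert e Y\<close> at once must contain \<open>e\<close> if \<open>e\<close> raises the
  rank of \<open>Y\<close>; its trace on \<open>insert e X\<close> is then too large.\<close>

lemma rk_insert_same_mono:
  assumes "rk M (insert e X) = rk M X" "X \<subseteq> Y"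
  shows "rk M (insert e Y) = rk M Y"
proof (rule ccontr)
  assume "rk M (insert e Y) \<noteq> rk M Y"
  then have ne: "rk M Y < rk M (insert e Y)" using rk_mono[of Y "insert e Y"] by (simp add: subset_insertI)
  obtain B where B: "B \<in> M" "card (B \<inter> X) = rk M X" "card (B \<inter> Y) = rk M Y"
    "card (B \<inter> insert e Y) = rk M (insert e Y)"
    using optimal_chain3[OF assms(2), of "insert e Y"] by auto
  have e: "e \<in> B"
  proof (rule ccontr)
    assume "e \<notin> B"
    then have "B \<inter> insert e Y = B \<inter> Y" by auto
    then show False using B ne by simp
  qed
  have "e \<notin> Y" using ne by (auto simp: insert_absorb)
  then have "e \<notin> X" using assms(2) by auto
  then have "card (B \<inter> insert e X) = Suc (card (B \<inter> X))"
    using e finite_basis[OF B(1)] by (simp add: Int_insert_right)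
  then show False using card_Int_le_rk[OF B(1), of "insert e X"] B assms(1) by simp
qed

text \<open>The bases optimal on \<open>X\<close> are those of the direct sum of \<open>M|X\<close>
  and \<open>M/X\<close>, so their two parts combine freely. Exchanges from \<open>B1\<close>
  towards \<open>B2\<close> that remove elements outside \<open>X\<close> never bring in an element
  of \<open>X\<close>, as that would exceed \<open>rk M X\<close>; the walk ends at the mixed
  set.\<close>

lemma optimal_recombine:
  assumes B1: "B1 \<in> M" "card (B1 \<inter> X) = rk M X" and B2: "B2 \<in> M" "card (B2 \<inter> X) = rk M X"
  shows "(B1 \<inter> X) \<union> (B2 - X) \<in> M"
proof -
  define Q where "Q C \<longleftrightarrow> C \<in> M \<and> C \<inter> X = B1 \<inter> X" for C
  obtain C where C: "C \<in> M" "C \<inter> X = B1 \<inter> X" and min: "\<And>D. Q D \<Longrightarrow> card (C - B2) \<le> card (D - B2)"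
    using ex_has_least_nat[of Q B1 "\<lambda>C. card (C - B2)"] B1 by (auto simp: Q_def)
  have fin: "finite C" using finite_basis C(1) .
  have sub: "C - X \<subseteq> B2 - X"
  proof (rule ccontr)
    assume "\<not> C - X \<subseteq> B2 - X"
    then obtain x where x: "x \<in> C" "x \<notin> X" "x \<notin> B2" by auto
    then obtain y where y: "y \<in> B2" "y \<notin> C" "insert y (C - {x}) \<in> M"
      using exchange[OF C(1) B2(1), of x] by auto
    let ?D = "insert y (C - {x})"
    have "y \<notin> X"
    proof
      assume "y \<in> X"
      then have "?D \<inter> X = insert y (C \<inter> X)" using x by auto
      then have "card (?D \<inter> X) = Suc (card (C \<inter> X))" using y(2) fin by simp
      then show False using card_Int_le_rk[OF y(3), of X] B1(2) C(2) by simp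
    qed
    then have "Q ?D" using y x C by (auto simp: Q_def)
    moreover have "?D - B2 = (C - B2) - {x}" using y by auto
    then have "card (?D - B2) < card (C - B2)"
      using x fin by (metis DiffI card_Diff1_less finite_Diff)
    ultimately show False using min[of ?D] by simp
  qed
  have "card (C - X) = card (B2 - X)"
    using card_basis_split[OF C(1), of X] card_basis_split[OF B2(1), of X] B1(2) B2(2) C(2) by simp
  then have "C - X = B2 - X" using sub finite_basis[OF B2(1)] by (metis card_subset_eq finite_Diff)
  then have "C = (B1 \<inter> X) \<union> (B2 - X)" using C(2) by blast
  then show ?thesis using C(1) by simp
qed

text \<open>Single exchanges lead from \<open>B\<close> to \<open>B'\<close>, and the trace on
  \<open>Z\<close> has to shrink at some step. That step trades an element \<open>a\<close> of
  \<open>Z\<close> for an element \<open>c\<close> outside. The inclusions between \<open>D\<close>,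
  \<open>B\<close> and \<open>B'\<close> tell callers where \<open>a\<close> and \<open>c\<close>
  can lie.\<close>

lemma exchange_across:
  assumes "B \<in> M" "B' \<in> M" "card (B' \<inter> Z) < card (B \<inter> Z)"
  obtains D a c where "D \<in> M" "insert c (D - {a}) \<in> M" "a \<in> D" "a \<in> Z" "c \<notin> Z" "c \<notin> D"
    "a \<in> B \<union> B' - (B \<inter> B')" "c \<in> B \<union> B' - (B \<inter> B')" "B \<inter> B' \<subseteq> D" "D \<subseteq> B \<union> B'"
  using assms
proof (induction "card (B - B')" arbitrary: B B' thesis rule: less_induct)
  case (less B B')
  note prems = less.prems(2-4) and that = less.prems(1)
  have finB: "finite B" "finite B'" using prems finite_basis by auto
  have "\<not> B \<subseteq> B'"
  proof
    assume "B \<subseteq> B'"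
    then have "B = B'" using prems finB card_basis by (metis card_subset_eq)
    then show False using prems by simp
  qed
  then obtain x where x: "x \<in> B" "x \<notin> B'" by auto
  then obtain y where y: "y \<in> B'" "y \<notin> B" "insert y (B - {x}) \<in> M"
    using exchange[of B B' x] prems by auto
  let ?C = "insert y (B - {x})"
  show ?case
  proof (cases "card (?C \<inter> Z) < card (B \<inter> Z)")
    case True
    have "x \<in> Z"
    proof (rule ccontr)
      assume "x \<notin> Z"
      then have "B \<inter> Z \<subseteq> ?C \<inter> Z" by auto
      then have "card (B \<inter> Z) \<le> card (?C \<inter> Z)" using finB by (intro card_mono) auto
      then show False using True by simp
    qed
    moreover have "y \<notin> Z"
    proof
      assume "y \<in> Z"
      then have "?C \<inter> Z = insert y ((B \<inter> Z) - {x})" by auto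
      then have "card (?C \<inter> Z) = card (B \<inter> Z)"
        using y finB \<open>x \<in> Z\<close> x card_Suc_Diff1[of "B \<inter> Z" x] by simp
      then show False using True by simp
    qed
    ultimately show ?thesis using prems x y by (intro that[of B y x]) auto
  next
    case False
    have "?C - B' = (B - B') - {x}" using y by auto
    then have lt: "card (?C - B') < card (B - B')"
      using x finB by (metis DiffI card_Diff1_less finite_Diff)
    have gt: "card (B' \<inter> Z) < card (?C \<inter> Z)" using False prems by simp
    obtain D a c where D: "D \<in> M" "insert c (D - {a}) \<in> M" "a \<in> D" "a \<in> Z" "c \<notin> Z" "c \<notin> D"
      "a \<in> ?C \<union> B' - (?C \<inter> B')" "c \<in> ?C \<union> B' - (?C \<inter> B')" "?C \<inter> B' \<subseteq> D" "D \<subseteq> ?C \<union> B'"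
      using less.hyps[OF lt _ y(3) prems(2) gt] .
    have "B \<inter> B' \<subseteq> ?C \<inter> B'" "?C \<union> B' \<subseteq> B \<union> B'" using x y by auto
    moreover from this have "?C \<union> B' - (?C \<inter> B') \<subseteq> B \<union> B' - (B \<inter> B')" by blast
    ultimately show ?thesis
      using D(1-6) subsetD[OF _ D(7)] subsetD[OF _ D(8)] subset_trans[OF _ D(9)] subset_trans[OF D(10)]
      by (intro that[of D c a]) assumption+
  qed
qed

end

section \<open>Matroids determined by the ranks of cyclic intervals\<close>

definition btw :: "'a::linorder \<Rightarrow> 'a \<Rightarrow> 'a \<Rightarrow> bool" where
  "btw p q x \<longleftrightarrow> min p q < x \<and> x < max p q"

text \<open>With the points placed on a circle in their linear order, the chords \<open>ac\<close>
  and \<open>bd\<close> meet. No order among the four is prescribed, so callers need not distinguish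
  rotations or swapped endpoints.\<close>

definition crossing :: "'a::linorder \<Rightarrow> 'a \<Rightarrow> 'a \<Rightarrow> 'a \<Rightarrow> bool" where
  "crossing a c b d \<longleftrightarrow> distinct [a, b, c, d] \<and> (btw a c b \<longleftrightarrow> \<not> btw a c d)"

definition squares_filled :: "'a::linorder set set \<Rightarrow> bool" where
  "squares_filled M \<longleftrightarrow> (\<forall>S a b c d. a < b \<longrightarrow> b < c \<longrightarrow> c < d \<longrightarrow> S \<inter> {a, b, c, d} = {} \<longrightarrow>
     S \<union> {a, b} \<in> M \<longrightarrow> S \<union> {a, d} \<in> M \<longrightarrow> S \<union> {b, c} \<in> M \<longrightarrow> S \<union> {c, d} \<in> M \<longrightarrow>
     S \<union> {a, c} \<in> M \<and> S \<union> {b, d} \<in> M)"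

lemma crossing_sym: "crossing a c b d \<longleftrightarrow> crossing b d a c"
  unfolding crossing_def btw_def by (auto simp: min_def max_def)

text \<open>Up to swapping the ends of the chord \<open>ac\<close>, a crossing is one of four cyclic
  arrangements. In each, the four given sets are the sides of the square and
  \<open>S \<union> {a, c}\<close> is one of its diagonals.\<close>

lemma squares_filledD:
  assumes M: "squares_filled M" and cr: "crossing a c b d" and S: "S \<inter> {a, b, c, d} = {}"
    and bases: "S \<union> {a, b} \<in> M" "S \<union> {a, d} \<in> M" "S \<union> {b, c} \<in> M" "S \<union> {c, d} \<in> M"
  shows "S \<union> {a, c} \<in> M"
proof -
  have sq: "S \<union> {p, r} \<in> M \<and> S \<union> {q, s} \<in> M" if "p < q" "q < r" "r < s" "S \<inter> {p, q, r, s} = {}"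
     "S \<union> {p, q} \<in> M" "S \<union> {p, s} \<in> M" "S \<union> {q, r} \<in> M" "S \<union> {r, s} \<in> M" for p q r s
    using M that unfolding squares_filled_def by blast
  have 1: "S \<union> {a', c'} \<in> M"
    if "a' < c'" "crossing a' c' b' d'" "S \<inter> {a', b', c', d'} = {}"
      "S \<union> {a', b'} \<in> M" "S \<union> {a', d'} \<in> M" "S \<union> {b', c'} \<in> M" "S \<union> {c', d'} \<in> M" for a' b' c' d'
  proof -
    from that consider "a' < b'" "b' < c'" "c' < d'" | "d' < a'" "a' < b'" "b' < c'"
      | "a' < d'" "d' < c'" "c' < b'" | "b' < a'" "a' < d'" "d' < c'"
      unfolding crossing_def btw_def
      by (simp add: min_absorb1 max_absorb2 less_imp_le) (metis linorder_neqE)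
    then show ?thesis
    proof cases
      case 1
      then show ?thesis using sq[of a' b' c' d'] that by auto
    next
      case 2
      then show ?thesis using sq[of d' a' b' c'] that by (auto simp: insert_commute)
    next
      case 3
      then show ?thesis using sq[of a' d' c' b'] that by (auto simp: insert_commute)
    next
      case 4
      then show ?thesis using sq[of b' a' d' c'] that by (auto simp: insert_commute)
    qed
  qed
  show ?thesis
  proof (cases "a < c")
    case True
    then show ?thesis using 1[of a c b d] assms by auto
  next
    case False
    then have "c < a" using cr by (auto simp: crossing_def)
    moreover have "crossing c a b d" using cr by (auto simp: crossing_def btw_def min.commute max.commute)
    ultimately have "S \<union> {c, a} \<in> M" using 1[of c a b d] S bases by (auto simp: insert_commute)
    then show ?thesis by (simp add: insert_commute)
  qed
qed

context matroid
begin

text \<open>\<open>M|X\<close> is not the direct sum of its parts on \<open>X1\<close> and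
  \<open>X2\<close>. One basis fills \<open>X1\<close>; another with the same trace outside
  \<open>X\<close> fills \<open>X2\<close> and so has fewer than \<open>rk M X1\<close> elements in
  \<open>X1\<close>. Some exchange between the two leaves \<open>X1\<close>, and as both agree
  outside \<open>X\<close>, it enters \<open>X2\<close>.\<close>

lemma link_inside:
  assumes X: "X = X1 \<union> X2" "X1 \<inter> X2 = {}" and gt: "rk M X < rk M X1 + rk M X2"
  obtains D a c where "D \<in> M" "card (D \<inter> X) = rk M X" "a \<in> D" "a \<in> X1" "c \<in> X2" "c \<notin> D"
    "insert c (D - {a}) \<in> M"
proof -
  obtain B where B: "B \<in> M" "card (B \<inter> X1) = rk M X1" "card (B \<inter> X) = rk M X"
    using optimal_chain[of X1 X] X by auto
  obtain B2 where B2: "B2 \<in> M" "card (B2 \<inter> X2) = rk M X2" "card (B2 \<inter> X) = rk M X"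
    using optimal_chain[of X2 X] X by auto
  define B' where "B' = (B2 \<inter> X) \<union> (B - X)"
  have B': "B' \<in> M" unfolding B'_def using optimal_recombine B B2 by blast
  have "B2 \<inter> X = (B2 \<inter> X1) \<union> (B2 \<inter> X2)" using X by auto
  moreover have "card ((B2 \<inter> X1) \<union> (B2 \<inter> X2)) = card (B2 \<inter> X1) + card (B2 \<inter> X2)"
    using X finite_basis[OF B2(1)] by (intro card_Un_disjoint) auto
  moreover have "B' \<inter> X1 = B2 \<inter> X1" using X by (auto simp: B'_def)
  ultimately have "card (B' \<inter> X1) < card (B \<inter> X1)" using gt B B2 by simp
  then obtain D a c where D: "D \<in> M" "insert c (D - {a}) \<in> M" "a \<in> D" "a \<in> X1" "c \<notin> X1" "c \<notin> D"
    "a \<in> B \<union> B' - (B \<inter> B')" "c \<in> B \<union> B' - (B \<inter> B')" "B \<inter> B' \<subseteq> D" "D \<subseteq> B \<union> B'"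
    by (rule exchange_across[OF B(1) B'])
  have "D - X = B - X" using D(9,10) by (auto simp: B'_def)
  then have "card (D \<inter> X) = rk M X"
    using card_basis_split[OF D(1), of X] card_basis_split[OF B(1), of X] B(3) by simp
  moreover have "c \<in> X2" using D(5,8) X by (auto simp: B'_def)
  ultimately show thesis using that D by blast
qed

text \<open>Dual to \<open>link_inside\<close>, now in \<open>M/X\<close>: the two bases share their
  trace on \<open>X\<close>. The second one fills \<open>X \<union> Y2\<close> and so keeps only
  \<open>k - rk M (X \<union> Y2)\<close> elements in \<open>Y1\<close>, fewer than the
  first.\<close>

lemma link_outside:
  assumes Y: "Y1 \<inter> X = {}" "Y2 \<inter> X = {}" "Y1 \<inter> Y2 = {}" and E: "\<And>B. B \<in> M \<Longrightarrow> B \<subseteq> X \<union> Y1 \<union> Y2"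
    and gt: "rk M X + k < rk M (X \<union> Y1) + rk M (X \<union> Y2)"
  obtains D b d where "D \<in> M" "card (D \<inter> X) = rk M X" "b \<in> D" "b \<in> Y1" "d \<in> Y2" "d \<notin> D"
    "insert d (D - {b}) \<in> M"
proof -
  obtain B where B: "B \<in> M" "card (B \<inter> X) = rk M X" "card (B \<inter> (X \<union> Y1)) = rk M (X \<union> Y1)"
    using optimal_chain[of X "X \<union> Y1"] by auto
  obtain B2 where B2: "B2 \<in> M" "card (B2 \<inter> X) = rk M X" "card (B2 \<inter> (X \<union> Y2)) = rk M (X \<union> Y2)"
    using optimal_chain[of X "X \<union> Y2"] by auto
  define B' where "B' = (B \<inter> X) \<union> (B2 - X)"
  have B': "B' \<in> M" unfolding B'_def using optimal_recombine B B2 by blast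
  have c1: "card (B \<inter> (X \<union> Y1)) = card (B \<inter> X) + card (B \<inter> Y1)"
    using Y finite_basis[OF B(1)] by (subst Int_Un_distrib, intro card_Un_disjoint) auto
  have c2: "card (B2 \<inter> (X \<union> Y2)) = card (B2 \<inter> X) + card (B2 \<inter> Y2)"
    using Y finite_basis[OF B2(1)] by (subst Int_Un_distrib, intro card_Un_disjoint) auto
  have "B2 = (B2 \<inter> X) \<union> ((B2 \<inter> Y1) \<union> (B2 \<inter> Y2))" using E[OF B2(1)] by auto
  also have "card \<dots> = card (B2 \<inter> X) + (card (B2 \<inter> Y1) + card (B2 \<inter> Y2))"
    using Y finite_basis[OF B2(1)] by (subst card_Un_disjoint, auto)+
  finally have c3: "k = card (B2 \<inter> X) + (card (B2 \<inter> Y1) + card (B2 \<inter> Y2))"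
    using card_basis[OF B2(1)] by simp
  have "B' \<inter> Y1 = B2 \<inter> Y1" using Y by (auto simp: B'_def)
  then have "card (B' \<inter> Y1) < card (B \<inter> Y1)" using gt B B2 c1 c2 c3 by simp
  then obtain D a c where D: "D \<in> M" "insert c (D - {a}) \<in> M" "a \<in> D" "a \<in> Y1" "c \<notin> Y1" "c \<notin> D"
    "a \<in> B \<union> B' - (B \<inter> B')" "c \<in> B \<union> B' - (B \<inter> B')" "B \<inter> B' \<subseteq> D" "D \<subseteq> B \<union> B'"
    by (rule exchange_across[OF B(1) B'])
  have "D \<inter> X = B \<inter> X" using D(9,10) by (auto simp: B'_def)
  then have "card (D \<inter> X) = rk M X" using B(2) by simp
  moreover have "c \<in> Y2" using D(5,8) Y E[OF B(1)] E[OF B2(1)] by (auto simp: B'_def)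
  ultimately show thesis using that D by blast
qed

end

lemma card_swap_in: "finite D \<Longrightarrow> a \<in> D \<Longrightarrow> c \<notin> D \<Longrightarrow> a \<in> X \<longleftrightarrow> c \<in> X \<Longrightarrow>
    card (insert c (D - {a}) \<inter> X) = card (D \<inter> X)"
proof (cases "c \<in> X")
  case True
  assume *: "finite D" "a \<in> D" "c \<notin> D" "a \<in> X \<longleftrightarrow> c \<in> X"
  have "insert c (D - {a}) \<inter> X = insert c ((D \<inter> X) - {a})" using True by auto
  then show ?thesis using * True card_Suc_Diff1[of "D \<inter> X" a] by simp
next
  case False
  assume *: "finite D" "a \<in> D" "c \<notin> D" "a \<in> X \<longleftrightarrow> c \<in> X"
  then have "insert c (D - {a}) \<inter> X = D \<inter> X" using False by auto
  then show ?thesis by simp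
qed

text \<open>A basis of \<open>M|X\<close> and one of \<open>M/X\<close> can be chosen independently,
  so the two links produce the four sides of a square. Filling it would add the diagonal
  \<open>S \<union> {a, c}\<close>, which has one element too many in \<open>X\<close>.\<close>

lemma no_crossing_links:
  fixes M :: "'a::linorder set set"
  assumes M: "matroid k M" and sq: "squares_filled M" and cr: "crossing a c b d"
    and D1: "D1 \<in> M" "card (D1 \<inter> X) = rk M X" "a \<in> D1" "a \<in> X" "c \<in> X" "c \<notin> D1"
      "insert c (D1 - {a}) \<in> M"
    and D2: "D2 \<in> M" "card (D2 \<inter> X) = rk M X" "b \<in> D2" "b \<notin> X" "d \<notin> X" "d \<notin> D2"
      "insert d (D2 - {b}) \<in> M"
  shows False
proof -
  interpret matroid k M by (rule M)
  define S where "S = (D1 \<inter> X - {a}) \<union> (D2 - X - {b})"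
  have fin: "finite D1" "finite D2" using D1(1) D2(1) finite_basis by auto
  have D1': "card (insert c (D1 - {a}) \<inter> X) = rk M X"
    using card_swap_in[OF fin(1) D1(3) D1(6), of X] D1(2,4,5) by metis
  have D2': "card (insert d (D2 - {b}) \<inter> X) = rk M X"
    using card_swap_in[OF fin(2) D2(3) D2(6), of X] D2(2,4,5) by metis
  have "(D1 \<inter> X) \<union> (D2 - X) = S \<union> {a, b}" using D1 D2 by (auto simp: S_def)
  then have ab: "S \<union> {a, b} \<in> M" using optimal_recombine[OF D1(1,2) D2(1,2)] by simp
  have "(D1 \<inter> X) \<union> (insert d (D2 - {b}) - X) = S \<union> {a, d}" using D1 D2 by (auto simp: S_def)
  then have ad: "S \<union> {a, d} \<in> M" using optimal_recombine[OF D1(1,2) D2(7) D2'] by simp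
  have "(insert c (D1 - {a}) \<inter> X) \<union> (D2 - X) = S \<union> {b, c}" using D1 D2 by (auto simp: S_def)
  then have bc: "S \<union> {b, c} \<in> M" using optimal_recombine[OF D1(7) D1' D2(1,2)] by simp
  have "(insert c (D1 - {a}) \<inter> X) \<union> (insert d (D2 - {b}) - X) = S \<union> {c, d}"
    using D1 D2 by (auto simp: S_def)
  then have cd: "S \<union> {c, d} \<in> M" using optimal_recombine[OF D1(7) D1' D2(7) D2'] by simp
  have "S \<inter> {a, b, c, d} = {}" using D1 D2 by (auto simp: S_def)
  then have "S \<union> {a, c} \<in> M" using squares_filledD[OF sq cr] ab ad bc cd by blast
  moreover have "(S \<union> {a, c}) \<inter> X = insert c (D1 \<inter> X)" using D1 D2 by (auto simp: S_def)
  then have "card ((S \<union> {a, c}) \<inter> X) = Suc (rk M X)" using D1 fin by simp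
  ultimately show False using card_Int_le_rk[of "S \<union> {a, c}" X] by simp
qed

text \<open>A cyclic interval as the residues of an integer interval. Intervals that wrap around
  simply have \<open>j > n\<close>, which fits the periodic functions used for affine
  permutations.\<close>

definition win :: "nat \<Rightarrow> nat \<Rightarrow> nat \<Rightarrow> nat set" where
  "win n i j = (\<lambda>m. m mod n) ` {i..<j}"

lemma win_no_wrap: "j \<le> n \<Longrightarrow> win n i j = {i..<j}"
  unfolding win_def by force

lemma win_wrap: assumes "q \<le> n" "p \<le> n" shows "win n q (p + n) = {q..<n} \<union> {0..<p}"
proof -
  have "{q..<p + n} = {q..<n} \<union> {n..<p + n}" using assms by auto
  moreover have "(\<lambda>m. m mod n) ` {q..<n} = {q..<n}" by force
  moreover have "(\<lambda>m. m mod n) ` {n..<p + n} = {0..<p}"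
  proof -
    have "{n..<p + n} = (\<lambda>m. m + n) ` {0..<p}" by simp
    then have "(\<lambda>m. m mod n) ` {n..<p + n} = (\<lambda>m. (m + n) mod n) ` {0..<p}" by (simp only: image_image)
    also have "\<dots> = (\<lambda>m. m) ` {0..<p}" using assms by (intro image_cong) auto
    finally show ?thesis by simp
  qed
  ultimately show ?thesis unfolding win_def by (simp add: image_Un)
qed

lemma convex_nat_set:
  fixes X :: "nat set"
  assumes "finite X" "\<And>x y z. x \<in> X \<Longrightarrow> z \<in> X \<Longrightarrow> x < y \<Longrightarrow> y < z \<Longrightarrow> y \<in> X"
  obtains p q where "p \<le> q" "X = {p..<q}"
proof (cases "X = {}")
  case True
  then show thesis using that[of 0 0] by simp
next
  case False
  have "X = {Min X..<Suc (Max X)}"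
  proof
    show "{Min X..<Suc (Max X)} \<subseteq> X"
    proof
      fix y assume "y \<in> {Min X..<Suc (Max X)}"
      then have "y = Min X \<or> y = Max X \<or> Min X < y \<and> y < Max X" by auto
      then show "y \<in> X" using assms(2)[OF Min_in[OF assms(1) False] Max_in[OF assms(1) False]]
          Min_in[OF assms(1) False] Max_in[OF assms(1) False] by auto
    qed
  qed (use assms(1) in \<open>auto simp: less_Suc_eq_le\<close>)
  moreover have "Min X \<le> Suc (Max X)" using False assms(1) by (meson Max_ge Min_in le_SucI)
  ultimately show thesis using that by blast
qed

text \<open>If \<open>X\<close> has a gap \<open>y\<close> between two of its points, its complement
  has no gap: a point of \<open>X\<close> between two points of the complement would yield crossing
  chords. So \<open>X\<close> or its complement is an interval of integers; in the latter case
  \<open>X\<close> wraps around.\<close>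

lemma noncrossing_imp_win:
  assumes X: "X \<subseteq> {0..<n}"
    and nc: "\<And>a b c d. a \<in> X \<Longrightarrow> c \<in> X \<Longrightarrow> b \<in> {0..<n} - X \<Longrightarrow> d \<in> {0..<n} - X \<Longrightarrow> \<not> crossing a c b d"
  obtains i j where "i \<le> j" "j \<le> i + n" "X = win n i j"
proof (cases "\<forall>x y z. x \<in> X \<longrightarrow> z \<in> X \<longrightarrow> x < y \<longrightarrow> y < z \<longrightarrow> y \<in> X")
  case True
  have "finite X" using X finite_subset by blast
  then obtain p q where pq: "p \<le> q" "X = {p..<q}" using True convex_nat_set[of X] by metis
  have "q \<le> n \<or> p = q" using X pq by (cases "p = q") (auto dest: subsetD[of _ _ "q - 1"])
  then show thesis
  proof
    assume "q \<le> n"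
    then show thesis using that[of p q] pq win_no_wrap[of q n p] by simp
  next
    assume "p = q"
    then show thesis using that[of 0 0] pq by (simp add: win_def)
  qed
next
  case False
  then obtain x y z where xyz: "x \<in> X" "z \<in> X" "x < y" "y < z" "y \<notin> X" by blast
  let ?Y = "{0..<n} - X"
  have yY: "y \<in> ?Y" using xyz X by auto
  have "x1 \<in> ?Y" if h: "y1 \<in> ?Y" "y2 \<in> ?Y" "y1 < x1" "x1 < y2" for y1 x1 y2
  proof (rule ccontr)
    assume "x1 \<notin> ?Y"
    then have x1: "x1 \<in> X" using h by auto
    show False
    proof (cases "y1 < x")
      case True
      then show False using nc[of x z y1 y] xyz h yY by (auto simp: crossing_def btw_def)
    next
      case False
      then have "x < y1" using h xyz by (metis DiffD2 linorder_neqE_nat)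
      then show False using nc[of x x1 y1 y2] xyz h x1 by (auto simp: crossing_def btw_def)
    qed
  qed
  then obtain p q where pq: "p \<le> q" "?Y = {p..<q}" using convex_nat_set[of ?Y] by (metis finite_Diff finite_atLeastLessThan)
  have "p < q" using pq yY by (cases "p = q") auto
  then have "q - 1 \<in> ?Y" using pq by auto
  then have qn: "q \<le> n" by auto
  have "X = {0..<n} - {p..<q}" using X pq(2) by blast
  also have "\<dots> = {q..<n} \<union> {0..<p}" using qn pq(1) by auto
  also have "\<dots> = win n q (p + n)" using win_wrap[of q n p] qn pq(1) by simp
  finally show thesis using that[of q "p + n"] pq qn by auto
qed

text \<open>The last points of the maximal cyclic runs of \<open>X\<close>, for
  \<open>X \<subseteq> {0..<n}\<close>; their number counts the runs and is the measure for the
  induction in \<open>violated_window\<close>.\<close>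

definition bdry :: "nat \<Rightarrow> nat set \<Rightarrow> nat set" where
  "bdry n X = {x \<in> X. Suc x mod n \<notin> X}"

lemma bdry_nonempty:
  assumes "X \<subseteq> {0..<n}" "x \<in> X" "y \<in> {0..<n} - X"
  shows "bdry n X \<noteq> {}"
proof
  assume "bdry n X = {}"
  then have step: "\<And>x. x \<in> X \<Longrightarrow> Suc x mod n \<in> X" by (auto simp: bdry_def)
  have "(x + m) mod n \<in> X" for m
  proof (induction m)
    case 0
    then show ?case using assms by (simp add: subset_iff)
  next
    case (Suc m)
    then show ?case using step[OF Suc] by (simp add: mod_Suc_eq)
  qed
  moreover have "x + (y + n - x) = y + n" using assms by (auto simp: subset_iff)
  ultimately have "(y + n) mod n \<in> X" by metis
  then show False using assms by simp
qed

text \<open>A step to the cyclic successor cannot cross the chord \<open>pq\<close> without touching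
  an endpoint. Hence a set that avoids both endpoints is cut by the chord only in its gaps.\<close>

lemma Suc_btw:
  assumes "x < n" "Suc x mod n < n" "btw p q x \<longleftrightarrow> \<not> btw p q (Suc x mod n)" "p < n" "q < n"
  shows "x = p \<or> x = q \<or> Suc x mod n = p \<or> Suc x mod n = q"
proof (cases "Suc x < n")
  case True
  then show ?thesis using assms by (auto simp: btw_def min_def max_def split: if_splits)
next
  case False
  then have "Suc x = n" using assms by auto
  then show ?thesis using assms by (auto simp: btw_def min_def max_def split: if_splits)
qed



lemma violated_window:
  fixes M :: "nat set set"
  assumes M: "matroid k M" and ground: "\<And>B. B \<in> M \<Longrightarrow> B \<subseteq> {0..<n}"
    and sq: "squares_filled M" and I: "I \<subseteq> {0..<n}" "card I = k"
    and X: "X \<subseteq> {0..<n}" "rk M X < card (I \<inter> X)"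
  shows "\<exists>i j. i \<le> j \<and> j \<le> i + n \<and> rk M (win n i j) < card (I \<inter> win n i j)"
  using X
proof (induction "card (bdry n X)" arbitrary: X rule: less_induct)
  case (less X)
  interpret matroid k M by (rule M)
  have finX: "finite Z" if "Z \<subseteq> {0..<n}" for Z using that finite_subset by blast
  \<comment> \<open>The companion \<open>Z'\<close> makes the decrease strict: its boundary is a
    nonempty part of that of \<open>X\<close>, disjoint from that of \<open>Z\<close>.\<close>
  have smaller: ?case if Z: "Z \<subseteq> {0..<n}" "rk M Z < card (I \<inter> Z)"
    and b: "bdry n Z \<subseteq> bdry n X" "bdry n Z' \<subseteq> bdry n X" "bdry n Z \<inter> bdry n Z' = {}" "bdry n Z' \<noteq> {}" for Z Z'
  proof -
    have "bdry n Z \<subset> bdry n X" using b by auto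
    moreover have "finite (bdry n X)" using finX[OF less.prems(1)] by (simp add: bdry_def)
    ultimately have "card (bdry n Z) < card (bdry n X)" by (metis psubset_card_mono)
    then show ?case using less.hyps Z by blast
  qed
  show ?case
  proof (cases "\<exists>a b c d. a \<in> X \<and> c \<in> X \<and> b \<in> {0..<n} - X \<and> d \<in> {0..<n} - X \<and> crossing a c b d")
    case False
    then obtain i j where "i \<le> j" "j \<le> i + n" "X = win n i j"
      using noncrossing_imp_win[OF less.prems(1)] by metis
    then show ?thesis using less.prems by blast
  next
    case True
    then obtain a0 b0 c0 d0 where q0: "a0 \<in> X" "c0 \<in> X" "b0 \<in> {0..<n} - X" "d0 \<in> {0..<n} - X"
      "crossing a0 c0 b0 d0" by blast
    have ltn: "x < n" "Suc x mod n < n" if "x \<in> X" for x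
      using that less.prems(1) by (auto simp: subset_iff intro!: mod_less_divisor)
    \<comment> \<open>The cut runs through \<open>b0\<close> and \<open>d0\<close>, which lie
      outside \<open>X\<close>, so it splits no run; \<open>a0\<close> and \<open>c0\<close> lie on
      different sides, so both pieces are nonempty.\<close>
    define W where "W = {x. btw b0 d0 x}"
    define X1 where "X1 = X \<inter> W"
    define X2 where "X2 = X - W"
    have cr': "btw b0 d0 a0 \<longleftrightarrow> \<not> btw b0 d0 c0" using q0(5) crossing_sym[of a0 c0 b0 d0] by (auto simp: crossing_def)
    have ne: "X1 \<noteq> {}" "X2 \<noteq> {}" using q0 cr' by (auto simp: X1_def X2_def W_def)
    have sep: "Suc x mod n \<notin> X" if "x \<in> X" "x \<in> W \<longleftrightarrow> Suc x mod n \<notin> W" for x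
      using Suc_btw[OF ltn[OF that(1)], of b0 d0] that q0 by (auto simp: W_def)
    have b1: "bdry n X1 \<subseteq> bdry n X" "bdry n X2 \<subseteq> bdry n X" "bdry n X1 \<inter> bdry n X2 = {}"
    proof -
      show "bdry n X1 \<subseteq> bdry n X"
      proof
        fix x assume "x \<in> bdry n X1"
        then show "x \<in> bdry n X" using sep[of x] by (auto simp: bdry_def X1_def)
      qed
      show "bdry n X2 \<subseteq> bdry n X"
      proof
        fix x assume "x \<in> bdry n X2"
        then show "x \<in> bdry n X" using sep[of x] by (auto simp: bdry_def X2_def)
      qed
      show "bdry n X1 \<inter> bdry n X2 = {}" by (auto simp: bdry_def X1_def X2_def)
    qed
    obtain x1 x2 where x12: "x1 \<in> X1" "x2 \<in> X2" using ne by auto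
    have "bdry n X1 \<noteq> {}" "bdry n X2 \<noteq> {}"
      using less.prems(1) q0 bdry_nonempty[OF _ x12(1), of n b0] bdry_nonempty[OF _ x12(2), of n b0]
      by (auto simp: X1_def X2_def)
    then have use1: ?thesis if "rk M X1 < card (I \<inter> X1) \<or> rk M X2 < card (I \<inter> X2)"
      using that smaller[of X1 X2] smaller[of X2 X1] b1 less.prems(1) by (auto simp: X1_def X2_def)
    have split1: "card (I \<inter> X) = card (I \<inter> X1) + card (I \<inter> X2)"
      using finX[OF I(1)] by (subst card_Un_disjoint[symmetric]) (auto simp: X1_def X2_def intro!: arg_cong[of _ _ card])
    show ?thesis
    proof (cases "rk M X < rk M X1 + rk M X2")
      case False
      \<comment> \<open>The traces of \<open>I\<close> add up to that of \<open>X\<close>, while the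
        two ranks add up to at most \<open>rk M X\<close>; so one of the pieces is violated.\<close>
      then show ?thesis using split1 less.prems(2) by (intro use1) linarith
    next
      case True
      obtain D1 a c where D1: "D1 \<in> M" "card (D1 \<inter> X) = rk M X" "a \<in> D1" "a \<in> X1" "c \<in> X2" "c \<notin> D1"
        "insert c (D1 - {a}) \<in> M"
        using link_inside[of X X1 X2] True by (auto simp: X1_def X2_def)
      have ac: "a \<in> X" "c \<in> X" "btw b0 d0 a" "\<not> btw b0 d0 c" using D1 by (auto simp: X1_def X2_def W_def)
      have "crossing b0 d0 a c" using ac q0 by (auto simp: crossing_def)
      then have cr2: "btw a c b0 \<longleftrightarrow> \<not> btw a c d0" using crossing_sym by (metis crossing_def)
      \<comment> \<open>The complement is cut along the link \<open>a\<close>, \<open>c\<close> just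
        found rather than along \<open>a0\<close>, \<open>c0\<close>: any link \<open>b\<close>,
        \<open>d\<close> joining the two sides then crosses it. The points \<open>b0\<close> and
        \<open>d0\<close> show that both sides are nonempty.\<close>
      define V where "V = {x. btw a c x}"
      define Y1 where "Y1 = ({0..<n} - X) \<inter> V"
      define Y2 where "Y2 = ({0..<n} - X) - V"
      have neY: "Y1 \<noteq> {}" "Y2 \<noteq> {}" using q0 cr2 by (auto simp: Y1_def Y2_def V_def)
      have sep: "Suc x mod n \<in> X" if "x \<in> {0..<n} - X" "x \<in> V \<longleftrightarrow> Suc x mod n \<notin> V" for x
        using Suc_btw[of x n a c] that ac ltn by (auto simp: V_def)
      have mX: "Suc x mod n < n" if "x < n" for x using that by (simp add: mod_less_divisor)
      have b2: "bdry n (X \<union> Y1) \<subseteq> bdry n X" "bdry n (X \<union> Y2) \<subseteq> bdry n X"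
      proof -
        show "bdry n (X \<union> Y1) \<subseteq> bdry n X"
        proof
          fix x assume "x \<in> bdry n (X \<union> Y1)"
          then show "x \<in> bdry n X" using sep[of x] mX[of x] by (auto simp: bdry_def Y1_def)
        qed
        show "bdry n (X \<union> Y2) \<subseteq> bdry n X"
        proof
          fix x assume "x \<in> bdry n (X \<union> Y2)"
          then show "x \<in> bdry n X" using sep[of x] mX[of x] by (auto simp: bdry_def Y2_def)
        qed
      qed
      have b3: "bdry n (X \<union> Y1) \<inter> bdry n (X \<union> Y2) = {}"
      proof -
        have False if "x \<in> bdry n (X \<union> Y1)" "x \<in> bdry n (X \<union> Y2)" for x
          using that mX[of x] ltn(2)[of x] by (auto simp: bdry_def Y1_def Y2_def)
        then show ?thesis by blast
      qed
      have b4: "bdry n (X \<union> Y1) \<noteq> {}" "bdry n (X \<union> Y2) \<noteq> {}"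
      proof -
        obtain y1 y2 where y: "y1 \<in> Y1" "y2 \<in> Y2" using neY by auto
        show "bdry n (X \<union> Y1) \<noteq> {}"
          using y ac less.prems(1) by (intro bdry_nonempty[of _ n a y2]) (auto simp: Y1_def Y2_def)
        show "bdry n (X \<union> Y2) \<noteq> {}"
          using y ac less.prems(1) by (intro bdry_nonempty[of _ n a y1]) (auto simp: Y1_def Y2_def)
      qed
      have use2: ?thesis if "rk M (X \<union> Y1) < card (I \<inter> (X \<union> Y1)) \<or> rk M (X \<union> Y2) < card (I \<inter> (X \<union> Y2))"
      proof -
        have "X \<union> Y1 \<subseteq> {0..<n}" "X \<union> Y2 \<subseteq> {0..<n}" using less.prems(1) by (auto simp: Y1_def Y2_def)
        then show ?thesis
          using that smaller[of "X \<union> Y1" "X \<union> Y2"] smaller[of "X \<union> Y2" "X \<union> Y1"] b2 b3 b4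
          by (auto simp: Int_commute)
      qed
      have fI: "finite I" using finX I by blast
      have e1: "card (I \<inter> (X \<union> Y1)) = card (I \<inter> X) + card (I \<inter> Y1)"
        using fI by (subst card_Un_disjoint[symmetric]) (auto simp: Y1_def intro!: arg_cong[of _ _ card])
      have "I = (I \<inter> (X \<union> Y2)) \<union> (I \<inter> Y1)" using I(1) by (auto simp: Y1_def Y2_def)
      moreover have "card ((I \<inter> (X \<union> Y2)) \<union> (I \<inter> Y1)) = card (I \<inter> (X \<union> Y2)) + card (I \<inter> Y1)"
        using fI by (intro card_Un_disjoint) (auto simp: Y1_def Y2_def)
      \<comment> \<open>Counting \<open>I\<close> is modular on these sets. If the ranks of
        \<open>X \<union> Y1\<close> and \<open>X \<union> Y2\<close> summed to at most
        \<open>rk M X + k\<close>, one of the two sets would be violated.\<close>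
      ultimately have split2: "card (I \<inter> X) + k = card (I \<inter> (X \<union> Y1)) + card (I \<inter> (X \<union> Y2))"
        using e1 I(2) by simp
      show ?thesis
      proof (cases "rk M X + k < rk M (X \<union> Y1) + rk M (X \<union> Y2)")
        case False
        then show ?thesis using split2 less.prems(2) by (intro use2) linarith
      next
        case True
        obtain D2 b d where D2: "D2 \<in> M" "card (D2 \<inter> X) = rk M X" "b \<in> D2" "b \<in> Y1" "d \<in> Y2" "d \<notin> D2"
          "insert d (D2 - {b}) \<in> M"
        proof (rule link_outside[of Y1 X Y2])
          show "B \<subseteq> X \<union> Y1 \<union> Y2" if "B \<in> M" for B using ground[OF that] by (auto simp: Y1_def Y2_def)
        qed (use True in \<open>auto simp: Y1_def Y2_def\<close>)
        have "crossing a c b d"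
          using D1 D2 ac by (auto simp: crossing_def Y1_def Y2_def V_def X1_def X2_def W_def)
        then show ?thesis
          using no_crossing_links[OF M sq _ D1(1,2,3) ac(1,2) D1(6,7) D2(1,2,3) _ _ D2(6,7)] D2(4,5)
          by (auto simp: Y1_def Y2_def)
      qed
    qed
  qed
qed

definition win_bases :: "nat \<Rightarrow> nat \<Rightarrow> (nat \<Rightarrow> nat \<Rightarrow> nat) \<Rightarrow> nat set set" where
  "win_bases k n r = {I. I \<subseteq> {0..<n} \<and> card I = k \<and> (\<forall>i j. i \<le> j \<longrightarrow> j \<le> i + n \<longrightarrow> card (I \<inter> win n i j) \<le> r i j)}"

text \<open>Applied to \<open>M\<close> and to the support of a matrix, this turns equality of
  window ranks into equality of bases.\<close>

lemma squares_filled_imp_win_bases: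
  assumes M: "matroid k M" and ground: "\<And>B. B \<in> M \<Longrightarrow> B \<subseteq> {0..<n}" and sq: "squares_filled M"
  shows "M = win_bases k n (\<lambda>i j. rk M (win n i j))"
proof (intro equalityI subsetI)
  interpret matroid k M by (rule M)
  fix I assume "I \<in> M"
  then show "I \<in> win_bases k n (\<lambda>i j. rk M (win n i j))"
    unfolding win_bases_def using ground card_basis card_Int_le_rk by auto
next
  interpret matroid k M by (rule M)
  fix I assume I: "I \<in> win_bases k n (\<lambda>i j. rk M (win n i j))"
  show "I \<in> M"
  proof (rule ccontr)
    assume nI: "I \<notin> M"
    have I': "I \<subseteq> {0..<n}" "card I = k" using I by (auto simp: win_bases_def)
    obtain B where B: "B \<in> M" "card (B \<inter> I) = rk M I" using rk_attained by blast
    have "rk M I < card I"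
    proof (rule ccontr)
      assume "\<not> rk M I < card I"
      then have "card B \<le> card (B \<inter> I)" using B card_basis I'(2) by simp
      then have "B \<inter> I = B" using finite_basis[OF B(1)] by (intro card_subset_eq) (auto intro!: le_antisym card_mono)
      then have "B \<subseteq> I" by auto
      then have "B = I" using I' card_basis[OF B(1)] finite_subset[OF I'(1)] by (metis card_subset_eq finite_atLeastLessThan)
      then show False using B nI by simp
    qed
    \<comment> \<open>The search starts from \<open>X = I\<close>, which violates its own rank bound
      because \<open>I\<close> is not a basis.\<close>
    then show False using violated_window[OF M ground sq I', of I] I I' by (force simp: win_bases_def)
  qed
qed

section \<open>Minors of a real matrix\<close>

text \<open>Columns come as a list in arbitrary order, possibly with repetitions, so that a column
  can be replaced or moved in place. \<open>minor\<close> is the sorted case.\<close>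

definition ldet :: "nat \<Rightarrow> (nat \<Rightarrow> 'a \<Rightarrow> real) \<Rightarrow> 'a list \<Rightarrow> real" where
  "ldet k A xs = det_nat k (\<lambda>i j. A i (xs ! j))"

definition minor :: "nat \<Rightarrow> (nat \<Rightarrow> 'a::linorder \<Rightarrow> real) \<Rightarrow> 'a set \<Rightarrow> real" where
  "minor k A I = ldet k A (sorted_list_of_set I)"

definition colmat :: "nat \<Rightarrow> (nat \<Rightarrow> 'a \<Rightarrow> real) \<Rightarrow> 'a list \<Rightarrow> real Matrix.mat" where
  "colmat k A xs = Matrix.mat k k (\<lambda>(i, j). A i (xs ! j))"

lemma colmat_carrier: "colmat k A xs \<in> carrier_mat k k"
  by (simp add: colmat_def)

lemma ldet_eq_det: "ldet k A xs = Determinant.det (colmat k A xs)"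
proof -
  have "(\<Prod>i = 0..<k. colmat k A xs $$ (i, p i)) = (\<Prod>i<k. A i (xs ! p i))" if "p permutes {0..<k}" for p
    unfolding atLeast0LessThan using that permutes_in_image[OF that]
    by (intro prod.cong) (auto simp: colmat_def)
  then show ?thesis
    unfolding ldet_def det_nat_def det_def'[OF colmat_carrier] by (intro sum.cong) auto
qed

lemma ldet_cong:
  assumes "length xs = k" "\<And>i x. i < k \<Longrightarrow> x \<in> set xs \<Longrightarrow> A i x = A' i x"
  shows "ldet k A xs = ldet k A' xs"
  unfolding ldet_eq_det colmat_def
  using assms by (intro arg_cong[of _ _ Determinant.det] eq_matI) auto

text \<open>\<open>undefined\<close> merely occupies the column that is expanded; the cofactor
  deletes it, so the value depends only on the columns \<open>us\<close> and
  \<open>vs\<close>.\<close>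

definition column_cofactor :: "nat \<Rightarrow> (nat \<Rightarrow> 'a \<Rightarrow> real) \<Rightarrow> 'a list \<Rightarrow> 'a list \<Rightarrow> nat \<Rightarrow> real" where
  "column_cofactor k A us vs i = cofactor (colmat k A (us @ undefined # vs)) i (length us)"

text \<open>Laplace expansion whose coefficients serve for every \<open>x\<close> and for every
  matrix agreeing with \<open>A\<close> on the other columns. Linearity in one column follows by
  comparing such expansions.\<close>

lemma ldet_column:
  assumes k: "Suc (length us + length vs) = k"
    and A': "\<And>i x. i < k \<Longrightarrow> x \<in> set us \<union> set vs \<Longrightarrow> A' i x = A i x"
  shows "ldet k A' (us @ x # vs) = (\<Sum>i<k. A' i x * column_cofactor k A us vs i)"
proof -
  let ?q = "length us"
  have "cofactor (colmat k A' (us @ x # vs)) i ?q = column_cofactor k A us vs i" if "i < k" for i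
  proof -
    have "mat_delete (colmat k A' (us @ x # vs)) i ?q = mat_delete (colmat k A (us @ undefined # vs)) i ?q"
      using k that unfolding mat_delete_def colmat_def
      by (intro eq_matI) (auto simp: nth_append nth_Cons' A')
    then show ?thesis unfolding cofactor_def column_cofactor_def by simp
  qed
  moreover have "colmat k A' (us @ x # vs) $$ (i, ?q) = A' i x" if "i < k" for i
    using k that by (auto simp: colmat_def nth_append)
  ultimately show ?thesis
    unfolding ldet_eq_det
    using laplace_expansion_column[OF colmat_carrier[of k A' "us @ x # vs"], of ?q] k by simp
qed

lemma ldet_repeat:
  assumes "length xs = k" "i < k" "j < k" "i \<noteq> j" "xs ! i = xs ! j"
  shows "ldet k A xs = 0"
  unfolding ldet_eq_det
  by (rule det_identical_columns[OF colmat_carrier assms(4,2,3)])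
    (use assms in \<open>auto simp: colmat_def col_def\<close>)

lemma ldet_not_distinct: "length xs = k \<Longrightarrow> \<not> distinct xs \<Longrightarrow> ldet k A xs = 0"
  using ldet_repeat[of xs k] by (metis distinct_conv_nth)

lemma ldet_swap:
  assumes "length (us @ x # y # vs) = k"
  shows "ldet k A (us @ y # x # vs) = - ldet k A (us @ x # y # vs)"
proof -
  let ?q = "length us"
  have q: "?q < k" "Suc ?q < k" using assms by auto
  have "colmat k A (us @ y # x # vs) = swapcols ?q (Suc ?q) (colmat k A (us @ x # y # vs))"
  proof (intro eq_matI)
    fix i j
    assume "i < dim_row (swapcols ?q (Suc ?q) (colmat k A (us @ x # y # vs)))"
      "j < dim_col (swapcols ?q (Suc ?q) (colmat k A (us @ x # y # vs)))"
    then have ij: "i < k" "j < k" by (auto simp: colmat_def)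
    consider "j < ?q" | "j = ?q" | "j = Suc ?q" | "j > Suc ?q" by linarith
    then show "colmat k A (us @ y # x # vs) $$ (i, j) =
        swapcols ?q (Suc ?q) (colmat k A (us @ x # y # vs)) $$ (i, j)"
      using ij q by cases (auto simp: colmat_def nth_append nth_Cons')
  qed (auto simp: colmat_def)
  then show ?thesis
    unfolding ldet_eq_det using det_swapcols[OF q(1,2) _ colmat_carrier] by simp
qed

text \<open>The column \<open>x\<close> moves left past the larger entries of \<open>us\<close>,
  with one sign change for each.\<close>

lemma ldet_insort:
  assumes "sorted us" "x \<notin> set us" "length (us @ x # vs) = k"
  shows "ldet k A (us @ x # vs) = (-1) ^ length (filter (\<lambda>u. x < u) us) * ldet k A (insort x us @ vs)"
  using assms
proof (induction us arbitrary: vs rule: rev_induct)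
  case Nil
  then show ?case by simp
next
  case (snoc u us)
  show ?case
  proof (cases "x < u")
    case True
    have "insort x (us @ [u]) = insort x us @ [u]"
      using True snoc.prems(1) by (induction us) auto
    moreover have "ldet k A (us @ u # x # vs) = - ldet k A (us @ x # u # vs)"
      using snoc.prems(3) by (intro ldet_swap) auto
    moreover have "ldet k A (us @ x # u # vs) =
        (-1) ^ length (filter (\<lambda>u. x < u) us) * ldet k A (insort x us @ u # vs)"
      using snoc.prems by (intro snoc.IH) (auto simp: sorted_append)
    ultimately show ?thesis using True by simp
  next
    case False
    then have le: "\<forall>v\<in>set (us @ [u]). v < x" using snoc.prems(1,2) by (force simp: sorted_append)
    have "insort x zs = zs @ [x]" if "\<forall>v\<in>set zs. v < x" for zs
      using that by (induction zs) auto
    from this[of "us @ [u]"] have "insort x (us @ [u]) = (us @ [u]) @ [x]" using le by simp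
    moreover have "filter (\<lambda>v. x < v) (us @ [u]) = []"
      using le by (auto simp: filter_empty_conv)
    ultimately show ?thesis by simp
  qed
qed

lemma ldet_sort:
  assumes "sorted us" "distinct (us @ zs)"
  shows "\<exists>s::real. s \<noteq> 0 \<and> (\<forall>k A. length (us @ zs) = k \<longrightarrow> ldet k A (us @ zs) = s * ldet k A (sort (us @ zs)))"
  using assms
proof (induction zs arbitrary: us)
  case Nil
  then show ?case by (intro exI[of _ 1]) (simp add: sorted_sort_id)
next
  case (Cons z zs)
  obtain s where s: "s \<noteq> 0" "\<And>k A. length (insort z us @ zs) = k \<Longrightarrow>
      ldet k A (insort z us @ zs) = s * ldet k A (sort (insort z us @ zs))"
    using Cons.IH[of "insort z us"] Cons.prems by (auto simp: sorted_insort set_insort_key distinct_insort)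
  have "sort (insort z us @ zs) = sort (us @ z # zs)"
    by (rule properties_for_sort) auto
  then show ?case
    using s ldet_insort[OF Cons.prems(1), of z zs] Cons.prems(2)
    by (intro exI[of _ "(-1) ^ length (filter (\<lambda>u. z < u) us) * s"]) auto
qed

lemma sort_eq_sorted_list_of_set: "distinct xs \<Longrightarrow> sort xs = sorted_list_of_set (set xs)"
  by (simp add: sorted_list_of_set_sort_remdups distinct_remdups_id)

lemma ldet_nonzero_iff:
  assumes "distinct xs" "length xs = k"
  shows "ldet k A xs \<noteq> 0 \<longleftrightarrow> minor k A (set xs) \<noteq> 0"
  using ldet_sort[of "[]" xs] assms
  by (auto simp: minor_def sort_eq_sorted_list_of_set)

text \<open>\<open>A'\<close> is \<open>A\<close> multiplied from the left by the inverse of its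
  submatrix on the columns \<open>xs\<close>. This expands every column of \<open>A\<close> in those
  columns and rescales all maximal minors by a common factor.\<close>

lemma row_reduce:
  assumes "length xs = k" "ldet k A xs \<noteq> 0"
  shows "\<exists>A'. (\<forall>i<k. \<forall>v. A i v = (\<Sum>j<k. A i (xs ! j) * A' j v)) \<and>
    (\<forall>j<k. \<forall>l<k. A' j (xs ! l) = (if j = l then 1 else 0)) \<and>
    (\<forall>ys. length ys = k \<longrightarrow> ldet k A ys = ldet k A xs * ldet k A' ys)"
proof -
  let ?G = "colmat k A xs"
  have G: "?G \<in> carrier_mat k k" by (rule colmat_carrier)
  have "?G \<in> Units (ring_mat TYPE(real) k ())"
    using det_non_zero_imp_unit[OF G] assms(2) by (simp add: ldet_eq_det)
  then obtain H where H: "H \<in> carrier_mat k k" "H * ?G = 1\<^sub>m k" "?G * H = 1\<^sub>m k"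
    unfolding Units_def ring_mat_def by auto
  define A' where "A' j v = (\<Sum>l<k. H $$ (j, l) * A l v)" for j v
  have mm: "(P * Q) $$ (i, j) = (\<Sum>l<k. P $$ (i, l) * Q $$ (l, j))"
    if "P \<in> carrier_mat k k" "Q \<in> carrier_mat k k" "i < k" "j < k" for P Q :: "real Matrix.mat" and i j
    using that by (auto simp: times_mat_def scalar_prod_def atLeast0LessThan intro!: sum.cong)
  have 1: "A i v = (\<Sum>j<k. A i (xs ! j) * A' j v)" if i: "i < k" for i v
  proof -
    have "(\<Sum>j<k. A i (xs ! j) * A' j v) = (\<Sum>j<k. \<Sum>l<k. A i (xs ! j) * H $$ (j, l) * A l v)"
      unfolding A'_def by (simp add: sum_distrib_left mult.assoc)
    also have "\<dots> = (\<Sum>l<k. (\<Sum>j<k. A i (xs ! j) * H $$ (j, l)) * A l v)"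
      by (subst sum.swap) (simp add: sum_distrib_right)
    also have "\<dots> = (\<Sum>l<k. (?G * H) $$ (i, l) * A l v)"
      using i mm[OF G H(1) i] by (intro sum.cong) (auto simp: colmat_def)
    also have "\<dots> = (\<Sum>l<k. (if i = l then A l v else 0))"
      unfolding H(3) using i by (intro sum.cong) auto
    also have "\<dots> = A i v" using i by simp
    finally show ?thesis by simp
  qed
  have 2: "A' j (xs ! l) = (if j = l then 1 else 0)" if "j < k" "l < k" for j l
  proof -
    have "A' j (xs ! l) = (H * ?G) $$ (j, l)"
      unfolding A'_def mm[OF H(1) G that] using that by (intro sum.cong) (auto simp: colmat_def)
    then show ?thesis using H(2) that by simp
  qed
  have 3: "ldet k A ys = ldet k A xs * ldet k A' ys" if "length ys = k" for ys
  proof -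
    have "colmat k A ys = ?G * colmat k A' ys"
    proof (intro eq_matI)
      fix i j assume "i < dim_row (?G * colmat k A' ys)" "j < dim_col (?G * colmat k A' ys)"
      then have ij: "i < k" "j < k" by (auto simp: colmat_def)
      show "colmat k A ys $$ (i, j) = (?G * colmat k A' ys) $$ (i, j)"
        unfolding mm[OF G colmat_carrier ij] using ij 1[OF ij(1), of "ys ! j"] by (auto simp: colmat_def)
    qed (auto simp: colmat_def)
    then show ?thesis unfolding ldet_eq_det using det_mult[OF G colmat_carrier] by simp
  qed
  show ?thesis using 1 2 3 by (intro exI[of _ A'] conjI allI impI) assumption+
qed

lemma ldet_replace_unit:
  assumes "length (us @ x # vs) = k" "q = length us"
    and unit: "\<And>j l. j < k \<Longrightarrow> l < k \<Longrightarrow> A j ((us @ x # vs) ! l) = (if j = l then 1 else 0)"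
  shows "ldet k A (us @ y # vs) = A q y"
proof -
  let ?f = "\<lambda>p. of_int (sign p) * (\<Prod>i<k. A i ((us @ y # vs) ! p i))"
  have q: "q < k" using assms by simp
  have same: "(us @ y # vs) ! l = (us @ x # vs) ! l" if "l \<noteq> q" for l
    using that assms by (simp add: nth_append nth_Cons')
  \<comment> \<open>A permutation other than the identity sends some row \<open>i\<close> to a
    column different from \<open>i\<close> and from the replaced column \<open>q\<close>; otherwise
    \<open>q\<close> would be fixed and, by injectivity, everything else too. The entry found there
    is an off-diagonal zero of the identity.\<close>
  have zero: "?f p = 0" if p: "p permutes {0..<k}" "p \<noteq> id" for p
  proof -
    have "\<exists>i<k. p i \<noteq> q \<and> p i \<noteq> i"
    proof (rule ccontr)
      assume "\<not> ?thesis"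
      then have h: "\<And>i. i < k \<Longrightarrow> p i = q \<or> p i = i" by blast
      then have pq: "p q = q" using q by blast
      have "p i = i" for i
      proof (cases "i < k")
        case True
        then show ?thesis using h[OF True] pq permutes_inj[OF p(1)] by (metis injD)
      next
        case False
        then show ?thesis using p(1) by (auto simp: permutes_def)
      qed
      then show False using p(2) by auto
    qed
    then obtain i where i: "i < k" "p i \<noteq> q" "p i \<noteq> i" by blast
    have "p i < k" using i(1) permutes_in_image[OF p(1), of i] by simp
    then have "A i ((us @ y # vs) ! p i) = 0" using same[OF i(2)] unit[OF i(1)] i(3) by simp
    then have "(\<Prod>i<k. A i ((us @ y # vs) ! p i)) = 0" using i(1) by (intro prod_zero) auto
    then show ?thesis by simp
  qed
  have fin: "finite {p. p permutes {0..<k}}" by (simp add: finite_permutations)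
  have "ldet k A (us @ y # vs) = (\<Sum>p\<in>{p. p permutes {0..<k}}. ?f p)"
    by (simp add: ldet_def det_nat_def)
  also have "\<dots> = (\<Sum>p\<in>{id}. ?f p)"
    using fin zero by (intro sum.mono_neutral_right) (auto simp: permutes_id)
  also have "\<dots> = (\<Prod>i<k. A i ((us @ y # vs) ! i))" by (simp add: sign_id)
  also have "\<dots> = (\<Prod>i<k. if i = q then A q y else 1)"
  proof (intro prod.cong refl)
    fix i assume "i \<in> {..<k}"
    then show "A i ((us @ y # vs) ! i) = (if i = q then A q y else 1)"
      using same[of i] unit[of i i] assms(2) by (cases "i = q") (auto simp: nth_append)
  qed
  also have "\<dots> = A q y" using q by simp
  finally show ?thesis .
qed

lemma ldet_zero_row:
  assumes "q < k" "length ys = k" "\<And>y. y \<in> set ys \<Longrightarrow> A q y = 0"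
  shows "ldet k A ys = 0"
proof -
  have "(\<Prod>i<k. A i (ys ! p i)) = 0" if p: "p permutes {0..<k}" for p
  proof -
    have "p q < k" using permutes_in_image[OF p, of q] assms(1) by simp
    then show ?thesis using assms by (intro prod_zero) (auto intro!: bexI[of _ q])
  qed
  then show ?thesis unfolding ldet_def det_nat_def by (intro sum.neutral) simp
qed

section \<open>Supports of totally nonnegative matrices\<close>

definition supp :: "nat \<Rightarrow> 'a::linorder set \<Rightarrow> (nat \<Rightarrow> 'a \<Rightarrow> real) \<Rightarrow> 'a set set" where
  "supp k E A = {I. I \<subseteq> E \<and> finite I \<and> card I = k \<and> minor k A I \<noteq> 0}"

definition tnn :: "nat \<Rightarrow> 'a::linorder set \<Rightarrow> (nat \<Rightarrow> 'a \<Rightarrow> real) \<Rightarrow> bool" where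
  "tnn k E A \<longleftrightarrow> (\<forall>I\<subseteq>E. finite I \<longrightarrow> card I = k \<longrightarrow> 0 \<le> minor k A I)"

text \<open>Replacing the \<open>q\<close>-th of the unit columns by column \<open>y\<close> gives a
  determinant equal to \<open>A' q y\<close>. So the zero pattern of the reduced matrix records
  which exchanges at \<open>I\<close> lead to bases.\<close>

lemma reduced_entry:
  assumes I: "finite I" "card I = k" "minor k A I \<noteq> 0" and q: "q < k" and y: "y \<notin> I"
    and xs: "xs = sorted_list_of_set I"
    and unit: "\<And>j l. j < k \<Longrightarrow> l < k \<Longrightarrow> A' j (xs ! l) = (if j = l then 1 else 0)"
    and red: "\<And>ys. length ys = k \<Longrightarrow> ldet k A ys = ldet k A xs * ldet k A' ys"
  shows "minor k A (insert y (I - {xs ! q})) \<noteq> 0 \<longleftrightarrow> A' q y \<noteq> 0"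
proof -
  have len: "length xs = k" and d: "distinct xs" and s: "set xs = I" using I xs by auto
  let ?us = "take q xs" and ?vs = "drop (Suc q) xs"
  have split: "?us @ xs ! q # ?vs = xs" using q len by (simp add: id_take_nth_drop[symmetric])
  have lu: "length ?us = q" using q len by simp
  have dist: "distinct (?us @ xs ! q # ?vs)" using d split by simp
  have set_eq: "set (?us @ xs ! q # ?vs) = I" using s split by simp
  have "ldet k A' (?us @ y # ?vs) = A' q y"
    by (rule ldet_replace_unit[of _ "xs ! q"]) (use len lu split unit in auto)
  moreover have "ldet k A (?us @ y # ?vs) = ldet k A xs * ldet k A' (?us @ y # ?vs)"
    using len q by (intro red) auto
  moreover have "ldet k A xs \<noteq> 0" using I(3) xs by (simp add: minor_def)
  moreover have "ldet k A (?us @ y # ?vs) \<noteq> 0 \<longleftrightarrow> minor k A (set (?us @ y # ?vs)) \<noteq> 0"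
    using dist set_eq y len q by (intro ldet_nonzero_iff) auto
  moreover have "set (?us @ y # ?vs) = insert y (I - {xs ! q})"
    using dist set_eq by auto
  ultimately show ?thesis by simp
qed

text \<open>If no element of \<open>B2\<close> could replace \<open>x\<close>, the row of
  \<open>x\<close> in the matrix reduced at \<open>B1\<close> would vanish on all of
  \<open>B2\<close>, making the minor at \<open>B2\<close> zero.\<close>

lemma supp_matroid:
  assumes "supp k E A \<noteq> {}"
  shows "matroid k (supp k E A)"
proof
  fix B1 B2 x
  assume B1: "B1 \<in> supp k E A" and B2: "B2 \<in> supp k E A" and x: "x \<in> B1 - B2"
  define xs where "xs = sorted_list_of_set B1"
  have b1: "finite B1" "card B1 = k" "minor k A B1 \<noteq> 0" "B1 \<subseteq> E" using B1 by (auto simp: supp_def)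
  have b2: "finite B2" "card B2 = k" "minor k A B2 \<noteq> 0" "B2 \<subseteq> E" using B2 by (auto simp: supp_def)
  have xs: "length xs = k" "distinct xs" "set xs = B1" using b1 by (auto simp: xs_def)
  have nz: "ldet k A xs \<noteq> 0" using b1 by (simp add: minor_def xs_def)
  obtain A' where "\<forall>j<k. \<forall>l<k. A' j (xs ! l) = (if j = l then 1 else 0)"
    "\<forall>ys. length ys = k \<longrightarrow> ldet k A ys = ldet k A xs * ldet k A' ys"
    using row_reduce[OF xs(1) nz] by blast
  then have A': "\<And>j l. j < k \<Longrightarrow> l < k \<Longrightarrow> A' j (xs ! l) = (if j = l then 1 else 0)"
    "\<And>ys. length ys = k \<Longrightarrow> ldet k A ys = ldet k A xs * ldet k A' ys"
    by blast+
  obtain q where q: "q < k" "xs ! q = x" using x xs by (metis DiffE in_set_conv_nth)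
  have entry: "minor k A (insert y (B1 - {x})) \<noteq> 0 \<longleftrightarrow> A' q y \<noteq> 0" if "y \<notin> B1" for y
    using reduced_entry[OF b1(1-3) q(1) that xs_def A'] q(2) by simp
  show "\<exists>y\<in>B2 - B1. insert y (B1 - {x}) \<in> supp k E A"
  proof (rule ccontr)
    assume no: "\<not> ?thesis"
    have "A' q y = 0" if y: "y \<in> B2" for y
    proof (cases "y \<in> B1")
      case True
      then obtain l where "l < k" "xs ! l = y" using xs by (metis in_set_conv_nth)
      then show ?thesis using A'(1)[OF q(1), of l] q x y by auto
    next
      case False
      have "card (insert y (B1 - {x})) = k"
        using False b1 x card_Suc_Diff1[of B1 x] by auto
      then have "insert y (B1 - {x}) \<in> supp k E A" if "minor k A (insert y (B1 - {x})) \<noteq> 0"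
        using that b1 b2 y by (auto simp: supp_def)
      then show ?thesis using entry[OF False] no y False by blast
    qed
    then have "ldet k A' (sorted_list_of_set B2) = 0"
      using b2 by (intro ldet_zero_row[OF q(1)]) auto
    then have "minor k A B2 = 0" unfolding minor_def using A'(2)[of "sorted_list_of_set B2"] b2 by simp
    then show False using b2 by simp
  qed
qed (use assms in \<open>auto simp: supp_def\<close>)

text \<open>The sign of sorting in the appended pair factors into one contribution per element: as
  \<open>x < y\<close>, inserting \<open>x\<close> does not change how many entries \<open>y\<close>
  has to pass.\<close>

lemma minor_pair:
  fixes S :: "'a::linorder set"
  assumes S: "finite S" "Suc (Suc (card S)) = k" and xy: "x \<notin> S" "y \<notin> S" "x < y"
  defines "\<eta> \<equiv> \<lambda>z. (-1) ^ length (filter (\<lambda>u. z < u) (sorted_list_of_set S)) :: real"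
  shows "ldet k A (sorted_list_of_set S @ [x, y]) = \<eta> x * \<eta> y * minor k A (S \<union> {x, y})"
proof -
  let ?s = "sorted_list_of_set S"
  have 1: "ldet k A (?s @ [x, y]) = \<eta> x * ldet k A (insort x ?s @ [y])"
    unfolding \<eta>_def using S xy by (intro ldet_insort[of ?s x "[y]"]) auto
  have "filter (\<lambda>u. y < u) (insort x ?s) = filter (\<lambda>u. y < u) ?s"
    using xy by (intro filter_insort_triv) auto
  then have 2: "ldet k A (insort x ?s @ [y]) = \<eta> y * ldet k A (insort y (insort x ?s))"
    unfolding \<eta>_def using S xy ldet_insort[of "insort x ?s" y "[]" k A]
    by (auto simp: sorted_insort set_insort_key)
  have "insort y (insort x ?s) = sorted_list_of_set (insert y (insert x S))"
    using S xy by (simp add: sorted_list_of_set_insert)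
  also have "insert y (insert x S) = S \<union> {x, y}" by auto
  finally show ?thesis using 1 2 by (simp add: minor_def)
qed

text \<open>Because the minor of \<open>S \<union> {a, b}\<close> is nonzero, column
  \<open>d\<close> is a combination of the columns of \<open>S\<close>, \<open>a\<close> and
  \<open>b\<close>. Substituting it proves the relation for unsorted determinants; all three
  products carry the same sign \<open>\<eta> a * \<eta> b * \<eta> c * \<eta> d\<close>, which
  cancels.\<close>

lemma three_term_Pluecker:
  fixes a b c d :: "'a::linorder"
  assumes S: "finite S" "Suc (Suc (card S)) = k" and abcd: "a < b" "b < c" "c < d" "S \<inter> {a, b, c, d} = {}"
    and nz: "minor k A (S \<union> {a, b}) \<noteq> 0"
  shows "minor k A (S \<union> {a, c}) * minor k A (S \<union> {b, d}) =
    minor k A (S \<union> {a, b}) * minor k A (S \<union> {c, d}) + minor k A (S \<union> {a, d}) * minor k A (S \<union> {b, c})"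
proof -
  define s where "s = sorted_list_of_set S"
  define D where "D x y = ldet k A (s @ [x, y])" for x y
  define \<eta> where "\<eta> z = ((-1) ^ length (filter (\<lambda>u. z < u) s) :: real)" for z
  have s: "length s = k - 2" "set s = S" "2 \<le> k" using S by (auto simp: s_def)
  have D: "D x y = \<eta> x * \<eta> y * minor k A (S \<union> {x, y})" if "x \<notin> S" "y \<notin> S" "x < y" for x y
    unfolding D_def \<eta>_def s_def using minor_pair[OF S that] .
  have \<eta>: "\<eta> z * \<eta> z = 1" for z unfolding \<eta>_def by (simp add: power_add[symmetric] mult_2[symmetric])
  have Dab: "D a b \<noteq> 0" using D[of a b] nz \<eta> abcd by (metis IntI empty_iff insert_iff mult_eq_0_iff zero_neq_one)
  have swap: "D y x = - D x y" for x y unfolding D_def using ldet_swap[of s x y "[]"] s by simp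
  have rep: "D x x = 0" for x using swap[of x x] by simp
  let ?xs = "s @ [a, b]"
  have len: "length ?xs = k" using s by simp
  have nz': "ldet k A ?xs \<noteq> 0" using Dab by (simp add: D_def)
  obtain A' where A': "\<forall>i<k. \<forall>v. A i v = (\<Sum>j<k. A i (?xs ! j) * A' j v)"
    using row_reduce[OF len nz'] by blast
  \<comment> \<open>In \<open>s @ [a, b]\<close> the columns \<open>a\<close> and \<open>b\<close>
    stand at positions \<open>k - 2\<close> and \<open>k - 1\<close>; the terms of the other
    positions repeat a column of \<open>S\<close> and vanish.\<close>
  have expand: "D z d = A' (k - 2) d * D z a + A' (k - 1) d * D z b" for z
  proof -
    have l: "Suc (length (s @ [z]) + length ([] :: 'a list)) = k" using s by simp
    let ?C = "column_cofactor k A (s @ [z]) []"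
    have Dz: "D z x = (\<Sum>i<k. A i x * ?C i)" for x using ldet_column[OF l, of A A x] by (simp add: D_def)
    have "D z d = (\<Sum>i<k. (\<Sum>j<k. A i (?xs ! j) * A' j d) * ?C i)"
      unfolding Dz by (intro sum.cong refl) (use A' in simp)
    also have "\<dots> = (\<Sum>j<k. A' j d * (\<Sum>i<k. A i (?xs ! j) * ?C i))"
      unfolding sum_distrib_left sum_distrib_right by (subst sum.swap) (simp add: mult_ac)
    also have "\<dots> = (\<Sum>j<k. A' j d * D z (?xs ! j))" unfolding Dz ..
    also have "\<dots> = (\<Sum>j\<in>{k - 2, k - 1}. A' j d * D z (?xs ! j))"
    proof (intro sum.mono_neutral_right ballI)
      fix j assume "j \<in> {..<k} - {k - 2, k - 1}"
      then have "j < length s" using s by auto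
      then have "D z (?xs ! j) = 0"
        unfolding D_def using s by (intro ldet_not_distinct) (auto simp: nth_append)
      then show "A' j d * D z (?xs ! j) = 0" by simp
    qed (use s in auto)
    also have "\<dots> = A' (k - 2) d * D z a + A' (k - 1) d * D z b"
    proof -
      have "?xs ! (k - 2) = a" "?xs ! (k - 1) = b" "k - 2 \<noteq> k - 1" using s by (auto simp: nth_append)
      then show ?thesis by simp
    qed
    finally show ?thesis .
  qed
  have e1: "D a d = A' (k - 1) d * D a b" using expand[of a] rep by simp
  have e2: "D b d = - A' (k - 2) d * D a b" using expand[of b] rep swap[of b a] by simp
  have e3: "D c d = - A' (k - 2) d * D a c - A' (k - 1) d * D b c"
    using expand[of c] swap[of c a] swap[of c b] by simp
  have "D a c * D b d = D a b * D c d + D a d * D b c" unfolding e1 e2 e3 by (simp add: algebra_simps)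
  moreover have "D a b = \<eta> a * \<eta> b * minor k A (S \<union> {a, b})" "D c d = \<eta> c * \<eta> d * minor k A (S \<union> {c, d})"
    "D a c = \<eta> a * \<eta> c * minor k A (S \<union> {a, c})" "D b d = \<eta> b * \<eta> d * minor k A (S \<union> {b, d})"
    "D a d = \<eta> a * \<eta> d * minor k A (S \<union> {a, d})" "D b c = \<eta> b * \<eta> c * minor k A (S \<union> {b, c})"
    using abcd by (simp_all add: D del: Un_insert_right)
  ultimately have "(\<eta> a * \<eta> b * \<eta> c * \<eta> d) * (minor k A (S \<union> {a, c}) * minor k A (S \<union> {b, d})) =
      (\<eta> a * \<eta> b * \<eta> c * \<eta> d) * (minor k A (S \<union> {a, b}) * minor k A (S \<union> {c, d}) +
      minor k A (S \<union> {a, d}) * minor k A (S \<union> {b, c}))" by (simp add: algebra_simps)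
  moreover have "\<eta> a * \<eta> b * \<eta> c * \<eta> d \<noteq> 0" by (simp add: \<eta>_def)
  ultimately show ?thesis by (metis mult_left_cancel)
qed

text \<open>On the right of the Pluecker relation one product is positive and the other nonnegative,
  so neither diagonal can have minor zero.\<close>

lemma supp_squares_filled:
  assumes A: "tnn k E A"
  shows "squares_filled (supp k E A)"
  unfolding squares_filled_def
proof (intro allI impI)
  fix S a b c d
  assume abcd: "a < b" "b < c" "c < d" "S \<inter> {a, b, c, d} = {}"
    and "S \<union> {a, b} \<in> supp k E A" "S \<union> {a, d} \<in> supp k E A" "S \<union> {b, c} \<in> supp k E A" "S \<union> {c, d} \<in> supp k E A"
  then have sub: "S \<union> {a, b, c, d} \<subseteq> E" and fin: "finite S" and nz: "minor k A (S \<union> {a, b}) \<noteq> 0"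
    "minor k A (S \<union> {c, d}) \<noteq> 0" and card: "card (S \<union> {a, b}) = k" by (auto simp: supp_def)
  have k: "Suc (Suc (card S)) = k" using card fin abcd by auto
  have pair: "card (S \<union> {x, y}) = k" if "x \<notin> S" "y \<notin> S" "x \<noteq> y" for x y using that fin k by auto
  have ge: "0 \<le> minor k A (S \<union> {x, y})" if "x \<notin> S" "y \<notin> S" "x \<noteq> y" "x \<in> E" "y \<in> E" for x y
    using A pair[OF that(1-3)] that sub fin by (auto simp: tnn_def)
  have "0 \<le> minor k A (S \<union> {a, b})" "0 \<le> minor k A (S \<union> {c, d})"
    using abcd sub by (simp_all add: ge del: Un_insert_right)
  then have "0 < minor k A (S \<union> {a, b}) * minor k A (S \<union> {c, d})"
    using nz by (intro mult_pos_pos) (simp_all add: less_le)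
  moreover have "0 \<le> minor k A (S \<union> {a, d}) * minor k A (S \<union> {b, c})"
    using ge[of a d] ge[of b c] abcd sub by (intro mult_nonneg_nonneg) auto
  ultimately have "minor k A (S \<union> {a, c}) * minor k A (S \<union> {b, d}) \<noteq> 0"
    using three_term_Pluecker[OF fin k abcd nz(1)] by linarith
  then show "S \<union> {a, c} \<in> supp k E A \<and> S \<union> {b, d} \<in> supp k E A"
    using pair[of a c] pair[of b d] abcd sub fin by (auto simp: supp_def)
qed

text \<open>Once the columns of \<open>B0\<close> form the identity, optimality of \<open>B0\<close> makes every nonzero entry in row
  \<open>b\<close> and column \<open>v\<close> satisfy \<open>w v \<le> w b\<close>. Keeping the entries with equality keeps, in the Leibniz
  expansion of a minor, all nonzero terms if the index set is optimal and none otherwise.\<close>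

lemma initial_tnn:
  fixes w :: "'a::linorder \<Rightarrow> real"
  assumes A: "tnn k E A" and B0: "B0 \<in> supp k E A"
    and opt: "\<And>B. B \<in> supp k E A \<Longrightarrow> sum w B \<le> sum w B0"
  obtains A2 where "tnn k E A2" "supp k E A2 = {B \<in> supp k E A. sum w B = sum w B0}"
proof -
  define xs where "xs = sorted_list_of_set B0"
  have b0: "finite B0" "card B0 = k" "minor k A B0 \<noteq> 0" "B0 \<subseteq> E" using B0 by (auto simp: supp_def)
  have xs: "length xs = k" "distinct xs" "set xs = B0" using b0 by (auto simp: xs_def)
  have nz: "ldet k A xs \<noteq> 0" using b0 by (simp add: minor_def xs_def)
  obtain A1 where "\<forall>j<k. \<forall>l<k. A1 j (xs ! l) = (if j = l then 1 else 0)"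
    "\<forall>ys. length ys = k \<longrightarrow> ldet k A ys = ldet k A xs * ldet k A1 ys"
    using row_reduce[OF xs(1) nz] by blast
  then have A1: "\<And>j l. j < k \<Longrightarrow> l < k \<Longrightarrow> A1 j (xs ! l) = (if j = l then 1 else 0)"
    "\<And>ys. length ys = k \<Longrightarrow> ldet k A ys = ldet k A xs * ldet k A1 ys"
    by blast+
  have pos: "0 < ldet k A xs" using A b0 nz by (auto simp: tnn_def minor_def xs_def less_le)
  have sum_nth: "sum w (set ys) = (\<Sum>j<k. w (ys ! j))" if "distinct ys" "length ys = k" for ys
    using that bij_betw_nth[of ys "{..<k}" "set ys"] by (intro sum.reindex_bij_betw[symmetric]) auto
  \<comment> \<open>A nonzero entry in row \<open>j\<close> and column \<open>v\<close> outside
    \<open>B0\<close> makes \<open>insert v (B0 - {xs ! j})\<close> a basis, whose weight cannot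
    exceed that of \<open>B0\<close>.\<close>
  have le: "w v \<le> w (xs ! j)" if j: "j < k" and v: "v \<in> E" "A1 j v \<noteq> 0" for j v
  proof (cases "v \<in> B0")
    case True
    then obtain l where "l < k" "xs ! l = v" using xs by (metis in_set_conv_nth)
    then show ?thesis using A1(1)[OF j, of l] v by (auto split: if_splits)
  next
    case False
    have xj: "xs ! j \<in> B0" using j xs by (metis nth_mem)
    have "minor k A (insert v (B0 - {xs ! j})) \<noteq> 0"
      using reduced_entry[OF b0(1-3) j False xs_def A1] v by simp
    moreover have "card (insert v (B0 - {xs ! j})) = k"
      using False b0 xj card_Suc_Diff1[of B0 "xs ! j"] by auto
    ultimately have "insert v (B0 - {xs ! j}) \<in> supp k E A" using b0 v by (auto simp: supp_def)
    then have "sum w (insert v (B0 - {xs ! j})) \<le> sum w B0" by (rule opt)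
    moreover have "sum w (insert v (B0 - {xs ! j})) = w v + (sum w B0 - w (xs ! j))"
      using False b0 xj by (simp add: sum_diff1)
    ultimately show ?thesis by simp
  qed
  define A2 where "A2 j v = (if w v = w (xs ! j) then A1 j v else 0)" for j v
  have key: "ldet k A2 ys = (if sum w (set ys) = sum w B0 then ldet k A1 ys else 0)"
    if ys: "distinct ys" "length ys = k" "set ys \<subseteq> E" for ys
  proof -
    have tot: "(\<Sum>i<k. w (ys ! p i)) = sum w (set ys)" if p: "p permutes {0..<k}" for p
    proof -
      have "bij_betw p {..<k} {..<k}" using permutes_imp_bij[OF p] by (simp add: atLeast0LessThan)
      then have "(\<Sum>i<k. w (ys ! p i)) = (\<Sum>i<k. w (ys ! i))"
        by (rule sum.reindex_bij_betw)
      then show ?thesis using sum_nth[OF ys(1,2)] by simp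
    qed
    have tot0: "(\<Sum>i<k. w (xs ! i)) = sum w B0" using sum_nth[OF xs(2,1)] xs(3) by simp
    have mem: "ys ! p i \<in> E" if "p permutes {0..<k}" "i < k" for p i
    proof -
      have "p i < length ys" using that ys permutes_in_image[OF that(1), of i] by simp
      then show ?thesis using ys(3) nth_mem by blast
    qed
    show ?thesis
    proof (cases "sum w (set ys) = sum w B0")
      case True
      have "(\<Prod>i<k. A2 i (ys ! p i)) = (\<Prod>i<k. A1 i (ys ! p i))" if p: "p permutes {0..<k}" for p
      proof (cases "\<forall>i<k. A1 i (ys ! p i) \<noteq> 0")
        case nz: True
        \<comment> \<open>Each difference is nonnegative by \<open>le\<close>, and equal total
          weights make the sum zero; so every factor of a nonzero term survives in
          \<open>A2\<close>.\<close>
        have "(\<Sum>i<k. w (xs ! i) - w (ys ! p i)) = 0" using tot[OF p] tot0 True by (simp add: sum_subtractf)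
        moreover have "\<And>i. i \<in> {..<k} \<Longrightarrow> 0 \<le> w (xs ! i) - w (ys ! p i)"
          using le mem[OF p] nz by simp
        ultimately have "\<forall>i\<in>{..<k}. w (xs ! i) - w (ys ! p i) = 0"
          by (subst (asm) sum_nonneg_eq_0_iff) auto
        then show ?thesis by (intro prod.cong) (auto simp: A2_def)
      next
        case False
        then obtain i where i: "i < k" "A1 i (ys ! p i) = 0" by blast
        then have "(\<Prod>i<k. A1 i (ys ! p i)) = 0" by (intro prod_zero) auto
        moreover have "(\<Prod>i<k. A2 i (ys ! p i)) = 0"
          using i by (intro prod_zero) (auto simp: A2_def intro!: bexI[of _ i])
        ultimately show ?thesis by (simp only:)
      qed
      then show ?thesis using True unfolding ldet_def det_nat_def by (auto intro!: sum.cong)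
    next
      case False
      have "(\<Prod>i<k. A2 i (ys ! p i)) = 0" if p: "p permutes {0..<k}" for p
      proof (rule ccontr)
        assume "\<not> ?thesis"
        then have "\<And>i. i < k \<Longrightarrow> A2 i (ys ! p i) \<noteq> 0" by (auto simp: prod_zero_iff)
        then have "\<And>i. i < k \<Longrightarrow> w (ys ! p i) = w (xs ! i)" unfolding A2_def by metis
        then have "(\<Sum>i<k. w (ys ! p i)) = (\<Sum>i<k. w (xs ! i))" by simp
        then show False using tot[OF p] tot0 False by simp
      qed
      then show ?thesis using False unfolding ldet_def det_nat_def by (auto intro!: sum.neutral)
    qed
  qed
  have min2: "minor k A I = ldet k A xs * minor k A1 I"
    "minor k A2 I = (if sum w I = sum w B0 then minor k A1 I else 0)"
    if "I \<subseteq> E" "finite I" "card I = k" for I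
    using A1(2)[of "sorted_list_of_set I"] key[of "sorted_list_of_set I"] that by (auto simp: minor_def)
  have "tnn k E A2"
    unfolding tnn_def using A pos min2 by (auto simp: tnn_def zero_le_mult_iff not_less)
  moreover have "supp k E A2 = {B \<in> supp k E A. sum w B = sum w B0}"
    using min2 pos by (auto simp: supp_def split: if_splits)
  ultimately show thesis using that by blast
qed


text \<open>Adding \<open>s\<close> times column \<open>a\<close> to column \<open>b\<close> adds to
  the minor at \<open>I\<close> that multiple of the determinant with \<open>a\<close> in the place
  of \<open>b\<close>. Sorting \<open>a\<close> into position passes the elements of
  \<open>I\<close> between \<open>a\<close> and \<open>b\<close>; if the result is nonzero these are
  exactly the coloops in between, so the fixed sign \<open>s\<close> compensates. Both contributions
  are nonnegative, hence the support is a union.\<close>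

lemma bridge_tnn:
  fixes a b :: "'a::linorder"
  assumes A: "tnn k E A" and ab: "a < b" "a \<in> E" "b \<in> E"
    and between: "\<And>m. m \<in> E \<Longrightarrow> a < m \<Longrightarrow> m < b \<Longrightarrow>
      (\<forall>B\<in>supp k E A. m \<notin> B) \<or> (\<forall>B\<in>supp k E A. m \<in> B)"
  obtains A' where "tnn k E A'"
    "supp k E A' = supp k E A \<union> {I. I \<subseteq> E \<and> finite I \<and> b \<in> I \<and> a \<notin> I \<and> insert a (I - {b}) \<in> supp k E A}"
proof -
  define Cl where "Cl = {m \<in> E. a < m \<and> m < b \<and> (\<forall>B\<in>supp k E A. m \<in> B)}"
  define s :: real where "s = (-1) ^ card Cl"
  define A' where "A' i j = A i j + (if j = b then s * A i a else 0)" for i j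
  have add: "ldet k A' (us @ b # vs) = ldet k A (us @ b # vs) + s * ldet k A (us @ a # vs)"
    if l: "Suc (length us + length vs) = k" and nb: "b \<notin> set us \<union> set vs" for us vs
  proof -
    let ?C = "column_cofactor k A us vs"
    have "ldet k A' (us @ b # vs) = (\<Sum>i<k. A' i b * ?C i)"
      using nb by (intro ldet_column[OF l]) (auto simp: A'_def)
    also have "\<dots> = (\<Sum>i<k. A i b * ?C i) + s * (\<Sum>i<k. A i a * ?C i)"
      by (simp add: A'_def sum.distrib distrib_right sum_distrib_left mult.assoc)
    finally show ?thesis using ldet_column[OF l, of A A] by simp
  qed
  have minor': "minor k A' I = minor k A I + (if b \<in> I \<and> a \<notin> I then minor k A (insert a (I - {b})) else 0)"
    if I: "I \<subseteq> E" "finite I" "card I = k" for I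
  proof (cases "b \<in> I")
    case False
    then have "minor k A' I = minor k A I"
      unfolding minor_def using I by (intro ldet_cong) (auto simp: A'_def)
    then show ?thesis using False by simp
  next
    case True
    define xs where "xs = sorted_list_of_set I"
    have xs: "length xs = k" "distinct xs" "sorted xs" "set xs = I" using I by (auto simp: xs_def)
    obtain us vs where uv: "xs = us @ b # vs" using True xs by (metis split_list)
    have us: "x < b" if "x \<in> set us" for x using that xs uv by (auto simp: sorted_append less_le)
    have vs: "b < x" if "x \<in> set vs" for x using that xs uv by (auto simp: sorted_append less_le)
    have m: "minor k A' I = minor k A I + s * ldet k A (us @ a # vs)"
      using add[of us vs] xs uv unfolding minor_def xs_def[symmetric] by auto
    show ?thesis
    proof (cases "a \<in> I")
      case True
      then have "ldet k A (us @ a # vs) = 0"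
        using ab xs uv by (intro ldet_not_distinct) auto
      then show ?thesis using m True by simp
    next
      case False
      let ?J = "insert a (I - {b})"
      have set_us: "set us = {u \<in> I. u < b}" using us vs uv xs by (auto dest: less_asym)
      have dist: "distinct (insort a us @ vs)" using False xs uv by (auto simp: distinct_insort set_insort_key)
      have "sorted (insort a us @ vs)"
        using xs uv ab us vs by (auto simp: sorted_append sorted_insort set_insort_key intro: less_imp_le less_trans dest: order.strict_trans1)
      moreover have "set (insort a us @ vs) = ?J" using xs uv by (auto simp: set_insort_key)
      ultimately have J: "insort a us @ vs = sorted_list_of_set ?J"
        using dist by (metis sorted_list_of_set.idem_if_sorted_distinct)
      have e: "ldet k A (us @ a # vs) = (-1) ^ length (filter (\<lambda>u. a < u) us) * minor k A ?J"
        using ldet_insort[of us a vs k A] False xs uv J by (auto simp: sorted_append minor_def)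
      have "s * ldet k A (us @ a # vs) = minor k A ?J"
      proof (cases "minor k A ?J = 0")
        case True
        then show ?thesis using e by simp
      next
        case nz: False
        have "card ?J = k" using False I \<open>b \<in> I\<close> card_Suc_Diff1[of I b] by auto
        then have JM: "?J \<in> supp k E A" using nz I ab by (auto simp: supp_def)
        have "length (filter (\<lambda>u. a < u) us) = card {u \<in> I. a < u \<and> u < b}"
          using xs uv set_us by (subst distinct_card[symmetric]) (auto intro!: arg_cong[of _ _ card])
        also have "{u \<in> I. a < u \<and> u < b} = Cl"
        proof
          show "{u \<in> I. a < u \<and> u < b} \<subseteq> Cl" using between JM I by (force simp: Cl_def)
          show "Cl \<subseteq> {u \<in> I. a < u \<and> u < b}" using JM by (auto simp: Cl_def)
        qed
        finally show ?thesis using e by (simp add: s_def power_add[symmetric] mult_2[symmetric])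
      qed
      then show ?thesis using m \<open>b \<in> I\<close> False by simp
    qed
  qed
  have cardJ: "card (insert a (I - {b})) = card I" if "finite I" "b \<in> I" "a \<notin> I" for I
    using that card_Suc_Diff1[of I b] by auto
  have ge: "0 \<le> minor k A I" if "I \<subseteq> E" "finite I" "card I = k" for I using A that by (auto simp: tnn_def)
  have ge': "0 \<le> minor k A (insert a (I - {b}))"
    if "I \<subseteq> E" "finite I" "card I = k" "b \<in> I" "a \<notin> I" for I
    using that ab cardJ[of I] by (intro ge) auto
  have "tnn k E A'"
    unfolding tnn_def using ge ge' minor' by auto
  moreover have "supp k E A' = supp k E A \<union>
      {I. I \<subseteq> E \<and> finite I \<and> b \<in> I \<and> a \<notin> I \<and> insert a (I - {b}) \<in> supp k E A}" (is "_ = _ \<union> ?R")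
  proof (intro equalityI subsetI)
    fix I assume I: "I \<in> supp k E A'"
    then have I': "I \<subseteq> E" "finite I" "card I = k" "minor k A' I \<noteq> 0" by (auto simp: supp_def)
    show "I \<in> supp k E A \<union> ?R"
    proof (cases "minor k A I = 0")
      case True
      then have "b \<in> I" "a \<notin> I" "minor k A (insert a (I - {b})) \<noteq> 0"
        using minor'[OF I'(1-3)] I'(4) by (auto split: if_splits)
      then show ?thesis using I' ab cardJ[of I] by (auto simp: supp_def)
    qed (use I' in \<open>auto simp: supp_def\<close>)
  next
    fix I assume I: "I \<in> supp k E A \<union> ?R"
    have I': "I \<subseteq> E" "finite I" "card I = k" using I cardJ[of I] by (auto simp: supp_def)
    have "minor k A I + (if b \<in> I \<and> a \<notin> I then minor k A (insert a (I - {b})) else 0) > 0"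
    proof (cases "b \<in> I \<and> a \<notin> I")
      case True
      have "minor k A I \<noteq> 0 \<or> minor k A (insert a (I - {b})) \<noteq> 0" using I by (auto simp: supp_def)
      then show ?thesis using ge[OF I'] ge'[OF I'] True by (auto simp: less_le add_nonneg_eq_0_iff)
    next
      case False
      then have "minor k A I \<noteq> 0" using I by (auto simp: supp_def)
      then show ?thesis using ge[OF I'] False by (auto simp: less_le)
    qed
    then show "I \<in> supp k E A'" using minor'[OF I'] I' by (auto simp: supp_def)
  qed
  ultimately show thesis using that by blast
qed

section \<open>Cyclic intervals and bounded affine permutations\<close>

lemma win_shift: "win n (x + n) (y + n) = win n x y"
proof -
  have "{x + n..<y + n} = (\<lambda>m. m + n) ` {x..<y}" by simp
  then show ?thesis unfolding win_def by (simp only: image_image mod_add_self2)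
qed

lemma win_insert_first: "x < y \<Longrightarrow> win n x y = insert (x mod n) (win n (Suc x) y)"
proof -
  assume "x < y"
  then have "{x..<y} = insert x {Suc x..<y}" by auto
  then show ?thesis unfolding win_def by simp
qed

lemma win_insert_last: "x \<le> y \<Longrightarrow> win n x (Suc y) = insert (y mod n) (win n x y)"
  unfolding win_def by (simp add: atLeastLessThanSuc)

lemma win_mono: "x \<le> x' \<Longrightarrow> y' \<le> y \<Longrightarrow> win n x' y' \<subseteq> win n x y"
  unfolding win_def by (intro image_mono) auto

lemma inj_on_mod_window:
  assumes "y \<le> x + n"
  shows "inj_on (\<lambda>m. m mod n) {x..<y :: nat}"
proof (rule linorder_inj_onI)
  fix p q assume pq: "p < q" "p \<in> {x..<y}" "q \<in> {x..<y}"
  show "p mod n \<noteq> q mod n"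
  proof
    assume "p mod n = q mod n"
    then have "n dvd q - p" using pq by (metis mod_eq_dvd_iff_nat less_imp_le)
    then have "n \<le> q - p" using pq by (intro dvd_imp_le) auto
    then show False using pq assms by auto
  qed
qed auto

lemma win_full:
  assumes "0 < n" "x + n \<le> y"
  shows "win n x y = {0..<n}"
proof
  show "win n x y \<subseteq> {0..<n}" using assms by (auto simp: win_def)
  have "card (win n x (x + n)) = n"
    unfolding win_def using card_image[OF inj_on_mod_window[of "x + n" x n]] by simp
  moreover have "win n x (x + n) \<subseteq> {0..<n}" using assms by (auto simp: win_def)
  ultimately have "win n x (x + n) = {0..<n}" by (intro card_subset_eq) auto
  then show "{0..<n} \<subseteq> win n x y" using win_mono[of x x "x + n" y n] assms by simp
qed

text \<open>Bounded affine permutations, restricted to the nonnegative integers, and the rank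
  \<open>cnt F x y\<close> of the cyclic interval \<open>[x, y)\<close> they encode.\<close>

definition bounded_affine :: "nat \<Rightarrow> (nat \<Rightarrow> nat) \<Rightarrow> bool" where
  "bounded_affine n F \<longleftrightarrow> (\<forall>m. m \<le> F m \<and> F m \<le> m + n \<and> F (m + n) = F m + n) \<and> inj F"

definition cnt :: "(nat \<Rightarrow> nat) \<Rightarrow> nat \<Rightarrow> nat \<Rightarrow> nat" where
  "cnt F x y = card {m \<in> {x..<y}. y \<le> F m}"

lemma cnt_Suc: assumes "x < y" shows "cnt F x y = cnt F (Suc x) y + (if y \<le> F x then 1 else 0)"
proof -
  have "{m \<in> {x..<y}. y \<le> F m} = {m \<in> {Suc x..<y}. y \<le> F m} \<union> (if y \<le> F x then {x} else {})"
    using assms by (auto simp: Suc_le_eq le_less)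
  then show ?thesis unfolding cnt_def by (auto simp: card_insert_if)
qed

lemma cnt_empty [simp]: "cnt F x x = 0"
  by (simp add: cnt_def)

lemma cnt_shift:
  assumes "bounded_affine n F"
  shows "cnt F (x + n) (y + n) = cnt F x y"
proof -
  have "{m \<in> {x + n..<y + n}. y + n \<le> F m} = (\<lambda>m. m + n) ` {m \<in> {x..<y}. y \<le> F m}"
  proof (intro equalityI subsetI)
    fix m assume "m \<in> {m \<in> {x + n..<y + n}. y + n \<le> F m}"
    then show "m \<in> (\<lambda>m. m + n) ` {m \<in> {x..<y}. y \<le> F m}"
      using assms unfolding bounded_affine_def
      by (intro image_eqI[of _ _ "m - n"]) (auto, metis add_le_cancel_right add_leD2 le_add_diff_inverse2)
  qed (use assms in \<open>auto simp: bounded_affine_def\<close>)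
  then show ?thesis unfolding cnt_def by (simp add: card_image)
qed

section \<open>Ranks after adding a multiple of one column to another\<close>

lemma (in matroid) rk_loops_coloops:
  assumes D: "\<And>m. m \<in> D \<Longrightarrow> (\<forall>B\<in>M. m \<notin> B) \<or> (\<forall>B\<in>M. m \<in> B)" "finite D" "D \<inter> X = {}"
  shows "rk M (X \<union> D) = rk M X + card {m \<in> D. \<forall>B\<in>M. m \<in> B}"
proof -
  have eq: "card (B \<inter> (X \<union> D)) = card (B \<inter> X) + card {m \<in> D. \<forall>B\<in>M. m \<in> B}" if B: "B \<in> M" for B
  proof -
    have "B \<inter> (X \<union> D) = (B \<inter> X) \<union> {m \<in> D. \<forall>B\<in>M. m \<in> B}" using D(1) B by blast
    moreover have "card \<dots> = card (B \<inter> X) + card {m \<in> D. \<forall>B\<in>M. m \<in> B}"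
      using D finite_basis[OF B] by (intro card_Un_disjoint) auto
    ultimately show ?thesis by simp
  qed
  obtain B where B: "B \<in> M" "card (B \<inter> X) = rk M X" using rk_attained by blast
  obtain B' where B': "B' \<in> M" "card (B' \<inter> (X \<union> D)) = rk M (X \<union> D)" using rk_attained by blast
  show ?thesis
    using eq[OF B(1)] eq[OF B'(1)] B(2) B'(2) card_Int_le_rk[OF B(1), of "X \<union> D"] card_Int_le_rk[OF B'(1), of X]
    by linarith
qed

lemma card_replace_le:
  assumes "finite J" "a \<in> J" "b \<notin> J"
  shows "card (insert b (J - {a}) \<inter> Z) \<le> Suc (card ((J - {a}) \<inter> Z))"
    "b \<notin> Z \<Longrightarrow> card (insert b (J - {a}) \<inter> Z) \<le> card (J \<inter> Z)"
    "a \<in> Z \<Longrightarrow> card (insert b (J - {a}) \<inter> Z) \<le> card (J \<inter> Z)"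
proof -
  have "insert b (J - {a}) \<inter> Z \<subseteq> insert b ((J - {a}) \<inter> Z)" by auto
  then have "card (insert b (J - {a}) \<inter> Z) \<le> card (insert b ((J - {a}) \<inter> Z))"
    using assms by (intro card_mono) auto
  also have "\<dots> \<le> Suc (card ((J - {a}) \<inter> Z))" by (rule card_insert_le_m1) auto
  finally show 1: "card (insert b (J - {a}) \<inter> Z) \<le> Suc (card ((J - {a}) \<inter> Z))" .
  show "card (insert b (J - {a}) \<inter> Z) \<le> card (J \<inter> Z)" if "b \<notin> Z"
    using that assms by (intro card_mono) auto
  show "card (insert b (J - {a}) \<inter> Z) \<le> card (J \<inter> Z)" if "a \<in> Z"
  proof -
    have "(J - {a}) \<inter> Z = (J \<inter> Z) - {a}" by auto
    then show ?thesis using 1 that assms card_Suc_Diff1[of "J \<inter> Z" a] by simp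
  qed
qed

text \<open>\<open>M'\<close> models the support after adding a multiple of column \<open>a\<close>
  to column \<open>b\<close>, as in \<open>bridge_tnn\<close>. Old bases stay and new ones arise by
  replacing \<open>a\<close> with \<open>b\<close>, so ranks never fall.\<close>

locale bridge = M: matroid k M + M': matroid k M' for k :: nat and M M' :: "'a set set" +
  fixes a b :: 'a and E :: "'a set"
  assumes neq: "a \<noteq> b" and ground: "\<And>B. B \<in> M \<Longrightarrow> B \<subseteq> E" and bE: "b \<in> E"
    and M': "M' = M \<union> {I. I \<subseteq> E \<and> finite I \<and> b \<in> I \<and> a \<notin> I \<and> insert a (I - {b}) \<in> M}"
begin

lemma sub: "M \<subseteq> M'" by (auto simp: M')

lemma rk_ge: "rk M Z \<le> rk M' Z"
  using M'.card_Int_le_rk sub M.rk_attained[of Z] by (metis subsetD)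

lemma new_basis:
  assumes "I \<in> M'" "I \<notin> M"
  obtains J where "J \<in> M" "a \<in> J" "b \<notin> J" "I = insert b (J - {a})"
  using assms neq by (intro that[of "insert a (I - {b})"]) (auto simp: M')

lemma rk_same: assumes "b \<notin> Z \<or> a \<in> Z" shows "rk M' Z = rk M Z"
proof (rule antisym[OF M'.rk_le rk_ge])
  fix I assume I: "I \<in> M'"
  show "card (I \<inter> Z) \<le> rk M Z"
  proof (cases "I \<in> M")
    case True
    then show ?thesis by (rule M.card_Int_le_rk)
  next
    case False
    then obtain J where J: "J \<in> M" "a \<in> J" "b \<notin> J" "I = insert b (J - {a})" using new_basis[OF I] by blast
    then have "card (I \<inter> Z) \<le> card (J \<inter> Z)" using card_replace_le(2,3)[of J a b Z] M.finite_basis assms by auto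
    then show ?thesis using M.card_Int_le_rk[OF J(1), of Z] by simp
  qed
qed

text \<open>The altered column \<open>b\<close> contributes more to \<open>Z\<close> only if it was
  redundant in \<open>Z\<close> before and the added column \<open>a\<close> is not spanned by
  \<open>Z\<close>.\<close>

lemma rk_change:
  assumes Z: "b \<in> Z" "a \<notin> Z"
  shows "rk M' Z = rk M Z + (if rk M Z = rk M (Z - {b}) \<and> rk M (insert a Z) = Suc (rk M Z) then 1 else 0)"
proof (cases "rk M Z = rk M (Z - {b}) \<and> rk M (insert a Z) = Suc (rk M Z)")
  case True
  have "rk M' Z \<le> Suc (rk M Z)"
  proof (rule M'.rk_le)
    fix I assume I: "I \<in> M'"
    show "card (I \<inter> Z) \<le> Suc (rk M Z)"
    proof (cases "I \<in> M")
      case True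
      then show ?thesis using M.card_Int_le_rk[of I Z] by simp
    next
      case False
      then obtain J where J: "J \<in> M" "a \<in> J" "b \<notin> J" "I = insert b (J - {a})" using new_basis[OF I] by blast
      have "card ((J - {a}) \<inter> Z) \<le> card (J \<inter> Z)" using M.finite_basis[OF J(1)] by (intro card_mono) auto
      then show ?thesis
        using J card_replace_le(1)[of J a b Z] M.finite_basis[OF J(1)] M.card_Int_le_rk[OF J(1), of Z] by simp
    qed
  qed
  moreover have "Suc (rk M Z) \<le> rk M' Z"
  proof -
    \<comment> \<open>For a basis optimal on the whole chain, equality of the first two ranks forces
      \<open>b \<notin> J\<close> and the rise to the third forces \<open>a \<in> J\<close>.
      Replacing \<open>a\<close> by \<open>b\<close> then gains one element in
      \<open>Z\<close>.\<close>
    obtain J where J: "J \<in> M" "card (J \<inter> (Z - {b})) = rk M (Z - {b})" "card (J \<inter> Z) = rk M Z"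
      "card (J \<inter> insert a Z) = rk M (insert a Z)"
      using M.optimal_chain3[of "Z - {b}" Z "insert a Z"] by auto
    have fin: "finite J" using M.finite_basis J(1) .
    have aJ: "a \<in> J"
    proof (rule ccontr)
      assume "a \<notin> J"
      then have "J \<inter> insert a Z = J \<inter> Z" by auto
      then show False using J True by simp
    qed
    have bJ: "b \<notin> J"
    proof
      assume "b \<in> J"
      then have "J \<inter> Z = insert b (J \<inter> (Z - {b}))" using Z by auto
      moreover have "b \<notin> J \<inter> (Z - {b})" by simp
      ultimately have "card (J \<inter> Z) = Suc (card (J \<inter> (Z - {b})))" using fin by simp
      then show False using J True by simp
    qed
    let ?I = "insert b (J - {a})"
    have "insert a (?I - {b}) = J" using aJ bJ by auto
    then have I: "?I \<in> M'" using J(1) aJ bJ neq fin ground[OF J(1)] bE by (auto simp: M')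
    have "?I \<inter> Z = insert b (J \<inter> Z)" using Z by auto
    then have "card (?I \<inter> Z) = Suc (rk M Z)" using bJ fin J(3) by simp
    then show ?thesis using M'.card_Int_le_rk[OF I, of Z] by simp
  qed
  ultimately show ?thesis using True by simp
next
  case False
  have "rk M' Z \<le> rk M Z"
  proof (rule M'.rk_le)
    fix I assume I: "I \<in> M'"
    show "card (I \<inter> Z) \<le> rk M Z"
    proof (cases "I \<in> M")
      case True
      then show ?thesis by (rule M.card_Int_le_rk)
    next
      case nI: False
      then obtain J where J: "J \<in> M" "a \<in> J" "b \<notin> J" "I = insert b (J - {a})" using new_basis[OF I] by blast
      have fin: "finite J" using M.finite_basis J(1) .
      have "I \<inter> Z = insert b (J \<inter> Z)" using J Z by auto
      then have IZ: "card (I \<inter> Z) = Suc (card (J \<inter> Z))" using J fin by simp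
      have "J \<inter> (Z - {b}) = J \<inter> Z" using J by auto
      then have 1: "card (J \<inter> Z) \<le> rk M (Z - {b})" using M.card_Int_le_rk[OF J(1), of "Z - {b}"] by simp
      have "J \<inter> insert a Z = insert a (J \<inter> Z)" using J by auto
      then have 2: "Suc (card (J \<inter> Z)) \<le> rk M (insert a Z)"
        using M.card_Int_le_rk[OF J(1), of "insert a Z"] Z fin by simp
      have "rk M (Z - {b}) \<le> rk M Z" by (rule M.rk_mono) auto
      then show ?thesis using False 1 2 IZ M.rk_insert_le[of a Z] M.rk_mono[of Z "insert a Z"] by auto
    qed
  qed
  then show ?thesis using rk_ge[of Z] False by simp
qed

end

section \<open>Realizing bounded affine permutations\<close>

definition realizes :: "nat \<Rightarrow> (nat \<Rightarrow> nat) \<Rightarrow> (nat \<Rightarrow> nat \<Rightarrow> real) \<Rightarrow> bool" where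
  "realizes n F A \<longleftrightarrow> tnn (cnt F 0 n) {0..<n} A \<and> supp (cnt F 0 n) {0..<n} A \<noteq> {} \<and>
     (\<forall>x y. x \<le> y \<longrightarrow> y \<le> x + n \<longrightarrow> rk (supp (cnt F 0 n) {0..<n} A) (win n x y) = cnt F x y)"

lemma bounded_affineD:
  assumes "bounded_affine n F"
  shows "m \<le> F m" "F m \<le> m + n" "F (m + n) = F m + n" "F m = F m' \<longleftrightarrow> m = m'"
  using assms unfolding bounded_affine_def by (auto dest: injD)

lemma bounded_affine_mult:
  assumes "bounded_affine n F"
  shows "F (m + l * n) = F m + l * n"
proof (induction l)
  case (Suc l)
  have "F (m + Suc l * n) = F ((m + l * n) + n)" by (simp add: algebra_simps)
  then show ?case using bounded_affineD(3)[OF assms, of "m + l * n"] Suc by simp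
qed simp

text \<open>The values \<open>m\<close> and \<open>m + n\<close> stand for loops and coloops, so the
  matroid has the single basis \<open>K\<close>. Unit columns at \<open>K\<close> and zero columns
  elsewhere realize it.\<close>

lemma realize_fixed:
  assumes F: "bounded_affine n F" and n: "0 < n" and fixed: "\<And>m. F m = m \<or> F m = m + n"
  shows "\<exists>A. realizes n F A"
proof -
  define K where "K = {m \<in> {0..<n}. F m = m + n}"
  define k where "k = cnt F 0 n"
  have "{m \<in> {0..<n}. n \<le> F m} = K"
    using fixed by (force simp: K_def)
  then have k: "card K = k" by (simp add: k_def cnt_def)
  have fin: "finite K" by (simp add: K_def)
  define xs where "xs = sorted_list_of_set K"
  have xs: "length xs = k" "distinct xs" "set xs = K" using k fin by (auto simp: xs_def)
  define A :: "nat \<Rightarrow> nat \<Rightarrow> real" where "A i j = (if j = xs ! i then 1 else 0)" for i j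
  have "colmat k A xs = 1\<^sub>m k"
    using xs by (intro eq_matI) (auto simp: colmat_def A_def nth_eq_iff_index_eq)
  then have mK: "minor k A K = 1" by (simp add: minor_def ldet_eq_det xs_def)
  have m0: "minor k A I = 0" if I: "finite I" "card I = k" "I \<noteq> K" for I
  proof -
    have "\<not> K \<subseteq> I" using I k by (metis card_subset_eq)
    then obtain q where q: "q < k" "xs ! q \<notin> I" using xs by (metis in_set_conv_nth subsetI)
    then show ?thesis
      unfolding minor_def using I by (intro ldet_zero_row[OF q(1)]) (auto simp: A_def)
  qed
  have supp: "supp k {0..<n} A = {K}"
  proof (intro equalityI subsetI)
    fix I assume "I \<in> supp k {0..<n} A"
    then show "I \<in> {K}" using m0[of I] by (cases "I = K") (auto simp: supp_def)
  next
    fix I assume "I \<in> {K}"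
    moreover have "K \<subseteq> {0..<n}" by (auto simp: K_def)
    ultimately show "I \<in> supp k {0..<n} A" using mK k fin by (simp add: supp_def)
  qed
  have tnn: "tnn k {0..<n} A"
    unfolding tnn_def using m0 mK by (metis order_refl zero_le_one)
  have "rk {K} (win n x y) = cnt F x y" if xy: "x \<le> y" "y \<le> x + n" for x y
  proof -
    let ?T = "{m \<in> {x..<y}. y \<le> F m}"
    have *: "F m = m + n \<longleftrightarrow> F (m mod n) = m mod n + n" for m
    proof -
      have "F m = F (m mod n) + m div n * n"
        using bounded_affine_mult[OF F, of "m mod n" "m div n"] by simp
      moreover have "m mod n + m div n * n = m" by simp
      ultimately show ?thesis by linarith
    qed
    have T: "?T = {m \<in> {x..<y}. F m = m + n}"
    proof (intro equalityI subsetI)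
      fix m assume m: "m \<in> ?T"
      then have "F m \<noteq> m" by auto
      then show "m \<in> {m \<in> {x..<y}. F m = m + n}" using m fixed[of m] by auto
    qed (use xy in auto)
    have "K \<inter> win n x y = (\<lambda>m. m mod n) ` ?T"
      unfolding T using n * by (auto simp: K_def win_def)
    then have "card (K \<inter> win n x y) = card ?T"
      using inj_on_subset[OF inj_on_mod_window[OF xy(2)], of ?T] by (simp add: card_image subset_eq)
    then show ?thesis by (simp add: rk_def cnt_def)
  qed
  then show ?thesis unfolding realizes_def using supp tnn by (auto simp: k_def)
qed

text \<open>Among the pairs \<open>a < b\<close> of non-fixed positions with \<open>F a < F b\<close>, one at minimal distance has only
  fixed positions in between. Such a pair exists: take the least non-fixed position \<open>a\<close> and \<open>b = F a\<close>.\<close>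

lemma exists_bridge:
  assumes F: "bounded_affine n F" and n: "0 < n" and nf: "F m0 \<noteq> m0" "F m0 \<noteq> m0 + n"
  obtains a b where "a < b" "b < n" "b \<le> F a" "F a < F b" "F b \<le> a + n"
    "\<forall>m. a < m \<longrightarrow> m < b \<longrightarrow> F m = m \<or> F m = m + n"
proof -
  define N where "N = {m. F m \<noteq> m \<and> F m \<noteq> m + n}"
  note F' = bounded_affineD[OF F]
  have Fmod: "F m = F (m mod n) + n * (m div n)" for m
    using bounded_affine_mult[OF F, of "m mod n" "m div n"] by (simp add: mult.commute)
  have N_mod: "m \<in> N \<longleftrightarrow> m mod n \<in> N" for m
  proof -
    have "m = m mod n + n * (m div n)" by simp
    then show ?thesis unfolding N_def mem_Collect_eq using Fmod[of m] by linarith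
  qed
  have N_F: "F m \<in> N" if "m \<in> N" for m
    using that F'(3,4) unfolding N_def mem_Collect_eq by metis
  have N_shift: "m + n \<in> N \<longleftrightarrow> m \<in> N" for m using N_mod[of m] N_mod[of "m + n"] by simp
  define Q where "Q a b \<longleftrightarrow> a \<in> N \<and> b \<in> N \<and> a < b \<and> b < n \<and> F a < F b" for a b
  have "\<exists>a b. Q a b"
  proof -
    have "m0 mod n \<in> N" using nf N_mod by (auto simp: N_def)
    then have ex: "\<exists>m. m \<in> N" by blast
    define a where "a = (LEAST m. m \<in> N)"
    have a: "a \<in> N" unfolding a_def using ex by (rule LeastI_ex)
    have min: "a \<le> m" if "m \<in> N" for m unfolding a_def using that by (rule Least_le)
    have "a \<le> a mod n" using min N_mod a by blast
    then have an: "a < n" using n by (metis le_less_trans mod_less_divisor)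
    have e: "a < F a" "F a < a + n" using a F'(1,2)[of a] by (auto simp: N_def le_less)
    \<comment> \<open>Otherwise \<open>F a - n\<close> would be a non-fixed position below the least
      one, since \<open>F a < a + n\<close>.\<close>
    have "F a < n"
    proof (rule ccontr)
      assume h: "\<not> F a < n"
      then have "F a - n \<in> N" using N_shift[of "F a - n"] N_F[OF a] by simp
      then show False using min[of "F a - n"] e h by linarith
    qed
    moreover have "F a < F (F a)" using N_F[OF a] F'(1)[of "F a"] by (auto simp: N_def le_less)
    ultimately show ?thesis using a N_F[OF a] e by (auto simp: Q_def)
  qed
  then have "\<exists>p. Q (fst p) (snd p)" by auto
  then obtain p where p: "Q (fst p) (snd p)" "\<forall>q. Q (fst q) (snd q) \<longrightarrow> snd p - fst p \<le> snd q - fst q"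
    using ex_has_least_nat[of "\<lambda>p. Q (fst p) (snd p)" _ "\<lambda>p. snd p - fst p"] by blast
  obtain a b where ab_def: "p = (a, b)" by (cases p)
  have ab: "Q a b" using p(1) ab_def by simp
  have min: "b - a \<le> b' - a'" if "Q a' b'" for a' b' using p(2)[rule_format, of "(a', b')"] that ab_def by simp
  have Qab: "a \<in> N" "b \<in> N" "a < b" "b < n" "F a < F b" using ab by (auto simp: Q_def)
  have between: "m \<notin> N" if m: "a < m" "m < b" for m
  proof
    assume mN: "m \<in> N"
    show False
    proof (cases "F a < F m")
      case True
      then have "Q a m" using Qab m mN by (auto simp: Q_def)
      then show False using min[of a m] m by simp
    next
      case False
      then have "Q m b" using Qab m mN by (auto simp: Q_def)
      then show False using min[of m b] m by simp
    qed
  qed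
  \<comment> \<open>Non-fixed positions are closed under \<open>F\<close> and under shifts by
    \<open>n\<close>. Failure of this bound would put \<open>F a\<close>, and failure of the next
    one \<open>F b - n\<close>, strictly between \<open>a\<close> and \<open>b\<close>, where only
    fixed positions occur.\<close>
  have "b \<le> F a"
  proof (rule ccontr)
    assume h: "\<not> b \<le> F a"
    have "a < F a" using Qab(1) F'(1)[of a] by (auto simp: N_def le_less)
    then show False using between[of "F a"] N_F[OF Qab(1)] h by simp
  qed
  moreover have "F b \<le> a + n"
  proof (rule ccontr)
    assume h: "\<not> F b \<le> a + n"
    have "F b < b + n" using Qab(2) F'(2)[of b] by (auto simp: N_def le_less)
    moreover have "F b - n \<in> N" using N_shift[of "F b - n"] N_F[OF Qab(2)] h by simp
    ultimately show False using between[of "F b - n"] h by simp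
  qed
  ultimately show thesis using that[of a b] Qab between by (auto simp: N_def)
qed

text \<open>The affine transposition exchanging \<open>a + l * n\<close> with
  \<open>b + l * n\<close> for all \<open>l\<close> at once. The subtraction does not truncate,
  since \<open>m mod n = b\<close> gives \<open>m \<ge> b\<close>.\<close>

definition swap_res :: "nat \<Rightarrow> nat \<Rightarrow> nat \<Rightarrow> nat \<Rightarrow> nat" where
  "swap_res n a b m = (if m mod n = a then m + (b - a) else if m mod n = b then m - (b - a) else m)"

lemma mod_of_less_double:
  fixes m n :: nat
  assumes "m < 2 * n"
  shows "m = m mod n \<or> m = m mod n + n"
  using assms by (cases "m < n") (simp_all add: le_mod_geq)

lemma cnt_pointwise:
  assumes "\<And>m. m \<in> {x..<y} \<Longrightarrow> y \<le> G m \<longleftrightarrow> y \<le> F m"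
  shows "cnt G x y = cnt F x y"
  unfolding cnt_def using assms by (intro arg_cong[of _ _ card]) auto

context
  fixes n a b :: nat
  assumes ab: "a < b" "b < n"
begin

lemma swap_res_simps:
  "swap_res n a b (a + l * n) = b + l * n" "swap_res n a b (b + l * n) = a + l * n"
  "m mod n \<noteq> a \<Longrightarrow> m mod n \<noteq> b \<Longrightarrow> swap_res n a b m = m"
  using ab by (auto simp: swap_res_def)

lemma residue_cases:
  obtains l where "m = a + l * n" | l where "m = b + l * n" | "m mod n \<noteq> a" "m mod n \<noteq> b"
proof -
  have "m = m mod n + (m div n) * n" by simp
  then show thesis using that by metis
qed

lemma swap_res_invol: "swap_res n a b (swap_res n a b m) = m"
  by (rule residue_cases[of m]) (auto simp: swap_res_simps)

lemma swap_res_add: "swap_res n a b (m + n) = swap_res n a b m + n"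
proof (rule residue_cases[of m])
  fix l assume "m = a + l * n"
  then show ?thesis using swap_res_simps(1)[of l] swap_res_simps(1)[of "Suc l"] by (simp add: algebra_simps)
next
  fix l assume "m = b + l * n"
  then show ?thesis using swap_res_simps(2)[of l] swap_res_simps(2)[of "Suc l"] by (simp add: algebra_simps)
next
  assume "m mod n \<noteq> a" "m mod n \<noteq> b"
  then show ?thesis using swap_res_simps(3)[of m] swap_res_simps(3)[of "m + n"] by simp
qed

lemma bounded_affine_swap:
  assumes F: "bounded_affine n F" and Fab: "b \<le> F a" "F a < F b" "F b \<le> a + n"
  shows "bounded_affine n (F \<circ> swap_res n a b)"
proof -
  note F' = bounded_affineD[OF F]
  have bd: "m \<le> F (swap_res n a b m) \<and> F (swap_res n a b m) \<le> m + n" for m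
  proof (rule residue_cases[of m])
    fix l assume "m = a + l * n"
    then show ?thesis using Fab ab bounded_affine_mult[OF F, of b l] by (simp add: swap_res_simps)
  next
    fix l assume "m = b + l * n"
    then show ?thesis using Fab ab bounded_affine_mult[OF F, of a l] by (simp add: swap_res_simps)
  next
    assume "m mod n \<noteq> a" "m mod n \<noteq> b"
    then show ?thesis using F' by (simp add: swap_res_simps)
  qed
  have "inj (swap_res n a b)" using swap_res_invol by (metis injI)
  then have "inj (F \<circ> swap_res n a b)" using F by (auto simp: bounded_affine_def intro: inj_compose)
  then show ?thesis using bd F' swap_res_add by (auto simp: bounded_affine_def)
qed

lemma cnt_swap_closed:
  assumes "\<And>m. m \<in> {x..<y} \<Longrightarrow> swap_res n a b m \<in> {x..<y}"
  shows "cnt (F \<circ> swap_res n a b) x y = cnt F x y"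
proof -
  have "bij_betw (swap_res n a b) {m \<in> {x..<y}. y \<le> (F \<circ> swap_res n a b) m} {m \<in> {x..<y}. y \<le> F m}"
    by (rule bij_betwI[where g = "swap_res n a b"]) (use assms swap_res_invol in auto)
  then show ?thesis unfolding cnt_def by (rule bij_betw_same_card)
qed

text \<open>A window containing both \<open>a\<close> and \<open>b\<close>, or both
  \<open>a + n\<close> and \<open>b + n\<close>, is mapped to itself. In any other one the two
  candidate values at a position lie on the same side of \<open>y\<close>:
  \<open>b \<le> F a\<close> settles the positions \<open>a\<close> and \<open>a + n\<close>, and
  \<open>F b \<le> a + n\<close> the position \<open>b\<close>. The excluded windows contain
  \<open>b\<close> but neither \<open>a\<close> nor \<open>a + n\<close>.\<close>

lemma cnt_swap:
  assumes F: "bounded_affine n F" and Fab: "b \<le> F a" "F a < F b" "F b \<le> a + n"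
    and xy: "x < n" "x \<le> y" "y \<le> x + n" and noncrit: "\<not> (a < x \<and> x \<le> b \<and> b < y \<and> y \<le> a + n)"
  shows "cnt (F \<circ> swap_res n a b) x y = cnt F x y"
proof -
  have mem: "m = a \<or> m = a + n \<or> m = b \<or> m = b + n \<or> (m mod n \<noteq> a \<and> m mod n \<noteq> b)" if "m \<in> {x..<y}" for m
  proof -
    have "m < 2 * n" using that xy by simp
    from mod_of_less_double[OF this] show ?thesis by auto
  qed
  have sw: "swap_res n a b a = b" "swap_res n a b b = a" "swap_res n a b (a + n) = b + n"
    "swap_res n a b (b + n) = a + n"
    using swap_res_simps(1)[of 0] swap_res_simps(2)[of 0] swap_res_simps(1)[of 1] swap_res_simps(2)[of 1] by auto
  have Fn: "F (a + n) = F a + n" "F (b + n) = F b + n" using bounded_affineD(3)[OF F] by auto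
  show ?thesis
  proof (cases "(x \<le> a \<and> b < y) \<or> (x \<le> a + n \<and> b + n < y)")
    case True
    show ?thesis
    proof (rule cnt_swap_closed)
      fix m assume m: "m \<in> {x..<y}"
      show "swap_res n a b m \<in> {x..<y}"
        using mem[OF m] m sw swap_res_simps(3)[of m] True xy ab by auto
    qed
  next
    case False
    show ?thesis
    proof (rule cnt_pointwise)
      fix m assume m: "m \<in> {x..<y}"
      show "y \<le> (F \<circ> swap_res n a b) m \<longleftrightarrow> y \<le> F m"
        using mem[OF m] m sw swap_res_simps(3)[of m] Fn Fab False noncrit xy ab by auto
    qed
  qed
qed

end


lemma sum_squares_swap:
  fixes w u v :: nat
  assumes "0 < w" "0 < v"
  shows "(w + u)\<^sup>2 + (u + v)\<^sup>2 < (w + u + v)\<^sup>2 + u\<^sup>2"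
proof -
  have "(w + u + v)\<^sup>2 + u\<^sup>2 = (w + u)\<^sup>2 + (u + v)\<^sup>2 + 2 * w * v"
    by (simp add: power2_eq_square algebra_simps)
  then show ?thesis using assms by simp
qed

text \<open>The swap replaces the displacements of \<open>a\<close> and \<open>b\<close> by
  \<open>F b - a\<close> and \<open>F a - b\<close>, which have the same sum but lie further apart.
  So the sum of squares grows, which yields termination.\<close>

lemma displacement_swap:
  fixes F :: "nat \<Rightarrow> nat"
  assumes ab: "a < b" "b < n" and Fab: "b \<le> F a" "F a < F b"
  shows "(\<Sum>m<n. (F m - m)\<^sup>2) < (\<Sum>m<n. ((F \<circ> swap_res n a b) m - m)\<^sup>2)"
proof -
  have split: "(\<Sum>m<n. g m) = (\<Sum>m\<in>{..<n} - {a, b}. g m) + (g a + g b)" for g :: "nat \<Rightarrow> nat"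
  proof -
    have "(\<Sum>m<n. g m) = (\<Sum>m\<in>{..<n} - {a, b}. g m) + (\<Sum>m\<in>{a, b}. g m)"
      using ab by (intro sum.subset_diff) auto
    then show ?thesis using ab by simp
  qed
  have sw: "swap_res n a b a = b" "swap_res n a b b = a"
    using swap_res_simps(1)[OF ab, of 0] swap_res_simps(2)[OF ab, of 0] by auto
  have "(\<Sum>m\<in>{..<n} - {a, b}. (F m - m)\<^sup>2) = (\<Sum>m\<in>{..<n} - {a, b}. ((F \<circ> swap_res n a b) m - m)\<^sup>2)"
    using swap_res_simps(3)[OF ab] by (intro sum.cong) auto
  moreover have "(F a - a)\<^sup>2 + (F b - b)\<^sup>2 < (F b - a)\<^sup>2 + (F a - b)\<^sup>2"
  proof -
    have "F a - a = (b - a) + (F a - b)" "F b - b = (F a - b) + (F b - F a)"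
      "F b - a = (b - a) + (F a - b) + (F b - F a)" using ab Fab by auto
    then show ?thesis using sum_squares_swap[of "b - a" "F b - F a" "F a - b"] ab Fab by simp
  qed
  ultimately show ?thesis unfolding split[of "\<lambda>m. (F m - m)\<^sup>2"] split[of "\<lambda>m. ((F \<circ> swap_res n a b) m - m)\<^sup>2"]
    using sw by simp
qed

text \<open>Both cases are visible in windows: \<open>[m, m + 1)\<close> has rank 0 for a loop, and
  \<open>[m + 1, m + n)\<close> has smaller rank than the ground set for a coloop.\<close>

lemma realizes_loop_coloop:
  assumes F: "bounded_affine n F" and n: "0 < n" and R: "realizes n F A" and m: "m < n"
  defines "M \<equiv> supp (cnt F 0 n) {0..<n} A"
  shows "F m = m \<Longrightarrow> \<forall>B\<in>M. m \<notin> B" "F m = m + n \<Longrightarrow> \<forall>B\<in>M. m \<in> B"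
proof -
  let ?k = "cnt F 0 n"
  interpret matroid ?k M unfolding M_def using R by (intro supp_matroid) (simp add: realizes_def)
  have rk: "rk M (win n x y) = cnt F x y" if "x \<le> y" "y \<le> x + n" for x y
    using R that by (auto simp: realizes_def M_def)
  have BE: "B \<subseteq> {0..<n}" if "B \<in> M" for B using that by (auto simp: M_def supp_def)
  show "\<forall>B\<in>M. m \<notin> B" if "F m = m"
  proof
    fix B assume B: "B \<in> M"
    have "rk M (win n m (Suc m)) = 0" using rk[of m "Suc m"] n that cnt_Suc[of m "Suc m" F] by simp
    moreover have "win n m (Suc m) = {m}" using m by (simp add: win_def)
    ultimately have "card (B \<inter> {m}) = 0" using card_Int_le_rk[OF B, of "{m}"] by simp
    then show "m \<notin> B" by (auto split: if_splits)
  qed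
  show "\<forall>B\<in>M. m \<in> B" if "F m = m + n"
  proof (rule ballI, rule ccontr)
    fix B assume B: "B \<in> M" and mB: "m \<notin> B"
    have full: "win n m (m + n) = {0..<n}" using win_full[OF n, of m "m + n"] by simp
    have "B \<subseteq> win n (Suc m) (m + n)"
      using BE[OF B] mB win_insert_first[of m "m + n" n] n m unfolding full by auto
    then have "?k \<le> rk M (win n (Suc m) (m + n))"
      using card_Int_le_rk[OF B, of "win n (Suc m) (m + n)"] card_basis[OF B] by (simp add: Int_absorb2)
    also have "\<dots> = cnt F (Suc m) (m + n)" using n by (intro rk) auto
    also have "\<dots> < cnt F m (m + n)" using cnt_Suc[of m "m + n" F] n that by simp
    also have "\<dots> = rk M (win n m (m + n))" by (simp add: rk)
    also have "\<dots> \<le> ?k" by (rule rk_le_rank)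
    finally show False by simp
  qed
qed

text \<open>A matrix for the swapped permutation becomes one for \<open>F\<close> when column
  \<open>a\<close>, up to sign, is added to column \<open>b\<close>. Only windows with
  \<open>b\<close> but not \<open>a\<close> are affected, and in them the rank and the count rise
  under the same condition \<open>F a < y \<le> F b\<close>.\<close>

lemma realize_swap:
  assumes F: "bounded_affine n F" and ab: "a < b" "b < n" and Fab: "b \<le> F a" "F a < F b" "F b \<le> a + n"
    and between: "\<And>m. a < m \<Longrightarrow> m < b \<Longrightarrow> F m = m \<or> F m = m + n"
    and R: "realizes n (F \<circ> swap_res n a b) A"
  shows "\<exists>A'. realizes n F A'"
proof -
  define G where "G = F \<circ> swap_res n a b"
  have n: "0 < n" using ab by simp
  have G: "bounded_affine n G" unfolding G_def by (rule bounded_affine_swap[OF ab F Fab])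
  define k where "k = cnt F 0 n"
  have k: "cnt G 0 n = k"
    unfolding G_def k_def using ab n by (intro cnt_swap[OF ab F Fab]) auto
  define M where "M = supp k {0..<n} A"
  have RG: "realizes n G A" using R by (simp add: G_def)
  have A: "tnn k {0..<n} A" "M \<noteq> {}" using RG k by (auto simp: realizes_def M_def)
  have rkM: "rk M (win n x y) = cnt G x y" if "x \<le> y" "y \<le> x + n" for x y
    using RG k that by (auto simp: realizes_def M_def)
  interpret M: matroid k M unfolding M_def using A(2) by (intro supp_matroid) (simp add: M_def)
  have Gab: "G a = F b" "G b = F a"
    using swap_res_simps(1)[OF ab, of 0] swap_res_simps(2)[OF ab, of 0] by (auto simp: G_def)
  have Gm: "G m = F m" if "a < m" "m < b" for m
    using that ab swap_res_simps(3)[OF ab, of m] by (simp add: G_def)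
  have fixed: "(\<forall>B\<in>M. m \<notin> B) \<or> (\<forall>B\<in>M. m \<in> B)" if m: "a < m" "m < b" for m
    using realizes_loop_coloop[OF G n RG, of m] k between[OF m] Gm[OF m] m ab by (auto simp: M_def)
  have E: "a \<in> {0..<n}" "b \<in> {0..<n}" using ab by auto
  have fixed': "(\<forall>B\<in>supp k {0..<n} A. m \<notin> B) \<or> (\<forall>B\<in>supp k {0..<n} A. m \<in> B)"
    if "m \<in> {0..<n}" "a < m" "m < b" for m using fixed[OF that(2,3)] by (simp add: M_def)
  obtain A' where A': "tnn k {0..<n} A'"
    "supp k {0..<n} A' = M \<union> {I. I \<subseteq> {0..<n} \<and> finite I \<and> b \<in> I \<and> a \<notin> I \<and> insert a (I - {b}) \<in> M}"
    unfolding M_def by (rule bridge_tnn[OF A(1) ab(1) E fixed'])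
  define M' where "M' = supp k {0..<n} A'"
  have ne: "M' \<noteq> {}" using A'(2) A(2) by (auto simp: M'_def)
  interpret M': matroid k M' unfolding M'_def using ne by (intro supp_matroid) (simp add: M'_def)
  interpret bridge k M M' a b "{0..<n}"
    using ab A'(2) by unfold_locales (auto simp: M_def M'_def supp_def)
  have rk0: "rk M' (win n x y) = cnt F x y" if xy: "x < n" "x \<le> y" "y \<le> x + n" for x y
  proof (cases "a < x \<and> x \<le> b \<and> b < y \<and> y \<le> a + n")
    case False
    have "b \<notin> win n x y \<or> a \<in> win n x y"
    proof (rule ccontr)
      assume h: "\<not> ?thesis"
      then obtain m where m: "x \<le> m" "m < y" "b = m mod n" by (auto simp: win_def)
      have "m = b \<or> m = b + n"
        using mod_of_less_double[of m n] m xy by simp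
      have a1: "\<not> (x \<le> a \<and> a < y)" "\<not> (x \<le> a + n \<and> a + n < y)"
      proof -
        have "a mod n = a" "(a + n) mod n = a" using ab by auto
        then show "\<not> (x \<le> a \<and> a < y)" "\<not> (x \<le> a + n \<and> a + n < y)"
          using h unfolding win_def by (metis atLeastLessThan_iff image_eqI)+
      qed
      show False using \<open>m = b \<or> m = b + n\<close>
      proof
        assume "m = b"
        then show False using m a1 False ab by auto
      next
        assume "m = b + n"
        then show False using m a1 ab xy by auto
      qed
    qed
    then have "rk M' (win n x y) = rk M (win n x y)" by (rule rk_same)
    also have "\<dots> = cnt F x y"
      using rkM[OF xy(2,3)] cnt_swap[OF ab F Fab xy False] by (simp add: G_def)
    finally show ?thesis .
  next
    case True
    then have crit: "a < x" "x \<le> b" "b < y" "y \<le> a + n" by auto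
    let ?Z = "win n x y" and ?Zb = "win n b y" and ?Zb' = "win n (Suc b) y"
    let ?D = "{x..<b}" and ?Da = "{Suc a..<b}"
    have winD: "win n z y = ?Zb \<union> {z..<b}" if "z \<le> b" for z
    proof -
      have "{z..<y} = {b..<y} \<union> {z..<b}" using that crit by auto
      moreover have "(\<lambda>m. m mod n) ` {z..<b} = {z..<b}" using ab by force
      ultimately show ?thesis unfolding win_def by (simp add: image_Un)
    qed
    have notin: "c \<notin> win n z y" if c: "a \<le> c" "c < z" "z \<le> Suc b" for c z
    proof
      assume "c \<in> win n z y"
      then obtain m where m: "z \<le> m" "m < y" "c = m mod n" by (auto simp: win_def)
      have "c \<noteq> m" using c m by simp
      then have "n \<le> m" using m by (metis mod_less not_less)
      then have "m mod n = (m - n) mod n" by (simp add: le_mod_geq)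
      moreover have "m - n < n" using m crit ab by simp
      ultimately have "c = m - n" using m by simp
      then show False using m c crit \<open>n \<le> m\<close> by simp
    qed
    have Zb: "?Zb = insert b ?Zb'" using win_insert_first[of b y n] crit ab by simp
    have fixD: "(\<forall>B\<in>M. m \<notin> B) \<or> (\<forall>B\<in>M. m \<in> B)" if "m \<in> {z..<b}" "a < z" for m z
      using fixed[of m] that by simp
    \<comment> \<open>All positions strictly between \<open>a\<close> and \<open>b\<close> are loops
      or coloops, so removing \<open>{z..<b}\<close> lowers each rank by the same constant. This
      reduces the two conditions of \<open>rk_change\<close> to windows starting next to
      \<open>b\<close> and next to \<open>a\<close>.\<close>
    let ?c = "\<lambda>z. card {m \<in> {z..<b}. \<forall>B\<in>M. m \<in> B}"
    have add: "rk M (X \<union> {z..<b}) = rk M X + ?c z"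
      if "a < z" "{z..<b} \<inter> X = {}" for X z
      using fixD that by (intro M.rk_loops_coloops) auto
    have disj: "{z..<b} \<inter> ?Zb = {}" "{z..<b} \<inter> ?Zb' = {}" "{z..<b} \<inter> insert a ?Zb = {}" if "a < z" for z
      using that notin[of _ b] notin[of _ "Suc b"] by auto
    have e1: "rk M ?Z = rk M ?Zb + ?c x" using add[of x ?Zb] winD[of x] disj crit by simp
    have "?Z - {b} = ?Zb' \<union> ?D" using winD[of x] Zb notin[of b "Suc b"] crit ab by auto
    then have e2: "rk M (?Z - {b}) = rk M ?Zb' + ?c x" using add[of x ?Zb'] disj crit by simp
    have "insert a ?Z = insert a ?Zb \<union> ?D" using winD[of x] crit by auto
    then have e3: "rk M (insert a ?Z) = rk M (insert a ?Zb) + ?c x" using add[of x "insert a ?Zb"] disj crit by simp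
    have e4: "rk M (win n (Suc a) y) = rk M ?Zb + ?c (Suc a)" using add[of "Suc a" ?Zb] winD[of "Suc a"] disj crit ab by simp
    have "win n a y = insert a ?Zb \<union> ?Da" using winD[of "Suc a"] win_insert_first[of a y n] ab crit by auto
    then have e5: "rk M (win n a y) = rk M (insert a ?Zb) + ?c (Suc a)" using add[of "Suc a" "insert a ?Zb"] disj crit by simp
    \<comment> \<open>\<open>G b = F a\<close> decides whether \<open>b\<close> adds to the rank of
      the window after it, and \<open>G a = F b\<close> does the same for \<open>a\<close>.\<close>
    have r1: "rk M ?Zb = rk M ?Zb' + (if y \<le> F a then 1 else 0)"
      using rkM[of b y] rkM[of "Suc b" y] cnt_Suc[of b y G] Gab crit by simp
    have r2: "rk M (win n a y) = rk M (win n (Suc a) y) + (if y \<le> F b then 1 else 0)"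
      using rkM[of a y] rkM[of "Suc a" y] cnt_Suc[of a y G] Gab crit by simp
    have f1: "rk M ?Z = rk M (?Z - {b}) + (if y \<le> F a then 1 else 0)" using e1 e2 r1 by linarith
    have f2: "rk M (insert a ?Z) = rk M ?Z + (if y \<le> F b then 1 else 0)" using e1 e3 e4 e5 r2 by linarith
    have "b \<in> ?Z" "a \<notin> ?Z" using winD[of x] Zb notin[of a x] crit by auto
    then have "rk M' ?Z = rk M ?Z + (if rk M ?Z = rk M (?Z - {b}) \<and> rk M (insert a ?Z) = Suc (rk M ?Z) then 1 else 0)"
      by (rule rk_change)
    also have "\<dots> = rk M ?Z + (if \<not> y \<le> F a \<and> y \<le> F b then 1 else 0)"
      using f1 f2 by (cases "y \<le> F a"; cases "y \<le> F b") simp_all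
    also have "\<dots> = cnt F x y"
    proof -
      \<comment> \<open>Within the window \<open>F\<close> and \<open>G\<close> differ only at
        \<open>b\<close>, where \<open>G b = F a < F b\<close>; so \<open>b\<close> is the only
        position that can be newly counted.\<close>
      have "cnt F x y = card ({m \<in> {x..<y}. y \<le> G m} \<union> (if \<not> y \<le> F a \<and> y \<le> F b then {b} else {}))"
      proof -
        have "F m = G m" if "m \<in> {x..<y}" "m \<noteq> b" for m
        proof -
          have "m mod n \<noteq> a" using notin[of a x] that crit by (auto simp: win_def)
          moreover have "m mod n \<noteq> b"
          proof (cases "m < b")
            case True
            then show ?thesis using ab by simp
          next
            case False
            then have "m mod n \<in> win n (Suc b) y" using that by (auto simp: win_def)
            then show ?thesis using notin[of b "Suc b"] ab by auto
          qed
          ultimately have "m mod n \<noteq> a" "m mod n \<noteq> b" by auto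
          then show ?thesis using swap_res_simps(3)[OF ab, of m] by (simp add: G_def)
        qed
        then have "m \<in> {m \<in> {x..<y}. y \<le> F m} \<longleftrightarrow>
            m \<in> {m \<in> {x..<y}. y \<le> G m} \<union> (if \<not> y \<le> F a \<and> y \<le> F b then {b} else {})" for m
          using Gab Fab crit by (cases "m = b") auto
        then have "{m \<in> {x..<y}. y \<le> F m} = {m \<in> {x..<y}. y \<le> G m} \<union> (if \<not> y \<le> F a \<and> y \<le> F b then {b} else {})"
          unfolding set_eq_iff by (intro allI)
        then show ?thesis by (simp add: cnt_def)
      qed
      also have "\<dots> = cnt G x y + (if \<not> y \<le> F a \<and> y \<le> F b then 1 else 0)"
        using Gab unfolding cnt_def by (auto simp: card_insert_if)
      finally show ?thesis using rkM[OF xy(2,3)] by simp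
    qed
    finally show ?thesis .
  qed
  have rkall: "rk M' (win n x y) = cnt F x y" if "x \<le> y" "y \<le> x + n" for x y
  proof -
    \<comment> \<open>Windows and counts are both periodic, so the case of starting points below
      \<open>n\<close> suffices.\<close>
    have "win n (x0 + l * n) (y0 + l * n) = win n x0 y0 \<and> cnt F (x0 + l * n) (y0 + l * n) = cnt F x0 y0" for x0 y0 l
    proof (induction l)
      case (Suc l)
      then show ?case
        using win_shift[of n "x0 + l * n" "y0 + l * n"] cnt_shift[OF F, of "x0 + l * n" "y0 + l * n"]
        by (simp add: algebra_simps)
    qed simp
    note shift = this[of "x mod n" "x div n" "y - x div n * n"]
    have x: "x mod n + x div n * n = x" by simp
    then have y: "y - x div n * n + x div n * n = y" using that by linarith
    have "rk M' (win n (x mod n) (y - x div n * n)) = cnt F (x mod n) (y - x div n * n)"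
      using x y that n by (intro rk0) (simp, linarith+)
    then show ?thesis using shift unfolding x y by simp
  qed
  then show ?thesis unfolding realizes_def using A'(1) ne by (auto simp: M'_def k_def)
qed

lemma bounded_affine_realizable:
  assumes "bounded_affine n F" "0 < n"
  shows "\<exists>A. realizes n F A"
  using assms
\<comment> \<open>Displacements are at most \<open>n\<close>, so the constant bounds the sum of
  their squares, which every swap increases.\<close>
proof (induction "n * n\<^sup>2 - (\<Sum>m<n. (F m - m)\<^sup>2)" arbitrary: F rule: less_induct)
  case (less F)
  show ?case
  proof (cases "\<forall>m. F m = m \<or> F m = m + n")
    case True
    then show ?thesis using realize_fixed less.prems by blast
  next
    case False
    then obtain m0 where "F m0 \<noteq> m0" "F m0 \<noteq> m0 + n" by blast
    then obtain a b where ab: "a < b" "b < n" "b \<le> F a" "F a < F b" "F b \<le> a + n"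
      "\<forall>m. a < m \<longrightarrow> m < b \<longrightarrow> F m = m \<or> F m = m + n"
      by (rule exists_bridge[OF less.prems])
    let ?G = "F \<circ> swap_res n a b"
    have G: "bounded_affine n ?G" by (rule bounded_affine_swap) (use ab less.prems in auto)
    have "(\<Sum>m<n. (?G m - m)\<^sup>2) \<le> (\<Sum>m<n. n\<^sup>2)"
      using bounded_affineD(2)[OF G] by (intro sum_mono power_mono) (auto simp: le_diff_conv add.commute)
    then have "n * n\<^sup>2 - (\<Sum>m<n. (?G m - m)\<^sup>2) < n * n\<^sup>2 - (\<Sum>m<n. (F m - m)\<^sup>2)"
      using displacement_swap[OF ab(1-4)] by simp
    then obtain A where "realizes n ?G A" using less.hyps G less.prems(2) by blast
    then show ?thesis using realize_swap[OF less.prems(1) ab(1-5) ab(6)[rule_format]] by blast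
  qed
qed

section \<open>Realizing matroids without missing squares\<close>

locale nat_matroid = matroid k M for k and M :: "nat set set" +
  fixes n :: nat
  assumes ground: "B \<in> M \<Longrightarrow> B \<subseteq> {0..<n}" and n_pos: "0 < n"
begin

definition spanned :: "nat \<Rightarrow> nat \<Rightarrow> bool" where
  "spanned m j \<longleftrightarrow> rk M (win n m (Suc j)) = rk M (win n (Suc m) (Suc j))"

text \<open>The bounded affine permutation of the matroid: the first \<open>j\<close> for which
  \<open>m\<close> lies in the closure of \<open>m + 1, ..., j\<close>, read modulo
  \<open>n\<close>. It is \<open>m\<close> for a loop and \<open>m + n\<close> for a coloop.\<close>

definition perm :: "nat \<Rightarrow> nat" where
  "perm m = (LEAST j. m \<le> j \<and> spanned m j)"

lemma spanned_full: "spanned m (m + n)"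
  unfolding spanned_def using win_full[OF n_pos] by simp

lemma spanned_mono:
  assumes "m \<le> j" "j \<le> j'" "spanned m j"
  shows "spanned m j'"
proof -
  have "rk M (insert (m mod n) (win n (Suc m) (Suc j))) = rk M (win n (Suc m) (Suc j))"
    using assms(1,3) win_insert_first[of m "Suc j" n] by (simp add: spanned_def)
  then have "rk M (insert (m mod n) (win n (Suc m) (Suc j'))) = rk M (win n (Suc m) (Suc j'))"
    by (rule rk_insert_same_mono[OF _ win_mono]) (use assms(2) in auto)
  then show ?thesis using assms win_insert_first[of m "Suc j'" n] by (simp add: spanned_def)
qed

lemma perm_ge: "m \<le> perm m" and spanned_perm: "spanned m (perm m)"
proof -
  have "m \<le> perm m \<and> spanned m (perm m)"
    unfolding perm_def by (rule LeastI[of _ "m + n"]) (simp add: spanned_full)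
  then show "m \<le> perm m" "spanned m (perm m)" by auto
qed

lemma perm_le_iff: "m \<le> j \<Longrightarrow> perm m \<le> j \<longleftrightarrow> spanned m j"
  using perm_ge[of m] spanned_perm[of m] spanned_mono[of m "perm m" j]
  by (auto simp: perm_def intro: Least_le)

lemma perm_shift: "perm (m + n) = perm m + n"
proof (rule antisym)
  have sp: "spanned (m + n) (j + n) \<longleftrightarrow> spanned m j" for j
    unfolding spanned_def using win_shift[of n m "Suc j"] win_shift[of n "Suc m" "Suc j"] by simp
  show "perm (m + n) \<le> perm m + n" using sp perm_le_iff[of "m + n" "perm m + n"] perm_ge spanned_perm by simp
  have "m + n \<le> perm (m + n)" by (rule perm_ge)
  then obtain j where j: "perm (m + n) = j + n" "m \<le> j"
    by (intro that[of "perm (m + n) - n"]) auto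
  then have "spanned m j" using sp spanned_perm[of "m + n"] by simp
  then show "perm m + n \<le> perm (m + n)" using j perm_le_iff[of m j] by simp
qed

text \<open>Exchange property of closure: \<open>m\<close> enters the closure of
  \<open>m + 1, ..., j\<close> only with \<open>j\<close>, so \<open>j\<close> lies in the closure
  of \<open>m, ..., j - 1\<close> but not in that of \<open>m + 1, ..., j - 1\<close>. This
  determines \<open>m\<close> from \<open>j\<close> and is the source of injectivity.\<close>

lemma last_spanned:
  assumes "perm m = j" "m < j"
  shows "rk M (insert (j mod n) (win n m j)) = rk M (win n m j)"
    "rk M (insert (j mod n) (win n (Suc m) j)) \<noteq> rk M (win n (Suc m) j)"
proof -
  have 1: "rk M (win n m (Suc j)) = rk M (win n (Suc m) (Suc j))"
    using spanned_perm[of m] assms by (simp add: spanned_def)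
  have "m \<le> j - 1" "\<not> perm m \<le> j - 1" using assms by auto
  then have "\<not> spanned m (j - 1)" using perm_le_iff by blast
  then have ne: "rk M (win n m j) \<noteq> rk M (win n (Suc m) j)" using assms by (simp add: spanned_def)
  have f: "win n m j = insert (m mod n) (win n (Suc m) j)" using win_insert_first[of m j n] assms by simp
  have 2: "rk M (win n m j) = Suc (rk M (win n (Suc m) j))"
    using ne rk_insert_le[of "m mod n" "win n (Suc m) j"] rk_mono[of "win n (Suc m) j" "win n m j"]
    unfolding f by (auto simp: subset_insertI)
  have l: "win n m (Suc j) = insert (j mod n) (win n m j)"
    "win n (Suc m) (Suc j) = insert (j mod n) (win n (Suc m) j)"
    using win_insert_last[of m j n] win_insert_last[of "Suc m" j n] assms by auto
  have ge: "rk M (win n m j) \<le> rk M (win n m (Suc j))" unfolding l by (rule rk_mono) auto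
  have le: "rk M (win n (Suc m) (Suc j)) \<le> Suc (rk M (win n (Suc m) j))" unfolding l by (rule rk_insert_le)
  show "rk M (insert (j mod n) (win n m j)) = rk M (win n m j)"
    using 1 2 ge le l by simp
  show "rk M (insert (j mod n) (win n (Suc m) j)) \<noteq> rk M (win n (Suc m) j)"
    using 1 2 ge l by simp
qed

lemma perm_less_imp_neq:
  assumes "m < m'"
  shows "perm m \<noteq> perm m'"
proof
  assume eq: "perm m = perm m'"
  define j where "j = perm m'"
  have j: "m' \<le> j" unfolding j_def by (rule perm_ge)
  \<comment> \<open>If \<open>m' = j\<close>, then \<open>j\<close> is a loop and lies in every
    closure.\<close>
  have sp: "rk M (insert (j mod n) (win n m' j)) = rk M (win n m' j)"
  proof (cases "m' = j")
    case True
    then have "spanned j j" using spanned_perm[of m'] j_def by simp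
    then have "rk M (win n j (Suc j)) = rk M (win n (Suc j) (Suc j))" by (simp add: spanned_def)
    then show ?thesis using True by (simp add: win_def)
  next
    case False
    then show ?thesis using last_spanned(1)[of m' j] j j_def by simp
  qed
  have "rk M (insert (j mod n) (win n (Suc m) j)) = rk M (win n (Suc m) j)"
    using sp by (rule rk_insert_same_mono[OF _ win_mono]) (use assms in auto)
  then show False using last_spanned(2)[of m j] eq j assms by (simp add: j_def)
qed

lemma bounded_affine_perm: "bounded_affine n perm"
  unfolding bounded_affine_def
proof (intro conjI allI)
  show "inj perm" by (rule linorder_injI) (rule perm_less_imp_neq)
qed (use perm_ge perm_le_iff[of _ "_ + n"] spanned_full perm_shift in auto)

text \<open>Elements are added from right to left. Position \<open>x\<close> raises the rank exactly
  if it is not in the closure of the later elements of the window, that is, if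
  \<open>perm x \<ge> y\<close>.\<close>

lemma rk_win_eq_cnt: "x \<le> y \<Longrightarrow> rk M (win n x y) = cnt perm x y"
proof (induction "y - x" arbitrary: x)
  case 0
  then have "x = y" by simp
  then show ?case using rk_le[of "{}" 0] by (simp add: win_def)
next
  case (Suc d)
  then have xy: "x < y" by simp
  have IH: "rk M (win n (Suc x) y) = cnt perm (Suc x) y" using Suc by (intro Suc.hyps(1)) auto
  have f: "win n x y = insert (x mod n) (win n (Suc x) y)" by (rule win_insert_first[OF xy])
  have "x \<le> y - 1" "y \<le> perm x \<longleftrightarrow> \<not> perm x \<le> y - 1" using xy by auto
  then have "y \<le> perm x \<longleftrightarrow> \<not> spanned x (y - 1)" using perm_le_iff by blast
  also have "\<dots> \<longleftrightarrow> rk M (win n x y) \<noteq> rk M (win n (Suc x) y)" using xy by (simp add: spanned_def)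
  finally have "rk M (win n x y) = rk M (win n (Suc x) y) + (if y \<le> perm x then 1 else 0)"
    using rk_insert_le[of "x mod n" "win n (Suc x) y"] rk_mono[of "win n (Suc x) y" "win n x y"] f
    by (auto simp: subset_insertI)
  then show ?case using IH cnt_Suc[OF xy, of perm] by simp
qed

lemma rank_eq_cnt: "k = cnt perm 0 n"
proof -
  obtain B where B: "B \<in> M" using nonempty by blast
  have "win n 0 n = {0..<n}" by (simp add: win_no_wrap)
  then have "B \<inter> win n 0 n = B" using ground[OF B] by auto
  then have "k \<le> rk M (win n 0 n)" using card_Int_le_rk[OF B, of "win n 0 n"] card_basis[OF B] by simp
  then show ?thesis using rk_le_rank[of "win n 0 n"] rk_win_eq_cnt[of 0 n] by simp
qed

theorem realizable:
  assumes sq: "squares_filled M"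
  obtains A where "tnn k {0..<n} A" "supp k {0..<n} A = M"
proof -
  obtain A where "realizes n perm A"
    using bounded_affine_realizable[OF bounded_affine_perm n_pos] by blast
  then have A: "tnn k {0..<n} A" "supp k {0..<n} A \<noteq> {}"
    "\<And>x y. x \<le> y \<Longrightarrow> y \<le> x + n \<Longrightarrow> rk (supp k {0..<n} A) (win n x y) = rk M (win n x y)"
    unfolding realizes_def rank_eq_cnt[symmetric] using rk_win_eq_cnt by auto
  have "supp k {0..<n} A = win_bases k n (\<lambda>i j. rk (supp k {0..<n} A) (win n i j))"
    using supp_matroid[OF A(2)] supp_squares_filled[OF A(1)]
    by (intro squares_filled_imp_win_bases) (auto simp: supp_def)
  also have "\<dots> = win_bases k n (\<lambda>i j. rk M (win n i j))"
    unfolding win_bases_def using A(3) by auto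
  also have "\<dots> = M"
    using squares_filled_imp_win_bases[OF matroid_axioms ground sq] by simp
  finally show thesis using that A(1) by blast
qed

end

section \<open>Faces of matroid polytopes\<close>

definition index :: "'n::{finite,linorder} \<Rightarrow> nat" where
  "index x = card {y. y < x}"

lemma index_less_iff: "index x < index y \<longleftrightarrow> x < y"
proof -
  have "index x < index y" if "x < y" for x y :: 'a
    unfolding index_def using that by (intro psubset_card_mono) auto
  then show ?thesis by (metis less_asym linorder_neqE)
qed

lemma inj_index: "inj index"
  by (rule linorder_injI) (metis index_less_iff less_irrefl)

lemma index_less_CARD: "index (x :: 'n::{finite,linorder}) < CARD('n)"
  unfolding index_def by (intro psubset_card_mono) auto

lemma minor_reindex:
  fixes I :: "'n::{finite,linorder} set"
  assumes "card I = k"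
  shows "minor k (\<lambda>i x. A i (index x)) I = minor k A (index ` I)"
proof -
  let ?xs = "map index (sorted_list_of_set I)"
  have "sorted ?xs"
    unfolding sorted_map
    by (rule sorted_wrt_mono_rel[OF _ sorted_sorted_list_of_set]) (metis index_less_iff leD leI)
  moreover have "distinct ?xs"
    by (simp add: distinct_map inj_on_subset[OF inj_index])
  ultimately have sl: "sorted_list_of_set (index ` I) = ?xs"
    using sorted_list_of_set.idem_if_sorted_distinct[of ?xs] by simp
  then show ?thesis
    unfolding minor_def sl ldet_eq_det colmat_def using assms
    by (intro arg_cong[of _ _ Determinant.det] eq_matI) auto
qed

lemma max_minor_eq_minor: "max_minor k A I = minor k A I"
  by (simp add: max_minor_def minor_def ldet_def)

lemma is_positroid_iff:
  fixes \<B> :: "'n::{finite,linorder} set set"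
  shows "is_positroid k \<B> \<longleftrightarrow> (\<exists>A. tnn k UNIV A \<and> supp k UNIV A = \<B> \<and> \<B> \<noteq> {})"
  unfolding is_positroid_def max_minor_eq_minor tnn_def supp_def by auto

lemma is_matroid_bases_iff:
  fixes \<B> :: "'n::finite set set"
  shows "is_matroid_bases k \<B> \<longleftrightarrow> matroid k \<B>"
  unfolding is_matroid_bases_def matroid_def by auto

lemma positroid_imp_matroid: "is_positroid k \<B> \<Longrightarrow> matroid k \<B>"
  unfolding is_positroid_iff using supp_matroid by metis

lemma positroid_imp_squares_filled: "is_positroid k \<B> \<Longrightarrow> squares_filled \<B>"
  unfolding is_positroid_iff using supp_squares_filled by metis

text \<open>Windows need arithmetic modulo \<open>n\<close>, so the family is carried along the
  order isomorphism \<open>index\<close> to \<open>{0..<n}\<close> and realized there. The matrix is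
  pulled back; an increasing relabelling of columns preserves minors.\<close>

lemma squares_filled_imp_positroid:
  fixes \<B> :: "'n::{finite,linorder} set set"
  assumes M: "matroid k \<B>" and sq: "squares_filled \<B>"
  shows "is_positroid k \<B>"
proof -
  interpret B: matroid k \<B> by (rule M)
  define n where "n = CARD('n)"
  define M' where "M' = (`) index ` \<B>"
  have index_range: "range (index :: 'n \<Rightarrow> nat) = {0..<n}"
    using index_less_CARD unfolding n_def
    by (intro card_subset_eq) (auto simp: card_image[OF inj_index])
  have inj_im: "index ` I = index ` J \<longleftrightarrow> I = J" for I J :: "'n set"
    using inj_index by (rule inj_image_eq_iff)
  have M'_iff: "index ` I \<in> M' \<longleftrightarrow> I \<in> \<B>" for I using inj_im by (auto simp: M'_def)
  interpret M': nat_matroid k M' n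
  proof
    show "M' \<noteq> {}" using B.nonempty by (auto simp: M'_def)
    show "finite B" if "B \<in> M'" for B using that by (auto simp: M'_def)
    show "card B = k" if "B \<in> M'" for B
      using that B.card_basis by (auto simp: M'_def card_image[OF inj_on_subset[OF inj_index]])
    show "B \<subseteq> {0..<n}" if "B \<in> M'" for B using that index_range by (auto simp: M'_def)
    show "0 < n" by (simp add: n_def)
    fix B1 B2 x assume h: "B1 \<in> M'" "B2 \<in> M'" "x \<in> B1 - B2"
    then obtain C1 C2 z where C: "C1 \<in> \<B>" "C2 \<in> \<B>" "B1 = index ` C1" "B2 = index ` C2"
      "x = index z" "z \<in> C1" "z \<notin> C2" by (auto simp: M'_def)
    obtain y where y: "y \<in> C2 - C1" "insert y (C1 - {z}) \<in> \<B>" using B.exchange[OF C(1,2), of z] C by auto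
    have "insert (index y) (B1 - {x}) = index ` insert y (C1 - {z})"
      using C by (simp add: image_set_diff[OF inj_index])
    moreover have "index y \<in> B2 - B1" using y C by (simp add: inj_image_mem_iff[OF inj_index])
    ultimately show "\<exists>y\<in>B2 - B1. insert y (B1 - {x}) \<in> M'" using y(2) M'_iff by metis
  qed
  have "squares_filled M'"
    unfolding squares_filled_def
  proof (intro allI impI)
    fix S a b c d
    assume abcd: "a < b" "b < c" "c < d" "S \<inter> {a, b, c, d} = {}"
      and mem: "S \<union> {a, b} \<in> M'" "S \<union> {a, d} \<in> M'" "S \<union> {b, c} \<in> M'" "S \<union> {c, d} \<in> M'"
    have "S \<union> {a, b, c, d} \<subseteq> range (index :: 'n \<Rightarrow> nat)"
      using M'.ground[OF mem(1)] M'.ground[OF mem(4)] unfolding index_range by auto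
    then have ran: "S \<subseteq> range (index :: 'n \<Rightarrow> nat)" "a \<in> range (index :: 'n \<Rightarrow> nat)"
      "b \<in> range (index :: 'n \<Rightarrow> nat)" "c \<in> range (index :: 'n \<Rightarrow> nat)" "d \<in> range (index :: 'n \<Rightarrow> nat)" by auto
    from ran(2-5) obtain a' b' c' d' :: 'n where e: "a = index a'" "b = index b'" "c = index c'" "d = index d'"
      by (elim rangeE) blast
    define S' :: "'n set" where "S' = index -` S"
    have S': "S = index ` S'" unfolding S'_def using ran(1) by (simp add: image_vimage_eq Int_absorb2)
    have im: "S \<union> {index x, index y} = index ` (S' \<union> {x, y})" for x y using S' by auto
    have "a' < b'" "b' < c'" "c' < d'" using abcd e index_less_iff by auto
    moreover have "S' \<inter> {a', b', c', d'} = {}" using abcd(4) S' e by auto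
    moreover have "S' \<union> {a', b'} \<in> \<B>" "S' \<union> {a', d'} \<in> \<B>" "S' \<union> {b', c'} \<in> \<B>" "S' \<union> {c', d'} \<in> \<B>"
      using mem unfolding e im M'_iff by auto
    ultimately have "S' \<union> {a', c'} \<in> \<B> \<and> S' \<union> {b', d'} \<in> \<B>"
      using sq unfolding squares_filled_def by blast
    then show "S \<union> {a, c} \<in> M' \<and> S \<union> {b, d} \<in> M'" unfolding e im M'_iff .
  qed
  then obtain A where A: "tnn k {0..<n} A" "supp k {0..<n} A = M'" using M'.realizable by blast
  define A' where "A' i x = A i (index x)" for i and x :: 'n
  have mA: "minor k A' I = minor k A (index ` I)" if "card I = k" for I :: "'n set"
    unfolding A'_def by (rule minor_reindex[OF that])
  have card_im: "card (index ` I) = card I" for I :: "'n set"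
    by (rule card_image[OF inj_on_subset[OF inj_index]]) simp
  have sub: "index ` I \<subseteq> {0..<n}" for I :: "'n set" using index_range by auto
  have "tnn k UNIV A'"
    using A(1) mA card_im sub unfolding tnn_def by auto
  moreover have "supp k UNIV A' = \<B>"
  proof (rule Set.set_eqI)
    fix I :: "'n set"
    have "I \<in> supp k UNIV A' \<longleftrightarrow> index ` I \<in> supp k {0..<n} A"
      using mA[of I] card_im[of I] sub[of I] by (auto simp: supp_def)
    then show "I \<in> supp k UNIV A' \<longleftrightarrow> I \<in> \<B>" using A(2) M'_iff by simp
  qed
  ultimately show ?thesis unfolding is_positroid_iff using B.nonempty by blast
qed

section \<open>Faces as families of maximal weight\<close>

lemma inner_indic_vec: "w \<bullet> indic_vec I = (\<Sum>i\<in>I. vec_nth w i)"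
  unfolding inner_vec_def indic_vec_def by (simp add: sum.If_cases if_distrib cong: if_cong)

lemma vec_nth_indic_vec: "vec_nth (indic_vec I) i = (if i \<in> I then 1 else 0)"
  by (simp add: indic_vec_def)

lemma indic_vec_inject [simp]: "indic_vec I = indic_vec J \<longleftrightarrow> I = J"
proof
  assume "indic_vec I = indic_vec J"
  then have "vec_nth (indic_vec I) i = vec_nth (indic_vec J) i" for i by simp
  then show "I = J" unfolding vec_nth_indic_vec by (auto split: if_splits) (metis zero_neq_one)+
qed simp

lemma convex_hull_Int_hyperplane:
  fixes S :: "'a::euclidean_space set"
  assumes S: "finite S" "\<And>x. x \<in> S \<Longrightarrow> a \<bullet> x \<le> c"
  shows "convex hull S \<inter> {x. a \<bullet> x = c} = convex hull (S \<inter> {x. a \<bullet> x = c})"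
    "convex hull (S \<inter> {x. a \<bullet> x = c}) face_of convex hull S"
proof -
  have "convex hull S \<subseteq> {x. a \<bullet> x \<le> c}"
    by (rule hull_minimal) (use S(2) convex_halfspace_le in auto)
  then have face: "convex hull S \<inter> {x. a \<bullet> x = c} face_of convex hull S"
    by (intro face_of_Int_supporting_hyperplane_le) auto
  show eq: "convex hull S \<inter> {x. a \<bullet> x = c} = convex hull (S \<inter> {x. a \<bullet> x = c})"
  proof
    obtain S' where S': "S' \<subseteq> S" "convex hull S \<inter> {x. a \<bullet> x = c} = convex hull S'"
      by (rule face_of_convex_hull_subset[OF finite_imp_compact[OF S(1)] face])
    then have "S' \<subseteq> S \<inter> {x. a \<bullet> x = c}" using hull_subset[of S' convex] by auto
    then show "convex hull S \<inter> {x. a \<bullet> x = c} \<subseteq> convex hull (S \<inter> {x. a \<bullet> x = c})"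
      unfolding S'(2) by (rule hull_mono)
    have "convex hull (S \<inter> {x. a \<bullet> x = c}) \<subseteq> {x. a \<bullet> x = c}"
      by (rule hull_minimal) (use convex_hyperplane in auto)
    then show "convex hull (S \<inter> {x. a \<bullet> x = c}) \<subseteq> convex hull S \<inter> {x. a \<bullet> x = c}"
      using hull_mono[of "S \<inter> {x. a \<bullet> x = c}" S convex] by auto
  qed
  show "convex hull (S \<inter> {x. a \<bullet> x = c}) face_of convex hull S" using face unfolding eq .
qed

lemma matroid_polytope_face:
  fixes w :: "'n::finite \<Rightarrow> real"
  assumes "\<And>I. I \<in> \<B> \<Longrightarrow> sum w I \<le> c"
  shows "matroid_polytope {I \<in> \<B>. sum w I = c} face_of matroid_polytope \<B>"
proof -
  let ?w = "vec_lambda w"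
  have ip: "?w \<bullet> indic_vec I = sum w I" for I by (simp add: inner_indic_vec)
  have "indic_vec ` {I \<in> \<B>. sum w I = c} = indic_vec ` \<B> \<inter> {x. ?w \<bullet> x = c}" using ip by auto
  then show ?thesis
    unfolding matroid_polytope_def using assms ip
    by (simp only:) (rule convex_hull_Int_hyperplane(2), auto)
qed

text \<open>All faces of a polytope are exposed, and a supporting functional is a weight on the
  ground set. The bound \<open>c\<close> need not be attained; then \<open>F\<close> is the empty
  face.\<close>

lemma matroid_polytope_face_cases:
  fixes \<B> :: "'n::finite set set"
  assumes F: "F face_of matroid_polytope \<B>"
  obtains w :: "'n \<Rightarrow> real" and c where "\<forall>I\<in>\<B>. sum w I \<le> c"
    "F = matroid_polytope {I \<in> \<B>. sum w I = c}"
proof -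
  have fin: "finite (indic_vec ` \<B>)" by simp
  then have "polyhedron (matroid_polytope \<B>)"
    unfolding matroid_polytope_def by (intro polytope_imp_polyhedron polytope_convex_hull)
  then have "F exposed_face_of matroid_polytope \<B>" using F exposed_face_of_polyhedron by blast
  then obtain a c where ac: "matroid_polytope \<B> \<subseteq> {x. a \<bullet> x \<le> c}" "F = matroid_polytope \<B> \<inter> {x. a \<bullet> x = c}"
    unfolding exposed_face_of_def by blast
  let ?w = "vec_nth a"
  have ip: "a \<bullet> indic_vec I = sum ?w I" for I by (rule inner_indic_vec)
  have le: "a \<bullet> indic_vec I \<le> c" if "I \<in> \<B>" for I
    using ac(1) hull_subset[of "indic_vec ` \<B>" convex] that unfolding matroid_polytope_def by auto
  have "indic_vec ` {I \<in> \<B>. sum ?w I = c} = indic_vec ` \<B> \<inter> {x. a \<bullet> x = c}" using ip by auto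
  then have "F = matroid_polytope {I \<in> \<B>. sum ?w I = c}"
    using ac(2) convex_hull_Int_hyperplane(1)[OF fin, of a c] le unfolding matroid_polytope_def by auto
  moreover have "\<forall>I\<in>\<B>. sum ?w I \<le> c" using le ip by simp
  ultimately show thesis using that by blast
qed

text \<open>The inner product with \<open>indic_vec I\<close> counts common elements: it is
  \<open>k\<close> at \<open>I\<close> and at most \<open>k - 1\<close> at every other member, as
  all have the same size. So no generator lies in the hull of the others.\<close>

lemma extreme_points_matroid_polytope:
  fixes \<B> :: "'n::finite set set"
  assumes card: "\<And>I. I \<in> \<B> \<Longrightarrow> card I = k"
  shows "{v. v extreme_point_of matroid_polytope \<B>} = indic_vec ` \<B>"
proof -
  have "a \<notin> convex hull (indic_vec ` \<B> - {a})" if a: "a \<in> indic_vec ` \<B>" for a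
  proof -
    obtain I where I: "I \<in> \<B>" "a = indic_vec I" using a by blast
    have ip: "indic_vec I \<bullet> indic_vec J = real (card (I \<inter> J))" for J
      unfolding inner_indic_vec vec_nth_indic_vec by (simp add: sum.If_cases Int_commute)
    have "indic_vec ` \<B> - {a} \<subseteq> {x. indic_vec I \<bullet> x \<le> real k - 1}"
    proof clarify
      fix J assume J: "J \<in> \<B>" "indic_vec J \<noteq> a"
      have "I \<inter> J \<subset> I"
      proof -
        have "I \<noteq> J" "card I = card J" using I J card by auto
        then show ?thesis using card_subset_eq[of J I] by auto
      qed
      then have "card (I \<inter> J) < k" using card[OF I(1)] psubset_card_mono[of I "I \<inter> J"] by simp
      then show "indic_vec I \<bullet> indic_vec J \<le> real k - 1" unfolding ip by simp
    qed
    then have "convex hull (indic_vec ` \<B> - {a}) \<subseteq> {x. indic_vec I \<bullet> x \<le> real k - 1}"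
      by (rule hull_minimal) (rule convex_halfspace_le)
    moreover have "indic_vec I \<bullet> a = real k" unfolding I(2) ip using card[OF I(1)] by simp
    ultimately show ?thesis by auto
  qed
  then show ?thesis
    unfolding matroid_polytope_def
    by (subst extreme_point_of_convex_hull_convex_independent) (auto simp: finite_imp_compact)
qed

lemma matroid_polytope_inject:
  fixes \<B> \<B>' :: "'n::finite set set"
  assumes "\<And>I. I \<in> \<B> \<Longrightarrow> card I = k" "\<And>I. I \<in> \<B>' \<Longrightarrow> card I = k'" "matroid_polytope \<B> = matroid_polytope \<B>'"
  shows "\<B> = \<B>'"
proof -
  have "indic_vec ` \<B> = indic_vec ` \<B>'"
    using extreme_points_matroid_polytope[of \<B>, OF assms(1)] extreme_points_matroid_polytope[of \<B>', OF assms(2)]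
      assms(3) by simp
  moreover have "inj (indic_vec :: 'n set \<Rightarrow> _)" by (rule injI) simp
  ultimately show ?thesis by (simp add: inj_image_eq_iff)
qed

lemma square_face:
  fixes \<B> :: "'n::finite set set"
  assumes M: "matroid k \<B>" and dist: "distinct [p, q, r, s]" and S: "S \<inter> {p, q, r, s} = {}"
    and mem: "S \<union> {p, r} \<in> \<B>" "S \<union> {p, s} \<in> \<B>" "S \<union> {q, r} \<in> \<B>" "S \<union> {q, s} \<in> \<B>"
    and no: "S \<union> {p, q} \<notin> \<B>"
  shows "matroid_polytope {S \<union> {p, r}, S \<union> {p, s}, S \<union> {q, r}, S \<union> {q, s}} face_of matroid_polytope \<B>"
proof -
  interpret matroid k \<B> by (rule M)
  \<comment> \<open>Sets of size \<open>k\<close> have weight at most \<open>2 * card S + 2\<close>,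
    and only \<open>S \<union> {p, q}\<close> reaches it. Without that set the maximum is
    \<open>c\<close>, attained exactly by \<open>S\<close> with one of \<open>p, q\<close> and one
    of \<open>r, s\<close>. The other diagonal \<open>S \<union> {r, s}\<close> is too light, so it
    stays off the face whether or not it is a basis.\<close>
  define w :: "'n \<Rightarrow> real" where
    "w i = (if i \<in> S then 2 else if i \<in> {p, q} then 1 else if i \<in> {r, s} then 0 else -1)" for i
  define c where "c = 2 * real (card S) + 1"
  let ?T = "S \<union> {p, q} \<union> {r, s}"
  have k: "k = card S + 2" using card_basis[OF mem(1)] dist S by auto
  have split: "I = (I \<inter> S) \<union> ((I \<inter> {p, q}) \<union> ((I \<inter> {r, s}) \<union> (I - ?T)))" for I by auto
  have sum: "sum g I = sum g (I \<inter> S) + (sum g (I \<inter> {p, q}) + (sum g (I \<inter> {r, s}) + sum g (I - ?T)))"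
    for g :: "'n \<Rightarrow> real" and I
  proof -
    have "sum g I = sum g ((I \<inter> S) \<union> ((I \<inter> {p, q}) \<union> ((I \<inter> {r, s}) \<union> (I - ?T))))"
      using split[of I] by simp
    also have "\<dots> = sum g (I \<inter> S) + (sum g (I \<inter> {p, q}) + (sum g (I \<inter> {r, s}) + sum g (I - ?T)))"
      using dist S by (subst sum.union_disjoint, auto)+
    finally show ?thesis .
  qed
  have w_sum: "sum w I = 2 * real (card (I \<inter> S)) + real (card (I \<inter> {p, q})) - real (card (I - ?T))" for I
  proof -
    have "sum w (I \<inter> S) = (\<Sum>i\<in>I \<inter> S. 2)" by (intro sum.cong) (auto simp: w_def)
    moreover have "sum w (I \<inter> {p, q}) = (\<Sum>i\<in>I \<inter> {p, q}. 1)" using S by (intro sum.cong) (auto simp: w_def)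
    moreover have "sum w (I \<inter> {r, s}) = (\<Sum>i\<in>I \<inter> {r, s}. 0)" using S dist by (intro sum.cong) (auto simp: w_def)
    moreover have "sum w (I - ?T) = (\<Sum>i\<in>I - ?T. - 1)" by (intro sum.cong) (auto simp: w_def)
    ultimately show ?thesis unfolding sum[of w I] by simp
  qed
  have cards: "card (I \<inter> S) + card (I \<inter> {p, q}) + card (I \<inter> {r, s}) + card (I - ?T) = card S + 2" if "I \<in> \<B>" for I
    using sum[of "\<lambda>_. 1" I] card_basis[OF that] k by simp
  have le_S: "card (I \<inter> S) \<le> card S" for I by (intro card_mono) auto
  have pq2: "card {p, q} = 2" "card {r, s} = 2" using dist by auto
  have le2: "card (I \<inter> {p, q}) \<le> 2" "card (I \<inter> {r, s}) \<le> 2" for I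
    using card_mono[of "{p, q}" "I \<inter> {p, q}"] card_mono[of "{r, s}" "I \<inter> {r, s}"] pq2 by auto
  have not_pq: "\<not> (card (I \<inter> S) = card S \<and> card (I \<inter> {p, q}) = 2)" if I: "I \<in> \<B>" for I
  proof
    assume h: "card (I \<inter> S) = card S \<and> card (I \<inter> {p, q}) = 2"
    have "I \<inter> S = S" by (rule card_subset_eq) (use h in auto)
    moreover have "I \<inter> {p, q} = {p, q}" by (rule card_subset_eq) (use h pq2 in auto)
    moreover have "I \<inter> {r, s} = {}" "I - ?T = {}" using h cards[OF I] by auto
    ultimately have "I = S \<union> {p, q}" using split[of I] by auto
    then show False using no I by simp
  qed
  have le: "sum w I \<le> c" if I: "I \<in> \<B>" for I
    unfolding w_sum c_def using cards[OF I] le_S[of I] le2[of I] not_pq[OF I] by linarith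
  have "{I \<in> \<B>. sum w I = c} = {S \<union> {p, r}, S \<union> {p, s}, S \<union> {q, r}, S \<union> {q, s}}"
  proof (intro equalityI subsetI)
    fix I assume "I \<in> {I \<in> \<B>. sum w I = c}"
    then have I: "I \<in> \<B>" "sum w I = c" by auto
    have num: "card (I \<inter> S) = card S" "card (I \<inter> {p, q}) = 1" "card (I \<inter> {r, s}) = 1" "card (I - ?T) = 0"
      using cards[OF I(1)] le_S[of I] le2[of I] not_pq[OF I(1)] I(2)[unfolded w_sum c_def] by linarith+
    have "I \<inter> S = S" using num(1) by (intro card_subset_eq) auto
    moreover have "I - ?T = {}" using num(4) by simp
    moreover obtain x where x: "I \<inter> {p, q} = {x}" using num(2) by (rule card_1_singletonE)
    moreover obtain y where y: "I \<inter> {r, s} = {y}" using num(3) by (rule card_1_singletonE)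
    ultimately have "I = S \<union> {x, y}" using split[of I] by auto
    moreover have "x = p \<or> x = q" "y = r \<or> y = s" using x y by blast+
    ultimately show "I \<in> {S \<union> {p, r}, S \<union> {p, s}, S \<union> {q, r}, S \<union> {q, s}}" by blast
  next
    fix I assume I: "I \<in> {S \<union> {p, r}, S \<union> {p, s}, S \<union> {q, r}, S \<union> {q, s}}"
    have "I \<inter> S = S" "I - ?T = {}" "card (I \<inter> {p, q}) = 1" using I S dist by auto
    then have "sum w I = c" unfolding w_sum c_def by simp
    then show "I \<in> {I \<in> \<B>. sum w I = c}" using I mem by auto
  qed
  then show ?thesis using matroid_polytope_face[of \<B> w c] le by simp
qed

text \<open>The four points form a parallelogram: the last is the second plus the third minus the
  first. The coordinate \<open>c\<close> keeps the third off the line through the first two.\<close>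

lemma aff_dim_square:
  fixes S :: "'n::finite set"
  assumes dist: "distinct [a, b, c, d]" and S: "S \<inter> {a, b, c, d} = {}"
  shows "aff_dim (matroid_polytope {S \<union> {a, b}, S \<union> {a, d}, S \<union> {b, c}, S \<union> {c, d}}) = 2"
proof -
  let ?p = "indic_vec (S \<union> {a, b})" and ?q = "indic_vec (S \<union> {a, d})"
    and ?r = "indic_vec (S \<union> {b, c})" and ?s = "indic_vec (S \<union> {c, d})"
  have e: "?s = (-1) *\<^sub>R ?p + 1 *\<^sub>R ?q + 1 *\<^sub>R ?r"
    using dist S by (intro Finite_Cartesian_Product.vec_eq_iff[THEN iffD2] allI) (auto simp: vec_nth_indic_vec)
  have s: "?s \<in> affine hull {?p, ?q, ?r}"
    unfolding affine_hull_3 mem_Collect_eq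
    by (rule exI[of _ "-1"], rule exI[of _ 1], rule exI[of _ 1]) (use e in simp)
  have r: "?r \<notin> affine hull {?p, ?q}"
  proof
    assume "?r \<in> affine hull {?p, ?q}"
    then obtain u v where "?r = u *\<^sub>R ?p + v *\<^sub>R ?q" unfolding affine_hull_2 by blast
    then have "vec_nth ?r c = vec_nth (u *\<^sub>R ?p + v *\<^sub>R ?q) c" by simp
    then show False using dist S by (auto simp: vec_nth_indic_vec)
  qed
  have q: "?q \<notin> affine hull {?p}" using dist S by auto
  have "matroid_polytope {S \<union> {a, b}, S \<union> {a, d}, S \<union> {b, c}, S \<union> {c, d}} = convex hull {?s, ?r, ?q, ?p}"
    unfolding matroid_polytope_def by (simp add: insert_commute)
  moreover have "aff_dim {?s, ?r, ?q, ?p} = 2"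
  proof -
    have eq: "{?r, ?q, ?p} = {?p, ?q, ?r}" "{?q, ?p} = {?p, ?q}" by blast+
    have s': "?s \<in> affine hull {?r, ?q, ?p}" unfolding eq(1) by (rule s)
    have r': "?r \<notin> affine hull {?q, ?p}" unfolding eq(2) by (rule r)
    have "aff_dim {?s, ?r, ?q, ?p} = aff_dim {?r, ?q, ?p}"
      unfolding aff_dim_insert[of ?s] by (simp only: s' if_True)
    moreover have "aff_dim {?r, ?q, ?p} = aff_dim {?q, ?p} + 1"
      unfolding aff_dim_insert[of ?r] by (simp only: r' if_False)
    moreover have "aff_dim {?q, ?p} = aff_dim {?p} + 1"
      unfolding aff_dim_insert[of ?q] by (simp only: q if_False)
    ultimately show ?thesis by simp
  qed
  ultimately show ?thesis by (simp add: aff_dim_convex_hull)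
qed

lemma missing_square_face:
  fixes \<B> :: "'n::{finite,linorder} set set"
  assumes M: "matroid k \<B>" and "\<not> squares_filled \<B>"
  obtains S a b c d where "a < b" "b < c" "c < d" "S \<inter> {a, b, c, d} = {}" "k = card S + 2"
    "matroid_polytope {S \<union> {a, b}, S \<union> {a, d}, S \<union> {b, c}, S \<union> {c, d}} face_of matroid_polytope \<B>"
proof -
  obtain S a b c d where abcd: "a < b" "b < c" "c < d" "S \<inter> {a, b, c, d} = {}"
    and mem: "S \<union> {a, b} \<in> \<B>" "S \<union> {a, d} \<in> \<B>" "S \<union> {b, c} \<in> \<B>" "S \<union> {c, d} \<in> \<B>"
    and no: "S \<union> {a, c} \<notin> \<B> \<or> S \<union> {b, d} \<notin> \<B>"
    using assms(2) unfolding squares_filled_def by blast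
  have k: "k = card S + 2" using matroid.card_basis[OF M mem(1)] abcd by auto
  have "matroid_polytope {S \<union> {a, b}, S \<union> {a, d}, S \<union> {b, c}, S \<union> {c, d}} face_of matroid_polytope \<B>"
    using no
  proof
    \<comment> \<open>\<open>square_face\<close> wants the missing diagonal as
      \<open>{p, q}\<close>, so the assignment of roles depends on which diagonal is
      missing.\<close>
    assume "S \<union> {a, c} \<notin> \<B>"
    then have "matroid_polytope {S \<union> {a, b}, S \<union> {a, d}, S \<union> {c, b}, S \<union> {c, d}} face_of matroid_polytope \<B>"
      using abcd mem by (intro square_face[OF M]) (auto simp: insert_commute)
    then show ?thesis by (simp add: insert_commute)
  next
    assume "S \<union> {b, d} \<notin> \<B>"
    then have "matroid_polytope {S \<union> {b, a}, S \<union> {b, c}, S \<union> {d, a}, S \<union> {d, c}} face_of matroid_polytope \<B>"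
      using abcd mem by (intro square_face[OF M]) (auto simp: insert_commute)
    then show ?thesis by (simp add: insert_commute)
  qed
  then show thesis using that abcd k by blast
qed

lemma face_of_positroid:
  fixes \<B> :: "'n::{finite,linorder} set set"
  assumes pos: "is_positroid k \<B>" and F: "F face_of matroid_polytope \<B>" "F \<noteq> {}"
  shows "is_positroid_polytope F"
proof -
  obtain w :: "'n \<Rightarrow> real" and c where w: "\<forall>I\<in>\<B>. sum w I \<le> c"
    "F = matroid_polytope {I \<in> \<B>. sum w I = c}" by (rule matroid_polytope_face_cases[OF F(1)])
  obtain A where A: "tnn k UNIV A" "supp k UNIV A = \<B>" using pos unfolding is_positroid_iff by blast
  obtain B0 where B0: "B0 \<in> \<B>" "sum w B0 = c"
    using F(2) w(2) by (auto simp: matroid_polytope_def)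
  obtain A2 where A2: "tnn k UNIV A2" "supp k UNIV A2 = {B \<in> supp k UNIV A. sum w B = sum w B0}"
  proof (rule initial_tnn[OF A(1)])
    show "B0 \<in> supp k UNIV A" using A(2) B0 by simp
    show "sum w B \<le> sum w B0" if "B \<in> supp k UNIV A" for B using that w(1) A(2) B0(2) by simp
  qed
  have "is_positroid k {I \<in> \<B>. sum w I = c}"
    unfolding is_positroid_iff using A2 A(2) B0 by (intro exI[of _ A2]) auto
  then show ?thesis unfolding is_positroid_polytope_def using w(2) by blast
qed

theorem theorem3p4:
  fixes \<B> :: "'n::{finite,linorder} set set" and k :: nat
  assumes "is_matroid_bases k \<B>"
  shows "(is_positroid k \<B> \<longleftrightarrow>
            (\<forall>F. F face_of matroid_polytope \<B> \<and> aff_dim F = 2 \<longrightarrow> is_positroid_polytope F))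
       \<and> (\<not> is_positroid k \<B> \<longrightarrow>
            (\<exists>F a b c d S. F face_of matroid_polytope \<B> \<and> aff_dim F = 2 \<and>
               a < b \<and> b < c \<and> c < d \<and> card S = k - 2 \<and> S \<inter> {a, b, c, d} = {} \<and>
               {v. v extreme_point_of F} =
                 {indic_vec (S \<union> {a, b}), indic_vec (S \<union> {a, d}),
                  indic_vec (S \<union> {b, c}), indic_vec (S \<union> {c, d})}))"
proof -
  have M: "matroid k \<B>" using assms is_matroid_bases_iff by blast
  \<comment> \<open>Recording that \<open>F\<close> is no positroid polytope lets this one face
    settle both the second claim and the converse direction of the equivalence.\<close>
  have square: "\<exists>F a b c d S. F face_of matroid_polytope \<B> \<and> aff_dim F = 2 \<and>
               a < b \<and> b < c \<and> c < d \<and> card S = k - 2 \<and> S \<inter> {a, b, c, d} = {} \<and>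
               {v. v extreme_point_of F} =
                 {indic_vec (S \<union> {a, b}), indic_vec (S \<union> {a, d}),
                  indic_vec (S \<union> {b, c}), indic_vec (S \<union> {c, d})} \<and> \<not> is_positroid_polytope F"
    if "\<not> is_positroid k \<B>"
  proof -
    have "\<not> squares_filled \<B>" using that squares_filled_imp_positroid[OF M] by blast
    then obtain S a b c d where abcd: "a < b" "b < c" "c < d" "S \<inter> {a, b, c, d} = {}" "k = card S + 2"
      and face: "matroid_polytope {S \<union> {a, b}, S \<union> {a, d}, S \<union> {b, c}, S \<union> {c, d}} face_of matroid_polytope \<B>"
      by (rule missing_square_face[OF M])
    define N where "N = {S \<union> {a, b}, S \<union> {a, d}, S \<union> {b, c}, S \<union> {c, d}}"
    have card_N: "card I = k" if "I \<in> N" for I using that abcd by (auto simp: N_def)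
    have not_pos: "\<not> is_positroid_polytope (matroid_polytope N)"
    proof
      assume "is_positroid_polytope (matroid_polytope N)"
      then obtain k' N' where N': "is_positroid k' N'" "matroid_polytope N = matroid_polytope N'"
        unfolding is_positroid_polytope_def by blast
      \<comment> \<open>The vertices of the polytope determine its family, so \<open>N\<close>
        itself would be a positroid and would have to contain its diagonals.\<close>
      have "N = N'"
        using matroid_polytope_inject[OF card_N _ N'(2)] matroid.card_basis[OF positroid_imp_matroid[OF N'(1)]] by blast
      then have sq: "squares_filled N" using positroid_imp_squares_filled[OF N'(1)] by simp
      have "crossing a c b d" using abcd(1-3) by (auto simp: crossing_def btw_def)
      then have "S \<union> {a, c} \<in> N"
        by (rule squares_filledD[OF sq]) (use abcd(4) in \<open>auto simp: N_def\<close>)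
      moreover have "b \<in> I \<or> d \<in> I" if "I \<in> N" for I using that by (auto simp: N_def)
      ultimately have "b \<in> S \<union> {a, c} \<or> d \<in> S \<union> {a, c}" by blast
      then show False using abcd by auto
    qed
    have "{v. v extreme_point_of matroid_polytope N} = indic_vec ` N"
      by (rule extreme_points_matroid_polytope[OF card_N])
    moreover have "aff_dim (matroid_polytope N) = 2"
      unfolding N_def using abcd by (intro aff_dim_square) auto
    moreover have "indic_vec ` N = {indic_vec (S \<union> {a, b}), indic_vec (S \<union> {a, d}),
        indic_vec (S \<union> {b, c}), indic_vec (S \<union> {c, d})}"
      unfolding N_def by (simp only: image_insert image_empty)
    moreover have "card S = k - 2" using abcd(5) by simp
    ultimately have props: "{v. v extreme_point_of matroid_polytope N} = {indic_vec (S \<union> {a, b}), indic_vec (S \<union> {a, d}),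
        indic_vec (S \<union> {b, c}), indic_vec (S \<union> {c, d})}" "aff_dim (matroid_polytope N) = 2" "card S = k - 2"
      by (simp_all only:)
    show ?thesis
      by (rule exI[of _ "matroid_polytope N"], rule exI[of _ a], rule exI[of _ b],
          rule exI[of _ c], rule exI[of _ d], rule exI[of _ S], intro conjI)
        (fact abcd face[folded N_def] not_pos props)+
  qed
  have faces: "is_positroid_polytope F" if "is_positroid k \<B>" "F face_of matroid_polytope \<B>" "aff_dim F = 2" for F
  proof (rule face_of_positroid[OF that(1,2)])
    show "F \<noteq> {}"
    proof
      assume "F = {}"
      then show False using that(3) by simp
    qed
  qed
  show ?thesis
  proof (intro conjI iffI allI impI)
    fix F assume "is_positroid k \<B>" "F face_of matroid_polytope \<B> \<and> aff_dim F = 2"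
    then show "is_positroid_polytope F" using faces by blast
  next
    assume "\<forall>F. F face_of matroid_polytope \<B> \<and> aff_dim F = 2 \<longrightarrow> is_positroid_polytope F"
    then show "is_positroid k \<B>" using square by meson
  next
    assume "\<not> is_positroid k \<B>"
    from square[OF this] show "\<exists>F a b c d S. F face_of matroid_polytope \<B> \<and> aff_dim F = 2 \<and>
               a < b \<and> b < c \<and> c < d \<and> card S = k - 2 \<and> S \<inter> {a, b, c, d} = {} \<and>
               {v. v extreme_point_of F} =
                 {indic_vec (S \<union> {a, b}), indic_vec (S \<union> {a, d}),
                  indic_vec (S \<union> {b, c}), indic_vec (S \<union> {c, d})}"
      by meson
  qed
qed

end
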